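(* Let $G$ be a Lagrangian grid diagram having a marking in its upper-right cell, and let $\{c_i\}$ be its crossings. Then for any $M>0$ there is a Lagrangian grid diagram $G'$, representing the same topological knot and having the same rotation number as $G$, such that $|\Delta t(c'_i)|>M$ for every crossing $c'_i$ of $G'$.
   Context: In the plane with coordinates $(w,y)$, an immersed grid diagram of size $n$ is an $n\times n$ grid of unit cells in $[0,n]^2$ with two kinds of markings at centers of cells, each row and each column containing exactly one marking of each kind; joining each marking of the first kind to the marking of the second kind in its row by a $w$-parallel segment, and each marking of the second kind to the marking of the first kind in its column by a $y$-parallel segment, gives an oriented connected closed piecewise-linear curve with no crossing information, viewed as an immersion $\gamma:\mathbb{R}/2\pi\mathbb{Z}\to\mathbb{R}^2$, $\theta\mapsto(w(\theta),y(\theta))$. It is a Lagrangian grid diagram if (1) $\int_0^{2\pi}y\,w'\,d\theta=0$ and (2) $\int_{\theta_0}^{\theta_1}y\,w'\,d\theta\neq0$ whenever $\theta_0\neq\theta_1$ and $\gamma(\theta_0)=\gamma(\theta_1)$. A crossing is a point $c=\gamma(\theta_0)=\gamma(\theta_1)$ with $\theta_0\neq\theta_1$, and $|\Delta t(c)|=|\int_{\theta_0}^{\theta_1}y\,w'\,d\theta|$. The knot represented by $G$ is the topological type of its Legendrian lift $\theta\mapsto(w,y,\int_0^\theta y\,w')$ in $\mathbb{R}^3$ (contact form $dt-y\,dw$), and the rotation number is $\frac14(\#\text{counterclockwise corners}-\#\text{clockwise corners})$, corners being the markings, counterclockwise meaning the curve turns left there. The upper-right cell is $[n-1,n]^2$.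 *)

theory Defs
  imports "HOL-Analysis.Analysis"
begin

text \<open>An immersed grid diagram of size n. Columns and rows are indexed by 0..n-1;
  column c is the strip [c,c+1] in the w-direction, row r the strip [r,r+1] in the
  y-direction. The marking of the first kind (X) in column c sits in the cell
  (c, Xrow c), the marking of the second kind (O) in column c in the cell (c, Orow c).\<close>

record grid =
  gsize :: nat
  Xrow :: "nat \<Rightarrow> nat"
  Orow :: "nat \<Rightarrow> nat"

text \<open>Column of the X marking reached after going X -> O (horizontally, in the row of X)
  -> X (vertically, in the column of that O).\<close>
definition gsigma :: "grid \<Rightarrow> nat \<Rightarrow> nat" where
  "gsigma G c = the_inv_into {..<gsize G} (Orow G) (Xrow G c)"

definition gcol :: "grid \<Rightarrow> nat \<Rightarrow> nat" where
  "gcol G k = (gsigma G ^^ k) 0"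

text \<open>Well-formed immersed grid diagram: each row and column contains exactly one
  marking of each kind, no cell carries two markings, and the resulting curve is a
  single (connected) closed curve, i.e. the column permutation gsigma is one n-cycle.\<close>
definition immersed_grid :: "grid \<Rightarrow> bool" where
  "immersed_grid G \<longleftrightarrow>
     gsize G \<ge> 1 \<and>
     bij_betw (Xrow G) {..<gsize G} {..<gsize G} \<and>
     bij_betw (Orow G) {..<gsize G} {..<gsize G} \<and>
     (\<forall>c<gsize G. Xrow G c \<noteq> Orow G c) \<and>
     gcol G ` {..<gsize G} = {..<gsize G}"

text \<open>Corners of the curve (centers of the markings) in cyclic order:
  vertex 2k is the X marking in column gcol k, vertex 2k+1 the O marking in its row.\<close>
definition vertex :: "grid \<Rightarrow> nat \<Rightarrow> real \<times> real" where
  "vertex G j =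
     (let k = j div 2 in
      if even j then (real (gcol G k) + 1/2, real (Xrow G (gcol G k)) + 1/2)
      else (real (gcol G (Suc k)) + 1/2, real (Xrow G (gcol G k)) + 1/2))"

definition gamma :: "grid \<Rightarrow> real \<Rightarrow> real \<times> real" where
  "gamma G \<theta> =
     (let N = 2 * gsize G; s = \<theta> * real N / (2 * pi); k = \<lfloor>s\<rfloor>; t = s - real_of_int k;
          j = nat (k mod int N)
      in (1 - t) *\<^sub>R vertex G j + t *\<^sub>R vertex G (Suc j))"

definition gw :: "grid \<Rightarrow> real \<Rightarrow> real" where "gw G \<theta> = fst (gamma G \<theta>)"
definition gy :: "grid \<Rightarrow> real \<Rightarrow> real" where "gy G \<theta> = snd (gamma G \<theta>)"

definition tint :: "grid \<Rightarrow> real \<Rightarrow> real \<Rightarrow> real" where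
  "tint G a b =
     (let f = (\<lambda>\<theta>. gy G \<theta> * deriv (gw G) \<theta>)
      in if a \<le> b then integral {a..b} f else - integral {b..a} f)"

definition lagrangian_grid :: "grid \<Rightarrow> bool" where
  "lagrangian_grid G \<longleftrightarrow>
     immersed_grid G \<and>
     tint G 0 (2 * pi) = 0 \<and>
     (\<forall>\<theta>0\<in>{0..<2*pi}. \<forall>\<theta>1\<in>{0..<2*pi}.
        \<theta>0 \<noteq> \<theta>1 \<and> gamma G \<theta>0 = gamma G \<theta>1 \<longrightarrow> tint G \<theta>0 \<theta>1 \<noteq> 0)"

definition legendrian_lift :: "grid \<Rightarrow> real \<Rightarrow> real^3" where
  "legendrian_lift G \<theta> = vector [gw G \<theta>, gy G \<theta>, tint G 0 \<theta>]"

definition lift_knot :: "grid \<Rightarrow> (real^3) set" where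
  "lift_knot G = legendrian_lift G ` {0..2*pi}"

definition ambient_isotopic :: "(real^3) set \<Rightarrow> (real^3) set \<Rightarrow> bool" where
  "ambient_isotopic K K' \<longleftrightarrow>
     (\<exists>H :: real \<times> (real^3) \<Rightarrow> real^3.
        continuous_on ({0..1} \<times> UNIV) H \<and>
        (\<forall>x. H (0, x) = x) \<and>
        (\<forall>t\<in>{0..1}. \<exists>g. homeomorphism UNIV UNIV (\<lambda>x. H (t, x)) g) \<and>
        (\<lambda>x. H (1, x)) ` K = K')"

text \<open>Turning of the curve at corner j: positive = counterclockwise (left turn).\<close>
definition turn :: "grid \<Rightarrow> nat \<Rightarrow> real" where
  "turn G j =
     (let N = 2 * gsize G;
          a = vertex G ((j + N - 1) mod N); b = vertex G j; c = vertex G (Suc j)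
      in (fst b - fst a) * (snd c - snd b) - (snd b - snd a) * (fst c - fst b))"

definition rotation_number :: "grid \<Rightarrow> real" where
  "rotation_number G =
     (real (card {j. j < 2 * gsize G \<and> turn G j > 0})
      - real (card {j. j < 2 * gsize G \<and> turn G j < 0})) / 4"

definition marking_upper_right :: "grid \<Rightarrow> bool" where
  "marking_upper_right G \<longleftrightarrow>
     Xrow G (gsize G - 1) = gsize G - 1 \<or> Orow G (gsize G - 1) = gsize G - 1"

end

theory Submission
  imports Defs
begin

text \<open>Stretch the diagram by \<open>K\<close> in the \<open>w\<close>-direction and by \<open>L\<close> in the \<open>y\<close>-direction. Every
  crossing lies off the two edges at the upper right corner, and of the two arcs at a crossing one
  avoids the corner, so as long as the total area stays zero all \<open>\<Delta>t\<close> are multiplied by \<open>K * L\<close>,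
  whatever replaces the two corner edges. They are replaced by an embedded path outside the
  stretched diagram which visits every row and column left empty by the stretching. A thin path
  encloses an extra area that is only linear in the stretching factors, while pushing the top row
  down frees an area of quadratic order; the difference is made up exactly by a step function
  with adjustable heights.

  The isotopy moves the lifted curve along one coordinate at a time: first the corner path is
  raised so that its \<open>t\<close>-coordinate increases strictly above everything else, then it can be moved
  in the \<open>w\<close>- and \<open>y\<close>-directions, and finally it is lowered again. Each such motion of a polygon
  that preserves the order on the lines parallel to a coordinate axis extends to an ambient
  isotopy that is monotone on these lines.\<close>


subsection \<open>Ambient isotopies along one coordinate\<close>

text \<open>Stretching alone would already enlarge every \<open>\<Delta>t\<close>, but it leaves
  empty rows and columns, and each of them must receive exactly one edge. The outside of the diagram
  is the one region where they can all be visited without new crossings, and an extremal corner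
  gives access to it. On the arc avoiding the corner, \<open>y\<close> becomes
  \<open>L * y + c\<close>; the constant \<open>c\<close> contributes \<open>c\<close> times the
  change of \<open>w\<close> around a loop, which is 0.

  The obstacle is exactness: everything is an integer and the total area has to vanish, not just to
  be small. With vertical factor \<open>2 * \<kappa> + 1\<close>, the area left over has the form
  \<open>A - 2 * \<kappa> * D\<close>, where neither \<open>A\<close> nor \<open>D\<close> depends
  on \<open>\<kappa>\<close>. The horizontal factor \<open>K = 2 * n - 1\<close> is taken because it
  guarantees \<open>D \<ge> 1\<close>. Then \<open>A\<close> is corrected to a multiple of
  \<open>2 * D\<close> and \<open>\<kappa>\<close> is read off from it; many rows above the diagram
  make \<open>A\<close>, and with it \<open>\<kappa>\<close>, as large as desired.

  Integrality also gives the final bound: a nonzero \<open>\<Delta>t\<close> of the old diagram is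
  at least 1 in absolute value.\<close>

lemma ambient_isotopic_trans:
  assumes "ambient_isotopic K1 K2" "ambient_isotopic K2 K3"
  shows "ambient_isotopic K1 K3"
proof -
  obtain H where H: "continuous_on ({0..1} \<times> UNIV) H" "\<And>x. H (0::real, x) = x"
    "\<And>t. t \<in> {0..1} \<Longrightarrow> \<exists>g. homeomorphism UNIV UNIV (\<lambda>x. H (t, x)) g" "(\<lambda>x. H (1, x)) ` K1 = K2"
    using assms(1) unfolding ambient_isotopic_def by metis
  obtain I where I: "continuous_on ({0..1} \<times> UNIV) I" "\<And>x. I (0::real, x) = x"
    "\<And>t. t \<in> {0..1} \<Longrightarrow> \<exists>g. homeomorphism UNIV UNIV (\<lambda>x. I (t, x)) g" "(\<lambda>x. I (1, x)) ` K2 = K3"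
    using assms(2) unfolding ambient_isotopic_def by metis
  \<comment> \<open>Run \<open>H\<close> at double speed, then \<open>I\<close> applied to the final
    map of \<open>H\<close>; the formulas agree at time 1/2 because
    \<open>I (0, x) = x\<close>.\<close>
  define J where "J = (\<lambda>p::real \<times> (real^3). if fst p \<le> 1/2 then H (2 * fst p, snd p) else I (2 * fst p - 1, H (1, snd p)))"
  have cH1: "continuous_on UNIV (\<lambda>x. H (1, x))"
    using H(3)[of 1] by (auto simp: homeomorphism_def)
  have "continuous_on ({0..1} \<times> UNIV) J"
    unfolding J_def
  proof (rule continuous_on_cases_le)
    show "continuous_on {x \<in> {0..1} \<times> UNIV. fst x \<le> 1/2} (\<lambda>x. H (2 * fst x, snd x))"
      by (rule continuous_on_compose2[OF H(1)]) (auto intro!: continuous_intros)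
    have c2: "continuous_on A (\<lambda>x::real \<times> (real^3). H (1, snd x))" for A
      by (rule continuous_on_compose2[OF cH1]) (auto intro!: continuous_intros)
    show "continuous_on {x \<in> {0..1} \<times> UNIV. 1/2 \<le> fst x} (\<lambda>x. I (2 * fst x - 1, H (1, snd x)))"
      by (rule continuous_on_compose2[OF I(1)]) (auto intro!: continuous_intros c2)
    show "H (2 * fst x, snd x) = I (2 * fst x - 1, H (1, snd x))" if "fst x = 1/2" for x
    proof -
      have "2 * fst x = 1" "2 * fst x - 1 = 0" using that by auto
      thus ?thesis by (simp only: I(2))
    qed
  qed (intro continuous_intros)
  moreover have "J (0, x) = x" for x by (simp add: J_def H)
  moreover have "\<exists>g. homeomorphism UNIV UNIV (\<lambda>x. J (t, x)) g" if "t \<in> {0..1}" for t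
  proof (cases "t \<le> 1/2")
    case True
    thus ?thesis using that H(3)[of "2*t"] by (simp add: J_def)
  next
    case False
    obtain g where g: "homeomorphism UNIV UNIV (\<lambda>x. H (1, x)) g" using H(3)[of 1] by auto
    have "2*t-1 \<in> {0..1}" using that False by auto
    then obtain h where h: "homeomorphism UNIV UNIV (\<lambda>x. I (2*t-1, x)) h" using I(3) by blast
    have "homeomorphism UNIV UNIV ((\<lambda>x. I (2*t-1, x)) \<circ> (\<lambda>x. H (1, x))) (g \<circ> h)"
      using homeomorphism_compose[OF g h] .
    thus ?thesis using False by (auto simp: J_def o_def)
  qed
  moreover have "(\<lambda>x. J (1, x)) ` K1 = K3"
    using H(4) I(4) by (auto simp: J_def image_image[symmetric])
  ultimately show ?thesis unfolding ambient_isotopic_def by blast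
qed

section \<open>Monotone extensions and motions along one coordinate\<close>

definition qdist :: "'n::finite \<Rightarrow> real^'n \<Rightarrow> real^'n \<Rightarrow> real" where
  "qdist k p q = (\<Sum>i\<in>-{k}. \<bar>p $ i - q $ i\<bar>) + max 0 (p $ k - q $ k)"

lemma qdist_nonneg: "0 \<le> qdist k p q"
  unfolding qdist_def by (intro add_nonneg_nonneg sum_nonneg) auto

lemma qdist_triangle: "qdist k p r \<le> qdist k p q + qdist k q r"
proof -
  have "(\<Sum>i\<in>-{k}. \<bar>p $ i - r $ i\<bar>) \<le> (\<Sum>i\<in>-{k}. \<bar>p $ i - q $ i\<bar> + \<bar>q $ i - r $ i\<bar>)"
    by (rule sum_mono) linarith
  thus ?thesis unfolding qdist_def sum.distrib by linarith
qed

lemma qdist_le: "qdist k p q \<le> CARD('n) * norm (p - q)" for p q :: "real^'n"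
proof -
  have "qdist k p q \<le> (\<Sum>i\<in>-{k}. \<bar>p $ i - q $ i\<bar>) + \<bar>p $ k - q $ k\<bar>"
    unfolding qdist_def by auto
  also have "\<dots> = (\<Sum>i\<in>UNIV. \<bar>p $ i - q $ i\<bar>)"
    by (subst sum.remove[of UNIV k]) (auto simp: Compl_eq_Diff_UNIV)
  also have "\<dots> \<le> (\<Sum>i\<in>(UNIV::'n set). norm (p - q))"
    by (rule sum_mono) (metis component_le_norm_cart vector_minus_component)
  finally show ?thesis by simp
qed

text \<open>McShane's extension formula with an asymmetric distance: since \<open>qdist\<close> vanishes
  when moving up along coordinate \<open>k\<close>, the extension is monotone in that direction.\<close>

lemma monotone_extension:
  fixes c :: "'a \<Rightarrow> real^'n::finite" and g :: "'a \<Rightarrow> real"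
  assumes "S \<noteq> {}" "\<Lambda> \<ge> 0"
    and bd: "\<And>u v. u \<in> S \<Longrightarrow> v \<in> S \<Longrightarrow> g u - g v \<le> \<Lambda> * qdist k (c u) (c v)"
  obtains f :: "real^'n \<Rightarrow> real" where "continuous_on UNIV f" "\<And>u. u \<in> S \<Longrightarrow> f (c u) = g u"
    "\<And>p q. (\<And>i. i \<noteq> k \<Longrightarrow> p $ i = q $ i) \<Longrightarrow> p $ k \<le> q $ k \<Longrightarrow> f p \<le> f q"
proof
  define f where "f = (\<lambda>p. INF u\<in>S. g u + \<Lambda> * qdist k p (c u))"
  obtain v0 where v0: "v0 \<in> S" using assms(1) by auto
  have bdd: "bdd_below ((\<lambda>u. g u + \<Lambda> * qdist k p (c u)) ` S)" for p
  proof (rule bdd_belowI2)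
    fix u assume u: "u \<in> S"
    have "g v0 - g u \<le> \<Lambda> * qdist k (c v0) (c u)" using bd v0 u by auto
    also have "\<dots> \<le> \<Lambda> * (qdist k (c v0) p + qdist k p (c u))"
      using assms(2) qdist_triangle by (rule mult_left_mono[rotated])
    finally show "g v0 - \<Lambda> * qdist k (c v0) p \<le> g u + \<Lambda> * qdist k p (c u)"
      by (simp add: algebra_simps)
  qed
  have lip: "f p \<le> f q + \<Lambda> * qdist k p q" for p q
  proof -
    have "f p - \<Lambda> * qdist k p q \<le> f q"
      unfolding f_def[of ] 
    proof (rule cINF_greatest[OF assms(1)])
      fix u assume u: "u \<in> S"
      have "(INF u\<in>S. g u + \<Lambda> * qdist k p (c u)) \<le> g u + \<Lambda> * qdist k p (c u)"
        by (rule cINF_lower[OF bdd u])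
      also have "\<dots> \<le> g u + \<Lambda> * (qdist k p q + qdist k q (c u))"
        using assms(2) qdist_triangle by (intro add_left_mono mult_left_mono) auto
      finally show "(INF u\<in>S. g u + \<Lambda> * qdist k p (c u)) - \<Lambda> * qdist k p q \<le> g u + \<Lambda> * qdist k q (c u)"
        by (simp add: algebra_simps)
    qed
    thus ?thesis by simp
  qed
  have lip2: "\<bar>f p - f q\<bar> \<le> \<Lambda> * CARD('n) * norm (p - q)" for p q
  proof -
    have "\<Lambda> * qdist k p q \<le> \<Lambda> * (CARD('n) * norm (p - q))" "\<Lambda> * qdist k q p \<le> \<Lambda> * (CARD('n) * norm (q - p))"
      using assms(2) qdist_le by (auto intro!: mult_left_mono)
    thus ?thesis using lip[of p q] lip[of q p] by (simp add: norm_minus_commute algebra_simps)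
  qed
  show "continuous_on UNIV f"
  proof (rule lipschitz_on_continuous_on)
    show "(\<Lambda> * CARD('n))-lipschitz_on UNIV f"
      by (rule lipschitz_onI) (use lip2 assms(2) in \<open>auto simp: dist_norm\<close>)
  qed
  show "f (c u) = g u" if "u \<in> S" for u
  proof (rule antisym)
    have "f (c u) \<le> g u + \<Lambda> * qdist k (c u) (c u)"
      unfolding f_def by (rule cINF_lower[OF bdd that])
    thus "f (c u) \<le> g u" by (simp add: qdist_def)
    show "g u \<le> f (c u)" unfolding f_def
      by (rule cINF_greatest[OF assms(1)]) (use bd[OF that] in \<open>auto simp: algebra_simps\<close>)
  qed
  show "f p \<le> f q" if "\<And>i. i \<noteq> k \<Longrightarrow> p $ i = q $ i" "p $ k \<le> q $ k" for p q
  proof -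
    have "qdist k p q = 0" using that by (auto simp: qdist_def intro!: sum.neutral)
    thus ?thesis using lip[of p q] by simp
  qed
qed

text \<open>Extend \<open>c' u $ k - \<epsilon> * c u $ k\<close> monotonically and add
  \<open>\<epsilon> * p $ k\<close> back: the resulting \<open>F\<close> is strictly increasing on
  every line parallel to axis \<open>k\<close>. Moving coordinate \<open>k\<close> linearly towards
  \<open>F\<close> is then injective at all times, and the slope \<open>\<epsilon>\<close> also
  makes every intermediate map onto.\<close>

lemma coordinate_isotopy:
  fixes c c' :: "'a \<Rightarrow> real^3"
  assumes "S \<noteq> {}" "\<Lambda> \<ge> 0" "\<epsilon> > 0"
    and same: "\<And>u i. u \<in> S \<Longrightarrow> i \<noteq> k \<Longrightarrow> c' u $ i = c u $ i"
    and bd: "\<And>u v. u \<in> S \<Longrightarrow> v \<in> S \<Longrightarrow>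
       (c' u $ k - c' v $ k) - \<epsilon> * (c u $ k - c v $ k) \<le> \<Lambda> * qdist k (c u) (c v)"
  shows "ambient_isotopic (c ` S) (c' ` S)"
proof -
  obtain f :: "real^3 \<Rightarrow> real" where f: "continuous_on UNIV f" 
      "\<And>u. u \<in> S \<Longrightarrow> f (c u) = c' u $ k - \<epsilon> * c u $ k"
      "\<And>p q. (\<And>i. i \<noteq> k \<Longrightarrow> p $ i = q $ i) \<Longrightarrow> p $ k \<le> q $ k \<Longrightarrow> f p \<le> f q"
  proof (rule monotone_extension[OF assms(1,2), of "\<lambda>u. c' u $ k - \<epsilon> * c u $ k" k c])
    show "c' u $ k - \<epsilon> * c u $ k - (c' v $ k - \<epsilon> * c v $ k) \<le> \<Lambda> * qdist k (c u) (c v)"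
      if "u \<in> S" "v \<in> S" for u v using bd[OF that] by (simp add: algebra_simps)
  qed blast
  define F where "F = (\<lambda>p. f p + \<epsilon> * p $ k)"
  define h where "h = (\<lambda>t p. (1 - t) * p $ k + t * F p :: real)"
  define H where "H = (\<lambda>tp::real \<times> (real^3). \<chi> i. if i = k then h (fst tp) (snd tp) else snd tp $ i)"
  have contf: "continuous_on A (\<lambda>x. f (g x))" if "continuous_on A g" for A :: "'z::topological_space set" and g
    by (rule continuous_on_compose2[OF f(1) that]) auto
  have "continuous_on ({0..1} \<times> UNIV) H"
    unfolding H_def
  proof (rule continuous_on_vec_lambda)
    fix i show "continuous_on ({0..1} \<times> UNIV) (\<lambda>x::real \<times> (real^3). if i = k then h (fst x) (snd x) else snd x $ i)"
      by (cases "i = k") (simp_all add: h_def F_def, intro continuous_intros contf, intro continuous_intros)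
  qed
  moreover have "H (0, x) = x" for x by (simp add: H_def h_def vec_eq_iff)
  moreover have "\<exists>g. homeomorphism UNIV UNIV (\<lambda>x. H (t, x)) g" if t: "t \<in> {0..1}" for t
  proof -
    have cont: "continuous_on UNIV (\<lambda>x. H (t, x))"
      unfolding H_def
    proof (rule continuous_on_vec_lambda)
      fix i show "continuous_on UNIV (\<lambda>x. if i = k then h (fst (t, x)) (snd (t, x)) else snd (t, x) $ i)"
        by (cases "i = k") (simp_all add: h_def F_def, intro continuous_intros contf, intro continuous_intros)
    qed
    have less: "h t p < h t q" if "\<And>i. i \<noteq> k \<Longrightarrow> p $ i = q $ i" "p $ k < q $ k" for p q
    proof -
      have "F p < F q" unfolding F_def using f(3)[of p q] that assms(3) by (smt (verit) mult_less_cancel_left)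
      thus ?thesis using t that(2) unfolding h_def
        by (cases "t = 0") (auto intro!: add_le_less_mono mult_left_mono mult_strict_left_mono)
    qed
    have inj: "inj (\<lambda>x. H (t, x))"
    proof (rule injI)
      fix p q assume e: "H (t, p) = H (t, q)"
      have *: "p $ i = q $ i" if "i \<noteq> k" for i
        using arg_cong[OF e, of "\<lambda>v. v $ i"] that by (simp add: H_def)
      have "h t p = h t q" using arg_cong[OF e, of "\<lambda>v. v $ k"] by (simp add: H_def)
      hence "p $ k = q $ k" using less[of p q] less[of q p] * by fastforce
      thus "p = q" using * by (metis vec_eq_iff)
    qed
    have surj: "(\<lambda>x. H (t, x)) ` UNIV = UNIV"
    proof -
      have "\<exists>p. H (t, p) = q" for q
      proof -
        define P where "P = (\<lambda>s. \<chi> i. if i = k then s else q $ i)"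
        define G where "G = (\<lambda>s. h t (P s))"
        have Pk: "P s $ k = s" "i \<noteq> k \<Longrightarrow> P s $ i = q $ i" for s i by (auto simp: P_def)
        have "continuous_on UNIV P" unfolding P_def
        proof (rule continuous_on_vec_lambda)
          fix i show "continuous_on UNIV (\<lambda>s. if i = k then s else q $ i)"
            by (cases "i = k") (auto intro!: continuous_intros)
        qed
        hence cG: "continuous_on UNIV G" unfolding G_def h_def F_def
          by (intro continuous_intros contf) auto
        \<comment> \<open>A slope valid at every time \<open>t\<close>: on a line,
          \<open>h t\<close> rises at rate at least \<open>1 - t + t * \<epsilon>\<close>, which
          lies between 1 and \<open>\<epsilon>\<close>.\<close>
        define m where "m = min 1 \<epsilon>"
        have m: "0 < m" "m \<le> 1" "m \<le> \<epsilon>" using assms(3) by (auto simp: m_def)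
        have cf: "m \<le> (1 - t) + t * \<epsilon>" 
        proof -
          have "m = (1 - t) * m + t * m" by (simp add: algebra_simps)
          also have "\<dots> \<le> (1 - t) * 1 + t * \<epsilon>" using t m by (intro add_mono mult_left_mono) auto
          finally show ?thesis by simp
        qed
        have Ge: "G s = ((1 - t) + t * \<epsilon>) * s + t * f (P s)" for s
          by (simp add: G_def h_def F_def Pk algebra_simps)
        have up: "G s \<ge> m * s + t * f (P 0)" if "s \<ge> 0" for s
        proof -
          have "f (P 0) \<le> f (P s)" using f(3)[of "P 0" "P s"] that by (simp add: Pk)
          thus ?thesis unfolding Ge using cf t that by (intro add_mono mult_right_mono mult_left_mono) auto
        qed
        have lo: "G s \<le> m * s + t * f (P 0)" if "s \<le> 0" for s
        proof -
          have "f (P s) \<le> f (P 0)" using f(3)[of "P s" "P 0"] that by (simp add: Pk)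
          thus ?thesis unfolding Ge using cf t that by (intro add_mono mult_right_mono_neg mult_left_mono) auto
        qed
        define R where "R = (\<bar>q $ k\<bar> + \<bar>t * f (P 0)\<bar>) / m"
        have R: "R \<ge> 0" "m * R = \<bar>q $ k\<bar> + \<bar>t * f (P 0)\<bar>" using m by (auto simp: R_def)
        have "G (-R) \<le> q $ k" "q $ k \<le> G R" using up[of R] lo[of "-R"] R by auto
        then obtain s where "G s = q $ k"
          using IVT'[of G "-R" "q $ k" R] R continuous_on_subset[OF cG] by auto
        hence "H (t, P s) = q" by (auto simp: H_def G_def vec_eq_iff Pk)
        thus ?thesis by blast
      qed
      thus ?thesis by (metis (mono_tags, lifting) surj_def)
    qed
    have "\<exists>g. homeomorphism UNIV ((\<lambda>x. H (t, x)) ` UNIV) (\<lambda>x. H (t, x)) g"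
      using invariance_of_domain_homeomorphism[OF open_UNIV cont _ inj] by (metis order_refl)
    thus ?thesis unfolding surj .
  qed
  moreover have "H (1, c u) = c' u" if "u \<in> S" for u
    using that f(2) same by (auto simp: H_def h_def F_def vec_eq_iff)
  hence "(\<lambda>x. H (1, x)) ` c ` S = c' ` S" by (force simp: image_image)
  ultimately show ?thesis unfolding ambient_isotopic_def by blast
qed

section \<open>Affine estimates on polytopes\<close>

definition affine_fun :: "('a::real_inner \<Rightarrow> real) \<Rightarrow> bool" where
  "affine_fun f \<longleftrightarrow> (\<exists>a r. \<forall>x. f x = a \<bullet> x + r)"

lemma affine_fun_const: "affine_fun (\<lambda>x. c)"
  unfolding affine_fun_def by (rule exI[of _ 0]) auto

lemma affine_fun_cmul: "affine_fun f \<Longrightarrow> affine_fun (\<lambda>x. c * f x)"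
  unfolding affine_fun_def by (metis distrib_left inner_scaleR_left)

lemma affine_fun_add: "affine_fun f \<Longrightarrow> affine_fun g \<Longrightarrow> affine_fun (\<lambda>x. f x + g x)"
  unfolding affine_fun_def
proof (elim exE)
  fix a r b s assume "\<forall>x. f x = a \<bullet> x + r" "\<forall>x. g x = b \<bullet> x + s"
  hence "\<forall>x. f x + g x = (a + b) \<bullet> x + (r + s)" by (simp add: inner_add_left)
  thus "\<exists>a r. \<forall>x. f x + g x = a \<bullet> x + r" by blast
qed

lemma affine_fun_diff: "affine_fun f \<Longrightarrow> affine_fun g \<Longrightarrow> affine_fun (\<lambda>x. f x - g x)"
  using affine_fun_add[of f "\<lambda>x. -1 * g x"] affine_fun_cmul[of g "-1"] by simp

lemma affine_fun_sum: "(\<And>i. i \<in> I \<Longrightarrow> affine_fun (f i)) \<Longrightarrow> affine_fun (\<lambda>x. \<Sum>i\<in>I. f i x)"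
  by (induction I rule: infinite_finite_induct) (auto intro: affine_fun_const affine_fun_add)

lemma polyhedron_affine_fun_le:
  fixes f :: "'a::euclidean_space \<Rightarrow> real"
  assumes "affine_fun f" shows "polyhedron {x. f x \<le> 0}"
proof -
  obtain a r where "\<forall>x. f x = a \<bullet> x + r" using assms unfolding affine_fun_def by blast
  hence "{x. f x \<le> 0} = {x. a \<bullet> x \<le> -r}" by auto
  thus ?thesis by (simp add: polyhedron_halfspace_le)
qed

text \<open>An affine inequality only has to be checked on the finitely many vertices of a polytope.\<close>

lemma polytope_affine_bound:
  fixes P :: "'a::euclidean_space set"
  assumes "polytope P" "affine_fun f" "affine_fun g"
    and pos: "\<And>x. x \<in> P \<Longrightarrow> 0 \<le> g x" and zero: "\<And>x. x \<in> P \<Longrightarrow> g x = 0 \<Longrightarrow> f x \<le> 0"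
  shows "\<exists>\<Lambda>\<ge>0. \<forall>x\<in>P. f x \<le> \<Lambda> * g x"
proof -
  obtain V where V: "finite V" "P = convex hull V" using assms(1) unfolding polytope_def by blast
  define \<Lambda> where "\<Lambda> = (\<Sum>v\<in>V. max 0 (f v / g v))"
  have "affine_fun (\<lambda>x. f x - \<Lambda> * g x)" by (intro affine_fun_diff affine_fun_cmul assms)
  hence conv: "convex {x. f x - \<Lambda> * g x \<le> 0}"
    using polyhedron_affine_fun_le polyhedron_imp_convex by blast
  have "V \<subseteq> {x. f x - \<Lambda> * g x \<le> 0}"
  proof
    fix v assume v: "v \<in> V"
    hence vP: "v \<in> P" using V by (simp add: hull_inc)
    have "f v \<le> \<Lambda> * g v"
    proof (cases "g v = 0")
      case True thus ?thesis using zero[OF vP] by simp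
    next
      case False
      hence g: "g v > 0" using pos[OF vP] by simp
      have "f v / g v \<le> max 0 (f v / g v)" by simp
      also have "\<dots> \<le> \<Lambda>" unfolding \<Lambda>_def by (rule member_le_sum) (use v V in auto)
      finally show ?thesis using g by (simp add: divide_le_eq)
    qed
    thus "v \<in> {x. f x - \<Lambda> * g x \<le> 0}" by simp
  qed
  hence "P \<subseteq> {x. f x - \<Lambda> * g x \<le> 0}" unfolding V(2) using conv by (rule hull_minimal)
  moreover have "\<Lambda> \<ge> 0" unfolding \<Lambda>_def by (rule sum_nonneg) auto
  ultimately show ?thesis by (auto simp: subset_iff)
qed

text \<open>Read \<open>D i\<close> and \<open>A\<close> as coordinate differences of two points
  before and after a motion. On the polytope of pairs lying on one line in the given order,
  \<open>A\<close> vanishes only where \<open>D k\<close> does, so \<open>- D k\<close> is bounded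
  by a multiple of \<open>- A\<close>; the reciprocal of that multiple is a uniform slope.\<close>

lemma fibre_slope:
  fixes D :: "'n::finite \<Rightarrow> 'a::euclidean_space \<Rightarrow> real"
  assumes "polytope Q" "\<And>i. affine_fun (D i)" "affine_fun A"
    and le: "\<And>x. x \<in> Q \<Longrightarrow> (\<forall>i. i \<noteq> k \<longrightarrow> D i x = 0) \<Longrightarrow> D k x \<le> 0 \<Longrightarrow> A x \<le> 0"
    and lt: "\<And>x. x \<in> Q \<Longrightarrow> (\<forall>i. i \<noteq> k \<longrightarrow> D i x = 0) \<Longrightarrow> D k x < 0 \<Longrightarrow> A x < 0"
  shows "\<exists>e>0. \<forall>\<epsilon>. 0 < \<epsilon> \<and> \<epsilon> \<le> e \<longrightarrow>
     (\<forall>x\<in>Q. (\<forall>i. i \<noteq> k \<longrightarrow> D i x = 0) \<and> D k x \<le> 0 \<longrightarrow> A x \<le> \<epsilon> * D k x)"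
proof -
  define P where "P = Q \<inter> (\<Inter>i\<in>-{k}. {x. D i x \<le> 0} \<inter> {x. -1 * D i x \<le> 0}) \<inter> {x. D k x \<le> 0}"
  have P: "x \<in> P \<longleftrightarrow> x \<in> Q \<and> (\<forall>i. i \<noteq> k \<longrightarrow> D i x = 0) \<and> D k x \<le> 0" for x
  proof -
    have "D i x \<le> 0 \<and> -1 * D i x \<le> 0 \<longleftrightarrow> D i x = 0" for i by auto
    thus ?thesis unfolding P_def Int_iff INT_iff mem_Collect_eq by (simp add: Ball_def)
  qed
  have "polyhedron ({x. D i x \<le> 0} \<inter> {x. -1 * D i x \<le> 0})" for i
    by (intro polyhedron_Int polyhedron_affine_fun_le affine_fun_cmul assms)
  hence "polyhedron (\<Inter>i\<in>-{k}. {x. D i x \<le> 0} \<inter> {x. -1 * D i x \<le> 0})"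
    by (intro polyhedron_Inter finite_imageI finite) blast
  hence "polytope P" unfolding P_def
    by (intro polytope_Int_polyhedron polyhedron_affine_fun_le assms)
  hence "\<exists>\<Lambda>\<ge>0. \<forall>x\<in>P. -1 * D k x \<le> \<Lambda> * (-1 * A x)"
  proof (rule polytope_affine_bound)
    show "0 \<le> -1 * A x" if "x \<in> P" for x using le[of x] that P by auto
    show "-1 * D k x \<le> 0" if "x \<in> P" "-1 * A x = 0" for x using lt[of x] that P by fastforce
  qed (intro affine_fun_cmul assms)+
  then obtain \<Lambda> where L: "\<Lambda> \<ge> 0" "\<And>x. x \<in> P \<Longrightarrow> -1 * D k x \<le> \<Lambda> * (-1 * A x)" by blast
  show ?thesis
  \<comment> \<open>The added 1 keeps the quotient positive when
    \<open>\<Lambda> = 0\<close>.\<close>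
  proof (intro exI[of _ "1 / (\<Lambda> + 1)"] conjI allI impI ballI)
    show "0 < 1 / (\<Lambda> + 1)" using L by simp
    fix \<epsilon> x assume e: "0 < \<epsilon> \<and> \<epsilon> \<le> 1 / (\<Lambda> + 1)" and x: "x \<in> Q" "(\<forall>i. i \<noteq> k \<longrightarrow> D i x = 0) \<and> D k x \<le> 0"
    hence xP: "x \<in> P" using P by auto
    have A: "A x \<le> 0" using le x by auto
    have "- D k x \<le> (\<Lambda> + 1) * (- A x)" using L(2)[OF xP] A by (simp add: algebra_simps)
    hence "\<epsilon> * (- D k x) \<le> \<epsilon> * ((\<Lambda> + 1) * (- A x))" using e by (intro mult_left_mono) auto
    also have "\<dots> = (\<epsilon> * (\<Lambda> + 1)) * (- A x)" by simp
    also have "\<dots> \<le> 1 * (- A x)"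
      using e L(1) A by (intro mult_right_mono) (auto simp: pos_le_divide_eq)
    finally show "A x \<le> \<epsilon> * D k x" by simp
  qed
qed

text \<open>The bounding expression is only piecewise affine. For a fixed sign pattern
  \<open>\<sigma>\<close> of the differences it equals the affine function \<open>G\<close>, so the
  vertex estimate applies on each of the finitely many pieces, and the constants obtained are added
  up.\<close>

lemma fibre_bound:
  fixes D :: "'n::finite \<Rightarrow> 'a::euclidean_space \<Rightarrow> real"
  assumes "polytope Q" "\<And>i. affine_fun (D i)" "affine_fun B"
    and le: "\<And>x. x \<in> Q \<Longrightarrow> (\<forall>i. i \<noteq> k \<longrightarrow> D i x = 0) \<Longrightarrow> D k x \<le> 0 \<Longrightarrow> B x \<le> 0"
  shows "\<exists>\<Lambda>\<ge>0. \<forall>x\<in>Q. B x \<le> \<Lambda> * ((\<Sum>i\<in>-{k}. \<bar>D i x\<bar>) + max 0 (D k x))"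
proof -
  define sg where "sg = (\<lambda>b. if b then 1 else -1 :: real)"
  have "\<forall>\<sigma>::'n \<Rightarrow> bool. \<exists>\<Lambda>\<ge>0. \<forall>x\<in>Q. (\<forall>i. 0 \<le> sg (\<sigma> i) * D i x) \<longrightarrow>
       B x \<le> \<Lambda> * ((\<Sum>i\<in>-{k}. \<bar>D i x\<bar>) + max 0 (D k x))"
  proof
    fix \<sigma> :: "'n \<Rightarrow> bool"
    define P where "P = Q \<inter> (\<Inter>i. {x. - sg (\<sigma> i) * D i x \<le> 0})"
    have P: "x \<in> P \<longleftrightarrow> x \<in> Q \<and> (\<forall>i. 0 \<le> sg (\<sigma> i) * D i x)" for x
      unfolding P_def by auto
    define G where "G = (\<lambda>x. (\<Sum>i\<in>-{k}. sg (\<sigma> i) * D i x) + (if \<sigma> k then 1 else 0) * D k x)"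
    have G: "G x = (\<Sum>i\<in>-{k}. \<bar>D i x\<bar>) + max 0 (D k x)" if "x \<in> P" for x
    proof -
      have *: "sg (\<sigma> i) * D i x = \<bar>D i x\<bar>" for i using that[unfolded P] by (auto simp: sg_def split: if_splits)
      hence "(if \<sigma> k then 1 else 0) * D k x = max 0 (D k x)"
        using spec[OF conjunct2[OF that[unfolded P]], of k] by (cases "\<sigma> k") (auto simp: sg_def)
      thus ?thesis unfolding G_def * by simp
    qed
    have "polyhedron {x. - sg (\<sigma> i) * D i x \<le> 0}" for i
      by (intro polyhedron_affine_fun_le affine_fun_cmul assms)
    hence "polyhedron (\<Inter>i. {x. - sg (\<sigma> i) * D i x \<le> 0})"
      by (intro polyhedron_Inter finite_imageI finite) blast
    hence "polytope P" unfolding P_def by (intro polytope_Int_polyhedron assms)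
    hence "\<exists>\<Lambda>\<ge>0. \<forall>x\<in>P. B x \<le> \<Lambda> * G x"
    proof (rule polytope_affine_bound)
      show "affine_fun G" unfolding G_def by (intro affine_fun_add affine_fun_sum affine_fun_cmul assms)
      show "0 \<le> G x" if "x \<in> P" for x unfolding G[OF that] by (intro add_nonneg_nonneg sum_nonneg) auto
      show "B x \<le> 0" if "x \<in> P" "G x = 0" for x
      proof -
        have s: "0 \<le> (\<Sum>i\<in>-{k}. \<bar>D i x\<bar>)" by (rule sum_nonneg) auto
        have "(\<Sum>i\<in>-{k}. \<bar>D i x\<bar>) = 0" "max 0 (D k x) = 0"
          using that(2) unfolding G[OF that(1)] using s by linarith+
        thus ?thesis using le[of x] that(1) P by (auto simp: sum_nonneg_eq_0_iff)
      qed
    qed (rule assms)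
    thus "\<exists>\<Lambda>\<ge>0. \<forall>x\<in>Q. (\<forall>i. 0 \<le> sg (\<sigma> i) * D i x) \<longrightarrow>
       B x \<le> \<Lambda> * ((\<Sum>i\<in>-{k}. \<bar>D i x\<bar>) + max 0 (D k x))"
      by (metis G P)
  qed
  then obtain L where L: "\<And>\<sigma>. L \<sigma> \<ge> 0" "\<And>\<sigma> x. x \<in> Q \<Longrightarrow> (\<forall>i. 0 \<le> sg (\<sigma> i) * D i x) \<Longrightarrow>
       B x \<le> L \<sigma> * ((\<Sum>i\<in>-{k}. \<bar>D i x\<bar>) + max 0 (D k x))"
    by metis
  show ?thesis
  proof (intro exI[of _ "\<Sum>\<sigma>\<in>UNIV. L \<sigma>"] conjI ballI)
    show "0 \<le> (\<Sum>\<sigma>\<in>UNIV. L \<sigma>)" using L by (intro sum_nonneg) auto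
    fix x assume x: "x \<in> Q"
    define \<sigma> where "\<sigma> = (\<lambda>i. 0 \<le> D i x)"
    have "B x \<le> L \<sigma> * ((\<Sum>i\<in>-{k}. \<bar>D i x\<bar>) + max 0 (D k x))"
      by (rule L(2)[OF x]) (auto simp: sg_def \<sigma>_def)
    also have "\<dots> \<le> (\<Sum>\<sigma>\<in>UNIV. L \<sigma>) * ((\<Sum>i\<in>-{k}. \<bar>D i x\<bar>) + max 0 (D k x))"
      by (intro mult_right_mono member_le_sum add_nonneg_nonneg sum_nonneg) (use L in auto)
    finally show "B x \<le> (\<Sum>\<sigma>\<in>UNIV. L \<sigma>) * ((\<Sum>i\<in>-{k}. \<bar>D i x\<bar>) + max 0 (D k x))" .
  qed
qed

subsection \<open>Piecewise linear curves\<close>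

definition pl :: "(int \<Rightarrow> 'a::real_vector) \<Rightarrow> real \<Rightarrow> 'a" where
  "pl V u = (1 - frac u) *\<^sub>R V \<lfloor>u\<rfloor> + frac u *\<^sub>R V (\<lfloor>u\<rfloor> + 1)"

lemma pl_int [simp]: "pl V (of_int k) = V k"
  by (simp add: pl_def)

text \<open>Both ends are included: at the right end the floor already points to the next edge, but
  the values agree.\<close>

lemma pl_edge:
  assumes "of_int k \<le> u" "u \<le> of_int k + 1"
  shows "pl V u = (1 - (u - of_int k)) *\<^sub>R V k + (u - of_int k) *\<^sub>R V (k + 1)"
proof (cases "u = of_int k + 1")
  case True
  hence "u = of_int (k + 1)" by simp
  thus ?thesis by (simp only: pl_int) simp
next
  case False
  hence "\<lfloor>u\<rfloor> = k" using assms by linarith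
  thus ?thesis by (simp add: pl_def frac_def)
qed

lemma pl_nth: "pl V u $ i = pl (\<lambda>k. V k $ i) u" for V :: "int \<Rightarrow> real^'n"
  by (simp add: pl_def)

lemma in_edge:
  fixes u :: real
  assumes "u \<in> {of_int a..of_int b}" "a < b"
  obtains k where "k \<in> {a..<b}" "of_int k \<le> u" "u \<le> of_int k + 1"
proof (cases "u = of_int b")
  case True thus ?thesis using that[of "b - 1"] assms by auto
next
  case False
  hence "u < of_int b" using assms by auto
  thus ?thesis using that[of "\<lfloor>u\<rfloor>"] assms by (auto simp: le_floor_iff floor_less_iff) 
qed

text \<open>Each pair of edges is parametrised by the unit square, on which all coordinate
  differences are affine. The qualitative order condition therefore yields the quantitative
  hypothesis of \<open>coordinate_isotopy\<close>: first a slope \<open>\<epsilon>\<close> common to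
  all pairs of edges, then a constant \<open>\<Lambda>\<close> belonging to that slope.\<close>

lemma polygon_isotopy:
  fixes V V' :: "int \<Rightarrow> real^3" and a b :: int
  assumes ab: "a < b" and same: "\<And>j i. i \<noteq> k \<Longrightarrow> V' j $ i = V j $ i"
    and eq: "\<And>u v. u \<in> {of_int a..of_int b} \<Longrightarrow> v \<in> {of_int a..of_int b} \<Longrightarrow>
      pl V u = pl V v \<Longrightarrow> pl V' u $ k = pl V' v $ k"
    and lt: "\<And>u v. u \<in> {of_int a..of_int b} \<Longrightarrow> v \<in> {of_int a..of_int b} \<Longrightarrow>
      (\<forall>i. i \<noteq> k \<longrightarrow> pl V u $ i = pl V v $ i) \<Longrightarrow> pl V u $ k < pl V v $ k \<Longrightarrow> pl V' u $ k < pl V' v $ k"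
  shows "ambient_isotopic (pl V ` {of_int a..of_int b}) (pl V' ` {of_int a..of_int b})"
proof -
  define Q where "Q = cbox (0::real \<times> real) (1, 1)"
  have Q: "polytope Q" by (simp add: Q_def polytope_interval)
  have Qi: "(s, t) \<in> Q \<longleftrightarrow> 0 \<le> s \<and> s \<le> 1 \<and> 0 \<le> t \<and> t \<le> 1" for s t
    by (auto simp: Q_def zero_prod_def cbox_Pair_eq)
  define D where "D = (\<lambda>(W::int \<Rightarrow> real^3) p i (x::real \<times> real).
     ((1 - fst x) * W (fst p) $ i + fst x * W (fst p + 1) $ i) -
     ((1 - snd x) * W (snd p) $ i + snd x * W (snd p + 1) $ i))"
  have Daff: "affine_fun (D W p i)" for W p i
    unfolding affine_fun_def
    by (intro exI[of _ "(W (fst p + 1) $ i - W (fst p) $ i, - (W (snd p + 1) $ i - W (snd p) $ i))"]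
        exI[of _ "W (fst p) $ i - W (snd p) $ i"]) (auto simp: D_def algebra_simps)
  have D: "D W p i (s, t) = pl W (of_int (fst p) + s) $ i - pl W (of_int (snd p) + t) $ i"
    if "(s, t) \<in> Q" for W p i s t
    using that[unfolded Qi] by (simp add: pl_edge[of "fst p" "of_int (fst p) + s"] pl_edge[of "snd p" "of_int (snd p) + t"] D_def)
  define E where "E = {a..<b} \<times> {a..<b}"
  have inS: "of_int (fst p) + s \<in> {of_int a..of_int b} \<and> of_int (snd p) + t \<in> {of_int a..of_int b}"
    if "(s, t) \<in> Q" "p \<in> E" for s t p
  proof -
    have "a \<le> fst p" "fst p + 1 \<le> b" "a \<le> snd p" "snd p + 1 \<le> b" using that(2) by (auto simp: E_def)
    hence "real_of_int a \<le> of_int (fst p)" "real_of_int (fst p + 1) \<le> of_int b" 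
       "real_of_int a \<le> of_int (snd p)" "real_of_int (snd p + 1) \<le> of_int b" by (simp_all only: of_int_le_iff)
    thus ?thesis using that(1)[unfolded Qi] by auto
  qed
  have le0: "D V' p k x \<le> 0" and lt0: "D V p k x < 0 \<Longrightarrow> D V' p k x < 0"
    if H: "p \<in> E" "x \<in> Q" "\<forall>i. i \<noteq> k \<longrightarrow> D V p i x = 0" "D V p k x \<le> 0" for p x
  proof -
    obtain s t where x: "x = (s, t)" by (cases x)
    define u where "u = of_int (fst p) + s"
    define v where "v = of_int (snd p) + t"
    have uv: "u \<in> {of_int a..of_int b}" "v \<in> {of_int a..of_int b}"
      using inS[of s t p] H x by (auto simp: u_def v_def)
    have DD: "D W p i x = pl W u $ i - pl W v $ i" for W i
      using D[of s t W p i] H(2) x by (simp add: u_def v_def)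
    have oth: "\<forall>i. i \<noteq> k \<longrightarrow> pl V u $ i = pl V v $ i" using H(3) DD by auto
    show l: "D V' p k x < 0" if "D V p k x < 0"
      using lt[OF uv oth] that DD by auto
    show "D V' p k x \<le> 0"
    proof (cases "D V p k x = 0")
      case True
      hence "pl V u = pl V v" using oth DD by (metis eq_iff_diff_eq_0 vec_eq_iff)
      thus ?thesis using eq[OF uv] DD by simp
    next
      case False
      thus ?thesis using l H(4) by auto
    qed
  qed
  have "\<forall>p\<in>E. \<exists>e>0. \<forall>\<epsilon>. 0 < \<epsilon> \<and> \<epsilon> \<le> e \<longrightarrow>
     (\<forall>x\<in>Q. (\<forall>i. i \<noteq> k \<longrightarrow> D V p i x = 0) \<and> D V p k x \<le> 0 \<longrightarrow> D V' p k x \<le> \<epsilon> * D V p k x)"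
    by (intro ballI fibre_slope Q Daff le0 lt0) auto
  then obtain e where e: "\<And>p. p \<in> E \<Longrightarrow> e p > 0" "\<And>p \<epsilon> x. p \<in> E \<Longrightarrow> 0 < \<epsilon> \<Longrightarrow> \<epsilon> \<le> e p \<Longrightarrow> x \<in> Q \<Longrightarrow>
     (\<forall>i. i \<noteq> k \<longrightarrow> D V p i x = 0) \<Longrightarrow> D V p k x \<le> 0 \<Longrightarrow> D V' p k x \<le> \<epsilon> * D V p k x"
    by metis
  have finE: "finite E" "E \<noteq> {}" using ab by (auto simp: E_def)
  define \<epsilon> where "\<epsilon> = Min (e ` E)"
  have \<epsilon>: "\<epsilon> > 0" "\<And>p. p \<in> E \<Longrightarrow> \<epsilon> \<le> e p" using finE e(1) by (auto simp: \<epsilon>_def)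
  have "\<forall>p\<in>E. \<exists>\<Lambda>\<ge>0. \<forall>x\<in>Q. D V' p k x - \<epsilon> * D V p k x \<le> \<Lambda> * ((\<Sum>i\<in>-{k}. \<bar>D V p i x\<bar>) + max 0 (D V p k x))"
    by (intro ballI fibre_bound Q Daff affine_fun_diff affine_fun_cmul) (use e(2) \<epsilon> in auto)
  then obtain L where L: "\<And>p. p \<in> E \<Longrightarrow> L p \<ge> 0" "\<And>p x. p \<in> E \<Longrightarrow> x \<in> Q \<Longrightarrow>
      D V' p k x - \<epsilon> * D V p k x \<le> L p * ((\<Sum>i\<in>-{k}. \<bar>D V p i x\<bar>) + max 0 (D V p k x))"
    by metis
  show ?thesis
  proof (rule coordinate_isotopy[where k = k and \<epsilon> = \<epsilon> and \<Lambda> = "\<Sum>p\<in>E. L p"])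
    show "{real_of_int a..real_of_int b} \<noteq> {}" using ab by auto
    show "0 \<le> (\<Sum>p\<in>E. L p)" using L by (intro sum_nonneg) auto
    show "pl V' u $ i = pl V u $ i" if "i \<noteq> k" for u i using same[OF that] by (simp add: pl_def)
    fix u v assume u: "u \<in> {real_of_int a..real_of_int b}" and v: "v \<in> {real_of_int a..real_of_int b}"
    obtain j where j: "j \<in> {a..<b}" "of_int j \<le> u" "u \<le> of_int j + 1" using in_edge[OF u ab] .
    obtain l where l: "l \<in> {a..<b}" "of_int l \<le> v" "v \<le> of_int l + 1" using in_edge[OF v ab] .
    define x where "x = (u - of_int j, v - of_int l)"
    have x: "x \<in> Q" using j l by (simp add: x_def Qi)
    have p: "(j, l) \<in> E" using j l by (simp add: E_def)
    have DD: "D W (j, l) i x = pl W u $ i - pl W v $ i" for W i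
      using D[OF x[unfolded x_def], of W "(j, l)" i] by (simp add: x_def)
    have q: "qdist k (pl V u) (pl V v) = (\<Sum>i\<in>-{k}. \<bar>D V (j, l) i x\<bar>) + max 0 (D V (j, l) k x)"
      by (simp add: qdist_def DD)
    have "(pl V' u $ k - pl V' v $ k) - \<epsilon> * (pl V u $ k - pl V v $ k) \<le> L (j, l) * qdist k (pl V u) (pl V v)"
      using L(2)[OF p x] by (simp add: q DD)
    also have "\<dots> \<le> (\<Sum>p\<in>E. L p) * qdist k (pl V u) (pl V v)"
      by (intro mult_right_mono member_le_sum qdist_nonneg) (use L p finE in auto)
    finally show "(pl V' u $ k - pl V' v $ k) - \<epsilon> * (pl V u $ k - pl V v $ k)
       \<le> (\<Sum>p\<in>E. L p) * qdist k (pl V u) (pl V v)" .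
  qed (rule \<epsilon>)
qed

lemma pl_shift: "pl V (u + of_int s) = pl (\<lambda>k. V (k + s)) u"
  by (simp add: pl_def add.commute add.left_commute)

text \<open>The reflection about -1/2 sends an edge \<open>[2 * i, 2 * i + 1]\<close> to an edge of
  the same kind, so horizontal edges stay horizontal when a curve is reversed.\<close>

lemma pl_reflect: "pl (\<lambda>k. V (-1 - k)) u = pl V (-1 - u)"
proof -
  have e: "of_int (-1 - \<lfloor>u\<rfloor> - 1) \<le> -1 - u" "-1 - u \<le> of_int (-1 - \<lfloor>u\<rfloor> - 1) + 1" by (simp_all, linarith+)
  show ?thesis unfolding pl_edge[OF e] by (simp add: pl_def frac_def algebra_simps)
qed

lemma pl_linear:
  fixes V W U :: "int \<Rightarrow> real"
  assumes "\<And>k. k \<in> {a..b} \<Longrightarrow> V k = \<alpha> * W k + \<beta> * U k + c" "u \<in> {of_int a..of_int b}" "a < b"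
  shows "pl V u = \<alpha> * pl W u + \<beta> * pl U u + c"
proof -
  obtain k where k: "k \<in> {a..<b}" "of_int k \<le> u" "u \<le> of_int k + 1" using in_edge[OF assms(2,3)] .
  show ?thesis unfolding pl_edge[OF k(2,3)] using assms(1)[of k] assms(1)[of "k + 1"] k(1)
    by (simp add: algebra_simps)
qed

lemma pl_cong:
  fixes V W :: "int \<Rightarrow> 'a::real_vector"
  assumes "\<And>k. k \<in> {a..b} \<Longrightarrow> V k = W k" "u \<in> {of_int a..of_int b}" "a < b"
  shows "pl V u = pl W u"
proof -
  obtain k where k: "k \<in> {a..<b}" "of_int k \<le> u" "u \<le> of_int k + 1" using in_edge[OF assms(2,3)] .
  show ?thesis unfolding pl_edge[OF k(2,3)] using assms(1)[of k] assms(1)[of "k + 1"] k(1) by simp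
qed

lemma pl_affine:
  assumes "\<And>k. k \<in> {a..b} \<Longrightarrow> V k = \<alpha> * of_int k + c" "u \<in> {of_int a..of_int b}" "a < b"
  shows "pl V u = \<alpha> * u + (c::real)"
proof -
  obtain k where k: "k \<in> {a..<b}" "of_int k \<le> u" "u \<le> of_int k + 1" using in_edge[OF assms(2,3)] .
  show ?thesis unfolding pl_edge[OF k(2,3)] using assms(1)[of k] assms(1)[of "k + 1"] k(1)
    by (simp add: algebra_simps)
qed

lemma pl_le:
  fixes V :: "int \<Rightarrow> real"
  assumes "\<And>k. k \<in> {a..b} \<Longrightarrow> V k \<le> B" "u \<in> {of_int a..of_int b}" "a < b"
  shows "pl V u \<le> B"
proof -
  obtain k where k: "k \<in> {a..<b}" "of_int k \<le> u" "u \<le> of_int k + 1" using in_edge[OF assms(2,3)] .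
  have "V k \<le> B" "V (k + 1) \<le> B" using assms(1) k(1) by auto
  thus ?thesis unfolding pl_edge[OF k(2,3)] real_scaleR_def
    by (rule convex_bound_le) (use k in auto)
qed

text \<open>A convex combination of values at most \<open>B\<close> equals \<open>B\<close> only if
  each value with positive weight does, and the two ends of an edge cannot both have index
  \<open>e\<close>.\<close>

lemma pl_eq_bound:
  fixes V :: "int \<Rightarrow> real"
  assumes "\<And>k. k \<in> {a..b} \<Longrightarrow> V k \<le> B" "\<And>k. k \<in> {a..b} \<Longrightarrow> V k = B \<Longrightarrow> k = e"
    and "u \<in> {of_int a..of_int b}" "a < b" "pl V u = B"
  shows "u = of_int e"
proof -
  obtain k where k: "k \<in> {a..<b}" "of_int k \<le> u" "u \<le> of_int k + 1" using in_edge[OF assms(3,4)] .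
  define s where "s = u - of_int k"
  have s: "0 \<le> s" "s \<le> 1" using k by (auto simp: s_def)
  have b: "V k \<le> B" "V (k + 1) \<le> B" using assms(1) k(1) by auto
  have e: "(1 - s) * (B - V k) + s * (B - V (k + 1)) = 0"
    using assms(5) unfolding pl_edge[OF k(2,3)] by (simp add: s_def algebra_simps)
  moreover have "0 \<le> (1 - s) * (B - V k)" "0 \<le> s * (B - V (k + 1))" using s b by auto
  ultimately have z: "(1 - s) * (B - V k) = 0" "s * (B - V (k + 1)) = 0" by linarith+
  consider "s = 0" | "s = 1" | "V k = B" "V (k + 1) = B" using z by force
  thus ?thesis
  proof cases
    case 1
    hence "k = e" using z assms(2)[of k] k(1) by auto
    thus ?thesis using 1 by (simp add: s_def)
  next
    case 2
    hence "k + 1 = e" using z assms(2)[of "k + 1"] k(1) by auto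
    hence "of_int (k + 1) = (of_int e :: real)" by (rule arg_cong)
    thus ?thesis using 2 by (simp add: s_def)
  next
    case 3
    hence "k = e" "k + 1 = e" using assms(2) k(1) by auto
    thus ?thesis by simp
  qed
qed

lemma pl_max:
  fixes V :: "int \<Rightarrow> real"
  assumes "\<And>k. k \<in> {a..b} \<Longrightarrow> V k \<le> B \<and> (V k = B \<longrightarrow> k = e)" "u \<in> {of_int a..of_int b}" "a < b"
  shows "pl V u \<le> B" "pl V u = B \<Longrightarrow> u = of_int e"
  by (rule pl_le[of a b], use assms in auto) (rule pl_eq_bound[of a b V B], use assms in auto)

lemma pl_strict_mono:
  fixes V :: "int \<Rightarrow> real"
  assumes inc: "\<And>k. k \<in> {a..<b} \<Longrightarrow> V k < V (k + 1)" and uv: "of_int a \<le> u" "u < v" "v \<le> of_int b"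
  shows "pl V u < pl V v"
proof -
  have edge: "pl V s < pl V t" if "k \<in> {a..<b}" "of_int k \<le> s" "s < t" "t \<le> of_int k + 1" for k s t
  proof -
    have s: "of_int k \<le> s" "s \<le> of_int k + 1" and t: "of_int k \<le> t" "t \<le> of_int k + 1" using that by auto
    have "pl V t - pl V s = (t - s) * (V (k + 1) - V k)"
      unfolding pl_edge[OF s] pl_edge[OF t] by (simp add: algebra_simps)
    also have "\<dots> > 0" using inc[OF that(1)] that(3) by simp
    finally show ?thesis by simp
  qed
  have mono: "V j \<le> V k" if "j \<le> k" "a \<le> j" "k \<le> b" for j k
    using that by (induction k rule: int_ge_induct) (auto, smt (verit) inc atLeastLessThan_iff)
  define k where "k = \<lfloor>u\<rfloor>"
  have ab: "a < b" using uv by linarith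
  have k: "of_int k \<le> u" "u < of_int k + 1" "k \<in> {a..<b}" 
    using uv by (auto simp: k_def le_floor_iff floor_less_iff)
  show ?thesis
  proof (cases "v \<le> of_int k + 1")
    case True thus ?thesis using edge[OF k(3,1) uv(2)] by simp
  next
    case False
    define l where "l = \<lceil>v\<rceil> - 1"
    have l: "of_int l < v" "v \<le> of_int l + 1" by (auto simp: l_def) linarith+
    have lb: "l \<in> {a..<b}" "k + 1 \<le> l" using l False uv k(1,3) by auto
    have "pl V u < pl V (of_int (k + 1))" using edge[OF k(3), of u "of_int (k+1)"] k by auto
    also have "\<dots> \<le> pl V (of_int l)" using mono[of "k + 1" l] lb k by (simp del: of_int_add)
    also have "\<dots> < pl V v" using edge[OF lb(1), of "of_int l" v] l by auto
    finally show ?thesis .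
  qed
qed

definition tri :: "(int \<Rightarrow> real) \<Rightarrow> (int \<Rightarrow> real) \<Rightarrow> (int \<Rightarrow> real) \<Rightarrow> int \<Rightarrow> real^3" where
  "tri a b c k = vector [a k, b k, c k]"

lemma pl_tri: "pl (tri a b c) u = vector [pl a u, pl b u, pl c u]"
  by (simp add: vec_eq_iff forall_3 pl_nth tri_def vector_3)

lemma pl_tri_nth [simp]: "pl (tri a b c) u $ 1 = pl a u" "pl (tri a b c) u $ 2 = pl b u" "pl (tri a b c) u $ 3 = pl c u"
  by (simp_all add: pl_tri vector_3)

text \<open>One equation between signs carries both hypotheses of \<open>polygon_isotopy\<close>; as
  \<open>sgn\<close> is odd, it is enough to have it for \<open>u \<le> v\<close>, which halves
  later case distinctions.\<close>

lemma polygon_isotopy_sgn: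
  fixes V V' :: "int \<Rightarrow> real^3" and a b :: int
  assumes ab: "a < b" and same: "\<And>j i. i \<noteq> k \<Longrightarrow> V' j $ i = V j $ i"
    and sg: "\<And>u v. u \<in> {of_int a..of_int b} \<Longrightarrow> v \<in> {of_int a..of_int b} \<Longrightarrow> u \<le> v \<Longrightarrow>
      (\<forall>i. i \<noteq> k \<longrightarrow> pl V u $ i = pl V v $ i) \<Longrightarrow>
      sgn (pl V u $ k - pl V v $ k) = sgn (pl V' u $ k - pl V' v $ k)"
  shows "ambient_isotopic (pl V ` {of_int a..of_int b}) (pl V' ` {of_int a..of_int b})"
proof -
  have s: "sgn (pl V u $ k - pl V v $ k) = sgn (pl V' u $ k - pl V' v $ k)"
    if "u \<in> {of_int a..of_int b}" "v \<in> {of_int a..of_int b}" "\<forall>i. i \<noteq> k \<longrightarrow> pl V u $ i = pl V v $ i" for u v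
  proof (cases "u \<le> v")
    case True thus ?thesis using sg that by blast
  next
    case False
    hence "sgn (pl V v $ k - pl V u $ k) = sgn (pl V' v $ k - pl V' u $ k)" using sg[of v u] that by auto
    hence "sgn (- (pl V v $ k - pl V u $ k)) = sgn (- (pl V' v $ k - pl V' u $ k))" by (simp only: sgn_minus)
    thus ?thesis by simp
  qed
  show ?thesis
  proof (rule polygon_isotopy[OF ab same])
    fix u v assume H: "u \<in> {real_of_int a..real_of_int b}" "v \<in> {real_of_int a..real_of_int b}"
    show "pl V' u $ k = pl V' v $ k" if "pl V u = pl V v"
      using s[OF H] that by (simp add: sgn_0_0)
    show "pl V' u $ k < pl V' v $ k" if "\<forall>i. i \<noteq> k \<longrightarrow> pl V u $ i = pl V v $ i" "pl V u $ k < pl V v $ k"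
      using s[OF H that(1)] that(2) by (simp add: sgn_if split: if_splits)
  qed
qed

lemma isotopy_coords:
  fixes a b c a' b' c' :: "int \<Rightarrow> real" and l m :: int
  assumes "l < m"
  defines "I \<equiv> {of_int l..of_int m}"
  shows isotopy_coord1: "(\<And>u v. u \<in> I \<Longrightarrow> v \<in> I \<Longrightarrow> u \<le> v \<Longrightarrow>
      pl b u = pl b v \<Longrightarrow> pl c u = pl c v \<Longrightarrow> sgn (pl a u - pl a v) = sgn (pl a' u - pl a' v)) \<Longrightarrow>
      ambient_isotopic (pl (tri a b c) ` I) (pl (tri a' b c) ` I)"
    and isotopy_coord2: "(\<And>u v. u \<in> I \<Longrightarrow> v \<in> I \<Longrightarrow> u \<le> v \<Longrightarrow>
      pl a u = pl a v \<Longrightarrow> pl c u = pl c v \<Longrightarrow> sgn (pl b u - pl b v) = sgn (pl b' u - pl b' v)) \<Longrightarrow>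
      ambient_isotopic (pl (tri a b c) ` I) (pl (tri a b' c) ` I)"
    and isotopy_coord3: "(\<And>u v. u \<in> I \<Longrightarrow> v \<in> I \<Longrightarrow> u \<le> v \<Longrightarrow>
      pl a u = pl a v \<Longrightarrow> pl b u = pl b v \<Longrightarrow> sgn (pl c u - pl c v) = sgn (pl c' u - pl c' v)) \<Longrightarrow>
      ambient_isotopic (pl (tri a b c) ` I) (pl (tri a b c') ` I)"
proof -
  have t: "tri a b c j $ 1 = a j" "tri a b c j $ 2 = b j" "tri a b c j $ 3 = c j" for a b c j
    by (simp_all add: tri_def vector_3)
  have ex: "i = 1 \<or> i = 2 \<or> i = 3" for i :: 3 by (rule exhaust_3)
  note iso = polygon_isotopy_sgn[OF assms(1), folded I_def]
  show "ambient_isotopic (pl (tri a b c) ` I) (pl (tri a' b c) ` I)" if "\<And>u v. u \<in> I \<Longrightarrow> v \<in> I \<Longrightarrow> u \<le> v \<Longrightarrow>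
      pl b u = pl b v \<Longrightarrow> pl c u = pl c v \<Longrightarrow> sgn (pl a u - pl a v) = sgn (pl a' u - pl a' v)"
  proof (rule iso[where k = 1])
    show "tri a' b c j $ i = tri a b c j $ i" if "i \<noteq> 1" for i j using ex[of i] that t by auto
  qed (simp add: forall_3 that)
  show "ambient_isotopic (pl (tri a b c) ` I) (pl (tri a b' c) ` I)" if "\<And>u v. u \<in> I \<Longrightarrow> v \<in> I \<Longrightarrow> u \<le> v \<Longrightarrow>
      pl a u = pl a v \<Longrightarrow> pl c u = pl c v \<Longrightarrow> sgn (pl b u - pl b v) = sgn (pl b' u - pl b' v)"
  proof (rule iso[where k = 2])
    show "tri a b' c j $ i = tri a b c j $ i" if "i \<noteq> 2" for i j using ex[of i] that t by auto
  qed (simp add: forall_3 that)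
  show "ambient_isotopic (pl (tri a b c) ` I) (pl (tri a b c') ` I)" if "\<And>u v. u \<in> I \<Longrightarrow> v \<in> I \<Longrightarrow> u \<le> v \<Longrightarrow>
      pl a u = pl a v \<Longrightarrow> pl b u = pl b v \<Longrightarrow> sgn (pl c u - pl c v) = sgn (pl c' u - pl c' v)"
  proof (rule iso[where k = 3])
    show "tri a b c' j $ i = tri a b c j $ i" if "i \<noteq> 3" for i j using ex[of i] that t by auto
  qed (simp add: forall_3 that)
qed

text \<open>Vertex \<open>2 * i\<close> is \<open>(x i, y i)\<close> and vertex
  \<open>2 * i + 1\<close> is \<open>(x (i + 1), y i)\<close>: even edges are horizontal, odd edges
  vertical. Heights use \<open>cx\<close> as well, since they change only along horizontal
  edges.\<close>

definition cx :: "(int \<Rightarrow> 'a) \<Rightarrow> int \<Rightarrow> 'a" where "cx x k = x ((k + 1) div 2)"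
definition cy :: "(int \<Rightarrow> 'a) \<Rightarrow> int \<Rightarrow> 'a" where "cy y k = y (k div 2)"

definition knot :: "(int \<Rightarrow> real) \<Rightarrow> (int \<Rightarrow> real) \<Rightarrow> (int \<Rightarrow> real) \<Rightarrow> (real^3) set" where
  "knot x y z = range (pl (tri (cx x) (cy y) (cx z)))"

lemma periodic_mult:
  fixes f :: "int \<Rightarrow> 'a" assumes "\<And>i. f (i + n) = f i" shows "f (i + n * k) = f i"
proof (induction k rule: int_induct[where k = 0])
  case (step1 k)
  thus ?case using assms[of "i + n * k"] by (simp add: algebra_simps)
next
  case (step2 k)
  thus ?case using assms[of "i + n * (k - 1)"] by (simp add: algebra_simps)
qed simp

lemma pl_periodic_range:
  fixes V :: "int \<Rightarrow> 'a::real_vector"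
  assumes "\<And>i. V (i + N) = V i" "0 < N" "b = a + N"
  shows "range (pl V) = pl V ` {of_int a..of_int b}"
proof -
  have "pl V u \<in> pl V ` {of_int a..of_int b}" for u
  proof -
    define q where "q = \<lfloor>(u - of_int a) / of_int N\<rfloor>"
    have "of_int q \<le> (u - of_int a) / of_int N" "(u - of_int a) / of_int N < of_int q + 1"
      by (simp_all add: q_def)
    hence q: "of_int q * of_int N \<le> u - of_int a" "u - of_int a < (of_int q + 1) * of_int N"
      using assms(2) by (simp_all add: field_simps)
    define v where "v = u - of_int (N * q)"
    have "v \<in> {of_int a..of_int b}" using q by (simp add: v_def assms(3) algebra_simps)
    moreover have "pl V v = pl V u"
    proof -
      have "pl V u = pl V (v + of_int (N * q))" by (simp add: v_def)
      also have "\<dots> = pl (\<lambda>k. V (k + N * q)) v" by (rule pl_shift)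
      also have "(\<lambda>k. V (k + N * q)) = V" using periodic_mult[of V N] assms(1) by auto
      finally show ?thesis by simp
    qed
    ultimately show ?thesis by (metis image_eqI)
  qed
  thus ?thesis by auto
qed

lemma cx_periodic: "(\<And>i. x (i + n) = x i) \<Longrightarrow> cx x (k + 2 * n) = cx x k"
  and cy_periodic: "(\<And>i. y (i + n) = y i) \<Longrightarrow> cy y (k + 2 * n) = cy y k"
proof -
  have e: "(k + 2 * n + 1) div 2 = (k + 1) div 2 + n" "(k + 2 * n) div 2 = k div 2 + n" by presburger+
  show "(\<And>i. x (i + n) = x i) \<Longrightarrow> cx x (k + 2 * n) = cx x k" unfolding cx_def e by simp
  show "(\<And>i. y (i + n) = y i) \<Longrightarrow> cy y (k + 2 * n) = cy y k" unfolding cy_def e by simp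
qed

lemma knot_interval:
  assumes "\<And>i. x (i + n) = x i" "\<And>i. y (i + n) = y i" "\<And>i. z (i + n) = z i" "0 < n"
  shows "knot x y z = pl (tri (cx x) (cy y) (cx z)) ` {of_int a..of_int (a + 2 * n)}"
  unfolding knot_def
proof (rule pl_periodic_range)
  show "tri (cx x) (cy y) (cx z) (i + 2 * n) = tri (cx x) (cy y) (cx z) i" for i
    by (simp only: tri_def cx_periodic[of x n, OF assms(1)] cy_periodic[of y n, OF assms(2)] cx_periodic[of z n, OF assms(3)])
qed (use assms in simp_all)

section \<open>Moving the corner path\<close>

text \<open>The old curve has its upper right corner at \<open>(x n, y (n - 1)) = (R, T)\<close>. The new curve is
  an affine image of the old one except that the path from vertex \<open>2 * n - 2\<close> through this corner
  to vertex \<open>2 * n\<close> is replaced by a path with \<open>2 * \<mu>\<close> interior vertices, which the new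
  indexing puts first.\<close>

locale corner_move =
  fixes n \<mu> :: int and x y z x' y' z' :: "int \<Rightarrow> real" and K L c1 c2 R T :: real
  assumes n2: "2 \<le> n" and mu: "1 \<le> \<mu>" and KL: "0 < K" "0 < L"
    and per: "x (i + n) = x i" "y (i + n) = y i" "z (i + n) = z i"
    and per': "x' (i + (\<mu> + n)) = x' i" "y' (i + (\<mu> + n)) = y' i" "z' (i + (\<mu> + n)) = z' i"
    and zrec: "z (i + 1) = z i + y i * (x (i + 1) - x i)"
    and zrec': "z' (i + 1) = z' i + y' i * (x' (i + 1) - x' i)"
    and x0: "x 0 = R" and xR: "l \<in> {1..n-1} \<Longrightarrow> x l < R" and xinj: "l \<in> {1..n-2} \<Longrightarrow> x l \<noteq> x (n - 1)"
    and yT: "y (n - 1) = T" and yl: "l \<in> {0..n-2} \<Longrightarrow> y l < T"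
    and x': "l \<in> {0..n-1} \<Longrightarrow> x' (\<mu> + l) = K * x l + c1"
    and y': "l \<in> {0..n-2} \<Longrightarrow> y' (\<mu> + l) = L * y l + c2"
    and Y': "l \<in> {0..n-2} \<Longrightarrow> L * y l + c2 < y' (\<mu> + n - 1)"
    and crossing: "i \<in> {0..n-3} \<Longrightarrow> x (n - 1) \<in> {x i<..<x (i+1)} \<union> {x (i+1)<..<x i} \<Longrightarrow>
        y i \<in> {y (n - 2)<..<T} \<Longrightarrow> z i + y i * (x (n - 1) - x i) \<noteq> z (n - 1)"
    and above: "u \<in> {-1..2 * of_int \<mu> - 1} \<Longrightarrow> pl (cx x') u = K * R + c1 \<Longrightarrow>
        u = 2 * of_int \<mu> - 1 \<or> y' (\<mu> - 1) < pl (cy y') u"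
    and down: "y' \<mu> < y' (\<mu> - 1)" and left: "x' 0 < x' (-1)"
    and planar: "u \<in> {-2..2 * of_int (\<mu> + n) - 2} \<Longrightarrow> v \<in> {-2..2 * of_int (\<mu> + n) - 2} \<Longrightarrow>
        pl (cx x') u = pl (cx x') v \<Longrightarrow> pl (cy y') u = pl (cy y') v \<Longrightarrow> u = v \<or>
        (u = -2 \<or> 2 * of_int \<mu> \<le> u) \<and> (v = -2 \<or> 2 * of_int \<mu> \<le> v)"
begin

abbreviation "N \<equiv> 2 * (\<mu> + n)"

text \<open>The level separating the kept part from the raised path.\<close>

definition "B = Max ((\<lambda>i. \<bar>z' i\<bar>) ` {0..<\<mu> + n})"

lemma zB: "z' i \<le> B"
proof -
  have "z' i = z' (i mod (\<mu> + n) + (\<mu> + n) * (i div (\<mu> + n)))" by simp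
  also have "\<dots> = z' (i mod (\<mu> + n))" by (rule periodic_mult) (rule per')
  also have "\<dots> \<le> \<bar>z' (i mod (\<mu> + n))\<bar>" by simp
  also have "\<dots> \<le> B" unfolding B_def by (rule Max_ge) (use n2 mu in auto)
  finally show ?thesis .
qed

text \<open>The old top edge is cut into as many equal pieces as there are edges from vertex
  \<open>-2\<close> to vertex \<open>2 * \<mu> - 1\<close>, so that the old and the new curve become
  polygons over the same index set.\<close>

definition "sl = (R - x (n - 1)) / (2 * of_int \<mu> + 1)"

lemma slope: "0 < sl" "sl * (2 * of_int \<mu> + 1) = R - x (n - 1)"
  using xR[of "n - 1"] n2 mu by (simp_all add: sl_def)

text \<open>\<open>xn\<close>, \<open>yn\<close>, \<open>zn\<close> describe the old curve with extra vertices spaced equally on its top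
  edge, \<open>zr\<close> the raised heights. The parameter intervals \<open>RT\<close>, \<open>RD\<close>, \<open>RL\<close> belong to the old top edge,
  the old right edge and the part that is kept.\<close>

definition "xn k = (if k < 2 * \<mu> then sl * of_int k
    + (x (n - 1) + 2 * (sl)) else cx x (k - 2 * \<mu>))"
definition "yn k = (if k < 2 * \<mu> then T else cy y (k - 2 * \<mu>))"
definition "zn k = (if k < 2 * \<mu> then z (n - 1) + T * (xn k - x (n - 1)) else cx z (k - 2 * \<mu>))"
definition "zr k = (if -1 \<le> k \<and> k < 2 * \<mu> then B + of_int k + 2 else cx z' k)"

abbreviation "I \<equiv> {-2..2 * real_of_int (\<mu> + n) - 2}"

definition "RT = {-2..2 * real_of_int \<mu> - 1}"
definition "RD = {2 * real_of_int \<mu> - 1..2 * real_of_int \<mu>}"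
definition "RL = {2 * real_of_int \<mu>..2 * real_of_int (\<mu> + n) - 2}"

lemma regions: "I = RT \<union> RD \<union> RL"
  using n2 mu by (auto simp: RT_def RD_def RL_def)

lemma region_ivl:
  "RT = {real_of_int (-2)..of_int (2 * \<mu> - 1)}" "RD = {real_of_int (2 * \<mu> - 1)..of_int (2 * \<mu>)}"
  "RL = {real_of_int (2 * \<mu>)..of_int (N - 2)}" "-2 < 2 * \<mu> - 1" "2 * \<mu> - 1 < 2 * \<mu>" "2 * \<mu> < N - 2"
  using n2 mu by (auto simp: RT_def RD_def RL_def)

lemma T_x: "u \<in> RT \<Longrightarrow> pl xn u = sl * u
    + (x (n - 1) + 2 * (sl))"
  by (rule pl_affine[of "-2" "2 * \<mu> - 1"]) (use mu in \<open>auto simp: xn_def RT_def\<close>)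

lemma T_x_inj: "u \<in> RT \<Longrightarrow> v \<in> RT \<Longrightarrow> pl xn u = pl xn v \<Longrightarrow> u = v"
  using slope by (simp add: T_x)

lemma T_y: "u \<in> RT \<Longrightarrow> pl yn u = T"
  using pl_affine[of "-2" "2 * \<mu> - 1" yn 0 T u] mu by (auto simp: yn_def RT_def)

lemma cx_even [simp]: "cx f (2 * i) = f i" and cx_odd [simp]: "cx f (2 * i + 1) = f (i + 1)"
  and cx_odd' [simp]: "cx f (2 * i - 1) = f i"
  and cy_even [simp]: "cy f (2 * i) = f i" and cy_odd [simp]: "cy f (2 * i + 1) = f i"
  and cy_odd' [simp]: "cy f (2 * i - 1) = f (i - 1)"
  unfolding cx_def cy_def by (rule arg_cong[where f = f], presburger)+

lemma zr_m2: "zr (-2) = z' (-1)"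
  using cx_even[of z' "-1"] mu by (simp add: zr_def)

text \<open>The first step climbs from \<open>z' (-1) \<le> B\<close> to \<open>B + 1\<close>; all
  others have size 1.\<close>

lemma T_zr_step: "k \<in> {-2..<2 * \<mu> - 1} \<Longrightarrow> zr k < zr (k + 1)"
  using zB[of "-1"] zr_m2 by (cases "k = -2") (auto simp: zr_def)

lemma T_zr: "u \<in> RT \<Longrightarrow> v \<in> RT \<Longrightarrow> u < v \<Longrightarrow> pl zr u < pl zr v"
  by (rule pl_strict_mono[of "-2" "2 * \<mu> - 1"]) (auto simp: region_ivl intro: T_zr_step)

lemma T_zr_inj: "u \<in> RT \<Longrightarrow> v \<in> RT \<Longrightarrow> pl zr u = pl zr v \<Longrightarrow> u = v"
  using T_zr[of u v] T_zr[of v u] by (cases u v rule: linorder_cases) auto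

text \<open>Hence only the first edge of the path, between the vertices \<open>-2\<close> and
  \<open>-1\<close>, can share a height with the kept part.\<close>

lemma T_zr_high: "u \<in> RT \<Longrightarrow> -1 \<le> u \<Longrightarrow> B < pl zr u"
proof (cases "u = -1")
  case True
  have "pl zr (of_int (-1)) = B + 1" unfolding pl_int using mu by (simp add: zr_def)
  thus ?thesis using True by simp
next
  case False
  assume u: "u \<in> RT" "-1 \<le> u"
  have "pl zr (of_int (-1)) = B + 1" unfolding pl_int using mu by (simp add: zr_def)
  moreover have "pl zr (of_int (-1)) < pl zr u" using T_zr[of "-1" u] u False mu by (auto simp: RT_def)
  ultimately show ?thesis by simp
qed

lemma D_edge: "u \<in> RD \<Longrightarrow> pl f u = (1 - (u - (2 * of_int \<mu> - 1))) * f (2 * \<mu> - 1) + (u - (2 * of_int \<mu> - 1)) * f (2 * \<mu>)"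
  for f :: "int \<Rightarrow> real"
  using pl_edge[of "2 * \<mu> - 1" u f] by (auto simp: RD_def)

lemma xn_nodes: "xn (2 * \<mu> - 1) = R" "xn (2 * \<mu>) = R"
proof -
  show "xn (2 * \<mu> - 1) = R" using slope(2) unfolding xn_def by (simp add: algebra_simps)
  show "xn (2 * \<mu>) = R" using x0 cx_even[of x 0] by (simp add: xn_def)
qed

lemma D_x: "u \<in> RD \<Longrightarrow> pl xn u = R"
  unfolding D_edge xn_nodes by (simp add: algebra_simps)

lemma D_y: "u \<in> RD \<Longrightarrow> pl yn u = T - (u - (2 * of_int \<mu> - 1)) * (T - y 0)"
  using cy_even[of y 0] by (simp add: D_edge yn_def algebra_simps)

lemma D_y_inj: "u \<in> RD \<Longrightarrow> v \<in> RD \<Longrightarrow> pl yn u = pl yn v \<Longrightarrow> u = v"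
  using yl[of 0] n2 by (simp add: D_y)

lemma D_zr: "u \<in> RD \<Longrightarrow> pl zr u = (B + 2 * of_int \<mu> + 1) - (u - (2 * of_int \<mu> - 1)) * (B + 2 * of_int \<mu> + 1 - z' \<mu>)"
proof -
  assume u: "u \<in> RD"
  have "zr (2 * \<mu> - 1) = B + 2 * of_int \<mu> + 1" "zr (2 * \<mu>) = z' \<mu>" using mu by (simp_all add: zr_def)
  thus ?thesis unfolding D_edge[OF u] by (simp only:) (simp add: algebra_simps)
qed

lemma D_zr_pos: "0 < B + 2 * of_int \<mu> + 1 - z' \<mu>"
  using zB[of \<mu>] mu by simp

lemma D_zr_inj: "u \<in> RD \<Longrightarrow> v \<in> RD \<Longrightarrow> pl zr u = pl zr v \<Longrightarrow> u = v"
  using D_zr_pos by (simp add: D_zr)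

lemma D_x': "u \<in> RD \<Longrightarrow> pl (cx x') u = K * R + c1"
  using x'[of 0] n2 x0 unfolding D_edge cx_even cx_odd' by (simp add: algebra_simps)

lemma D_y': "u \<in> RD \<Longrightarrow> pl (cy y') u \<le> y' (\<mu> - 1)"
proof -
  assume u: "u \<in> RD"
  have "pl (cy y') u = y' (\<mu> - 1) - (u - (2 * of_int \<mu> - 1)) * (y' (\<mu> - 1) - y' \<mu>)"
    unfolding D_edge[OF u] cy_even cy_odd' by (simp add: algebra_simps)
  moreover have "0 \<le> (u - (2 * of_int \<mu> - 1)) * (y' (\<mu> - 1) - y' \<mu>)"
    using u down by (intro mult_nonneg_nonneg) (auto simp: RD_def)
  ultimately show ?thesis by simp
qed

lemma L_node: assumes "k \<in> {2 * \<mu>..N - 2}"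
  shows "xn k = cx x (k - 2 * \<mu>)" "yn k = cy y (k - 2 * \<mu>)" "zn k = cx z (k - 2 * \<mu>)" "zr k = cx z' k"
    "(k - 2 * \<mu> + 1) div 2 \<in> {0..n-1}" "(k - 2 * \<mu>) div 2 \<in> {0..n-1}"
    "cx f k = f (\<mu> + (k - 2 * \<mu> + 1) div 2)" "cy f k = f (\<mu> + (k - 2 * \<mu>) div 2)"
proof -
  show "(k - 2 * \<mu> + 1) div 2 \<in> {0..n-1}" "(k - 2 * \<mu>) div 2 \<in> {0..n-1}" using assms by auto
  show "cx f k = f (\<mu> + (k - 2 * \<mu> + 1) div 2)" "cy f k = f (\<mu> + (k - 2 * \<mu>) div 2)"
    unfolding cx_def cy_def by (rule arg_cong[where f = f], presburger)+
qed (use assms mu in \<open>auto simp: xn_def yn_def zn_def zr_def\<close>)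

lemma RL_max:
  fixes V :: "int \<Rightarrow> real"
  assumes "\<And>k. k \<in> {2 * \<mu>..N - 2} \<Longrightarrow> V k \<le> b \<and> (V k = b \<longrightarrow> k = e)" "u \<in> RL"
  shows "pl V u \<le> b" "pl V u = b \<Longrightarrow> u = of_int e"
proof -
  have u: "u \<in> {of_int (2 * \<mu>)..of_int (N - 2)}" using assms(2) region_ivl(3) by blast
  show "pl V u \<le> b" by (rule pl_max(1)[OF assms(1) u region_ivl(6)])
  show "u = of_int e" if "pl V u = b" by (rule pl_max(2)[OF assms(1) u region_ivl(6) that])
qed

lemma L_x_eq: "u \<in> RL \<Longrightarrow> pl xn u = R \<Longrightarrow> u = 2 * of_int \<mu>"
proof -
  have b: "xn k \<le> R \<and> (xn k = R \<longrightarrow> k = 2 * \<mu>)" if k: "k \<in> {2 * \<mu>..N - 2}" for k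
  proof -
    have "k = 2 * \<mu> \<or> (k - 2 * \<mu> + 1) div 2 \<in> {1..n-1}" using k by auto
    thus ?thesis using L_node(1)[OF k] xR xn_nodes by (fastforce simp: cx_def)
  qed
  show "u = 2 * of_int \<mu>" if "u \<in> RL" "pl xn u = R"
    using RL_max(2)[of xn R "2 * \<mu>" u] b that by simp
qed

lemma L_y_le: "u \<in> RL \<Longrightarrow> pl yn u \<le> T" and L_y_eq: "u \<in> RL \<Longrightarrow> pl yn u = T \<Longrightarrow> u = 2 * of_int (\<mu> + n) - 2"
proof -
  have b: "yn k \<le> T \<and> (yn k = T \<longrightarrow> k = N - 2)" if k: "k \<in> {2 * \<mu>..N - 2}" for k
  proof -
    have "k = N - 2 \<or> (k - 2 * \<mu>) div 2 \<in> {0..n-2}" using k by auto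
    moreover have "(N - 2 - 2 * \<mu>) div 2 = n - 1" by simp
    ultimately show ?thesis using L_node(2)[OF k] yl yT by (fastforce simp: cy_def)
  qed
  show "pl yn u \<le> T" if "u \<in> RL" by (rule RL_max(1)[OF b that])
  show "u = 2 * of_int (\<mu> + n) - 2" if "u \<in> RL" "pl yn u = T"
    using RL_max(2)[of yn T "N - 2" u] b that by simp
qed

lemma L_y'_le: "u \<in> RL \<Longrightarrow> pl (cy y') u \<le> y' (\<mu> + n - 1)"
  and L_y'_eq: "u \<in> RL \<Longrightarrow> pl (cy y') u = y' (\<mu> + n - 1) \<Longrightarrow> u = 2 * of_int (\<mu> + n) - 2"
proof -
  have b: "cy y' k \<le> y' (\<mu> + n - 1) \<and> (cy y' k = y' (\<mu> + n - 1) \<longrightarrow> k = N - 2)" if k: "k \<in> {2 * \<mu>..N - 2}" for k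
  proof -
    have "k = N - 2 \<or> (k - 2 * \<mu>) div 2 \<in> {0..n-2}" using k by auto
    moreover have "cy y' (N - 2) = y' (\<mu> + n - 1)" using cy_even[of y' "\<mu> + n - 1"] by (simp add: algebra_simps)
    ultimately show ?thesis using L_node(8)[OF k, of y'] y' Y' by fastforce
  qed
  show "pl (cy y') u \<le> y' (\<mu> + n - 1)" if "u \<in> RL" by (rule RL_max(1)[OF b that])
  show "u = 2 * of_int (\<mu> + n) - 2" if "u \<in> RL" "pl (cy y') u = y' (\<mu> + n - 1)"
    using RL_max(2)[of "cy y'" "y' (\<mu> + n - 1)" "N - 2" u] b that by simp
qed

lemma L_x': "u \<in> RL \<Longrightarrow> pl (cx x') u = K * pl xn u + c1"
proof -
  assume u: "u \<in> RL"
  have "pl (cx x') u = K * pl xn u + 0 * pl xn u + c1"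
  proof (rule pl_linear[of "2 * \<mu>" "N - 2"])
    fix k assume k: "k \<in> {2 * \<mu>..N - 2}"
    show "cx x' k = K * xn k + 0 * xn k + c1"
      using x'[OF L_node(5)[OF k]] unfolding L_node(1)[OF k] L_node(7)[OF k, of x'] cx_def[of x] by simp
  qed (use u region_ivl in auto)
  thus ?thesis by simp
qed

lemma DL_x': "u \<in> RD \<union> RL \<Longrightarrow> pl (cx x') u = K * pl xn u + c1"
  using L_x' D_x D_x' by auto

lemma L_zr: "u \<in> RL \<Longrightarrow> pl zr u = pl (cx z') u"
  by (rule pl_cong[of "2 * \<mu>" "N - 2"]) (use region_ivl L_node in auto)

lemma L_zr_le: "u \<in> RL \<Longrightarrow> pl zr u \<le> B"
  unfolding L_zr by (rule pl_le[of "2 * \<mu>" "N - 2"]) (use region_ivl zB in \<open>auto simp: cx_def\<close>)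

text \<open>On the kept part the recursion for the heights is the old one up to scaling; the shift
  \<open>c2\<close> adds a multiple of \<open>x\<close>, which is constant on the lines where
  heights are compared.\<close>

lemma z'_low: "l \<in> {0..n-1} \<Longrightarrow> z' (\<mu> + l) = K * L * z l + c2 * K * x l + (z' \<mu> - K * L * z 0 - c2 * K * R)"
proof -
  assume l: "l \<in> {0..n-1}"
  hence "0 \<le> l" by simp
  thus ?thesis using l
  proof (induction l rule: int_ge_induct)
    case base thus ?case by (simp add: x0)
  next
    case (step l)
    hence l: "l \<in> {0..n-1}" "l \<in> {0..n-2}" "l + 1 \<in> {0..n-1}" by auto
    have "z' (\<mu> + (l + 1)) = z' (\<mu> + l) + y' (\<mu> + l) * (x' (\<mu> + (l + 1)) - x' (\<mu> + l))"
      using zrec'[of "\<mu> + l"] by (simp add: add.assoc)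
    also have "\<dots> = z' (\<mu> + l) + (L * y l + c2) * (K * (x (l + 1) - x l))"
      unfolding x'[OF l(1)] x'[OF l(3)] y'[OF l(2)] by (simp add: algebra_simps)
    finally show ?case unfolding zrec[of l] step.IH[OF l(1)] by (simp add: algebra_simps)
  qed
qed

lemma L_zr_lin: "u \<in> RL \<Longrightarrow> pl zr u = K * L * pl zn u + c2 * K * pl xn u + (z' \<mu> - K * L * z 0 - c2 * K * R)"
proof (rule pl_linear[of "2 * \<mu>" "N - 2"])
  fix k assume k: "k \<in> {2 * \<mu>..N - 2}"
  show "zr k = K * L * zn k + c2 * K * xn k + (z' \<mu> - K * L * z 0 - c2 * K * R)"
    using z'_low[OF L_node(5)[OF k]] unfolding L_node[OF k] by (simp add: cx_def)
qed (use region_ivl in auto)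

lemma node_ends: "xn (-2) = x (n - 1)" "zn (-2) = z (n - 1)" "cx x' (-2) = cx x' (N - 2)" "cy y' (-2) = cy y' (N - 2)"
   "zr (-2) = cx z' (N - 2)" "xn (N - 2) = x (n - 1)" "zn (N - 2) = z (n - 1)" "zr (N - 2) = cx z' (N - 2)"
   "cx z' (-2) = cx z' (N - 2)"
proof -
  show "xn (-2) = x (n - 1)" "zn (-2) = z (n - 1)" using mu by (auto simp: xn_def zn_def)
  show "cx x' (-2) = cx x' (N - 2)" using cx_periodic[of x' "\<mu> + n" "-2"] per' by simp
  show "cy y' (-2) = cy y' (N - 2)" using cy_periodic[of y' "\<mu> + n" "-2"] per' by simp
  show p: "cx z' (-2) = cx z' (N - 2)" using cx_periodic[of z' "\<mu> + n" "-2"] per' by simp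
  thus "zr (-2) = cx z' (N - 2)" using mu by (simp add: zr_def)
  show "xn (N - 2) = x (n - 1)" "zn (N - 2) = z (n - 1)"
    using L_node(1,3)[of "N - 2"] n2 cx_even[of _ "n - 1"] by (simp_all add: right_diff_distrib)
  show "zr (N - 2) = cx z' (N - 2)" using n2 by (simp add: zr_def)
qed

lemma pl_ends: "pl f (-2) = f (-2)" "pl f (2 * of_int (\<mu> + n) - 2) = f (N - 2)" for f :: "int \<Rightarrow> real"
  using pl_int[of f "-2"] pl_int[of f "N - 2"] by simp_all

lemma region_cases:
  assumes "u \<in> I" "v \<in> I" "u \<le> v"
  obtains "u \<in> RT" "v \<in> RT" | "u \<in> RT" "v \<in> RD" | "u \<in> RT" "v \<in> RL" | "u \<in> RD" "v \<in> RD" | "u \<in> RD" "v \<in> RL" | "u \<in> RL" "v \<in> RL"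
proof (cases "v \<le> 2 * of_int \<mu> - 1")
  case True
  thus ?thesis using that(1) assms by (simp add: RT_def)
next
  case v1: False
  show ?thesis
  proof (cases "v \<le> 2 * of_int \<mu>")
    case True
    thus ?thesis using that(2,4) assms v1 by (cases "u \<le> 2 * of_int \<mu> - 1") (simp_all add: RT_def RD_def)
  next
    case False
    hence "v \<in> RL" using assms by (simp add: RL_def)
    thus ?thesis using that(3,5,6) assms
      by (cases "u \<le> 2 * of_int \<mu> - 1"; cases "u \<le> 2 * of_int \<mu>") (simp_all add: RT_def RD_def RL_def)
  qed
qed

text \<open>The top and the right edge of the old curve are extremal, so in the plane they meet the
  rest only at their ends. Two points of the kept part over the same point have equal
  \<open>xn\<close>, hence their height difference is just multiplied by
  \<open>K * L\<close>.\<close>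

lemma move_raise: assumes uv: "u \<in> I" "v \<in> I" "u \<le> v"
  and X: "pl xn u = pl xn v" and Y: "pl yn u = pl yn v"
  shows "sgn (pl zn u - pl zn v) = sgn (pl zr u - pl zr v)"
  using uv
proof (cases rule: region_cases)
  case 1
    hence "u = v" using T_x_inj X by blast
    thus ?thesis by simp
next
  case 2
  hence "v = 2 * of_int \<mu> - 1" using D_y_inj[of v "2 * of_int \<mu> - 1"] Y T_y[of u] D_y[of "2 * of_int \<mu> - 1"] by (auto simp: RD_def)
  hence "v \<in> RT" using mu by (simp add: RT_def)
  hence "u = v" using T_x_inj X 2 by blast
    thus ?thesis by simp
next
  case 3
  hence v: "v = 2 * of_int (\<mu> + n) - 2" using L_y_eq Y T_y by auto
  have "pl xn u = pl xn (-2)" using X node_ends v by (simp only: pl_ends)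
  hence "u = -2" using 3 T_x_inj[of u "-2"] mu by (auto simp: RT_def)
  thus ?thesis using v node_ends by (simp only: pl_ends diff_self)
next
  case 4
  hence "u = v" using D_y_inj Y by blast
  thus ?thesis by simp
next
  case 5
  hence v: "v = 2 * of_int \<mu>" using L_x_eq X D_x by auto
  hence "v \<in> RD" by (simp add: RD_def)
  hence "u = v" using 5 D_y_inj Y by blast
  thus ?thesis by simp
next
  case 6
  have "pl zr u - pl zr v = K * L * (pl zn u - pl zn v)"
    using 6 X by (simp add: L_zr_lin algebra_simps)
  thus ?thesis using KL by (simp add: sgn_mult)
qed

text \<open>Two points of the former top edge at equal height coincide since \<open>zr\<close> is
  strictly increasing there, and in row \<open>T\<close> this edge meets the rest only at its ends.
  Everything else moves by one affine map with factor \<open>K > 0\<close>.\<close>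

lemma move_x: assumes uv: "u \<in> I" "v \<in> I" "u \<le> v"
  and Y: "pl yn u = pl yn v" and Z: "pl zr u = pl zr v"
  shows "sgn (pl xn u - pl xn v) = sgn (pl (cx x') u - pl (cx x') v)"
proof -
  have lin: ?thesis if "u \<in> RD \<union> RL" "v \<in> RD \<union> RL"
  proof -
    have "pl (cx x') u - pl (cx x') v = K * (pl xn u - pl xn v)"
      by (simp add: DL_x'[OF that(1)] DL_x'[OF that(2)] algebra_simps)
    thus ?thesis using KL by (simp add: sgn_mult)
  qed
  show ?thesis using uv
  proof (cases rule: region_cases)
    case 1
    hence "u = v" using T_zr_inj Z by blast
    thus ?thesis by simp
  next
    case 2
    hence "v = 2 * of_int \<mu> - 1" using D_y_inj[of v "2 * of_int \<mu> - 1"] Y T_y[of u] D_y[of "2 * of_int \<mu> - 1"] by (auto simp: RD_def)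
    hence "v \<in> RT" using mu by (simp add: RT_def)
    hence "u = v" using T_zr_inj Z 2 by blast
    thus ?thesis by simp
  next
    case 3
    hence v: "v = 2 * of_int (\<mu> + n) - 2" using L_y_eq Y T_y by auto
    have "pl zr u = pl zr (-2)" using Z node_ends v by (simp only: pl_ends)
    hence "u = -2" using 3 T_zr_inj[of u "-2"] mu by (auto simp: RT_def)
    thus ?thesis using v node_ends by (simp only: pl_ends diff_self)
  qed (use lin in auto)
qed

text \<open>This stops one vertex before the end of the kept part: the last vertex lies in the top
  row, whose new height need not be \<open>L * T + c2\<close>.\<close>

lemma L_y'_lin: "u \<in> RL \<Longrightarrow> u \<le> 2 * of_int (\<mu> + n) - 3 \<Longrightarrow> pl (cy y') u = L * pl yn u + c2"
proof -
  assume u: "u \<in> RL" "u \<le> 2 * of_int (\<mu> + n) - 3"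
  have "pl (cy y') u = L * pl yn u + 0 * pl yn u + c2"
  proof (rule pl_linear[of "2 * \<mu>" "N - 3"])
    show "2 * \<mu> < N - 3" using n2 by simp
  next
    fix k assume k: "k \<in> {2 * \<mu>..N - 3}"
    hence k': "k \<in> {2 * \<mu>..N - 2}" "(k - 2 * \<mu>) div 2 \<in> {0..n-2}" by auto
    show "cy y' k = L * yn k + 0 * yn k + c2"
      using y'[OF k'(2)] unfolding L_node(2)[OF k'(1)] L_node(8)[OF k'(1), of y'] cy_def[of y] by simp
  qed (use u in \<open>auto simp: RL_def\<close>)
  thus ?thesis by simp
qed

text \<open>The last low edge is the only one that is not moved affinely. Something on the same
  vertical line and at the same height as a point of it would have to be a crossing with
  vanishing height difference, unless it lies below the whole edge.\<close>

lemma rise_edge: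
  assumes u: "u \<in> RL" "u \<le> 2 * of_int (\<mu> + n) - 3" and v: "2 * of_int (\<mu> + n) - 3 < v" "v \<le> 2 * of_int (\<mu> + n) - 2"
    and X: "pl xn u = pl xn v" and Z: "pl zr u = pl zr v"
  shows "pl yn u \<le> y (n - 2)"
proof (rule ccontr)
  assume H: "\<not> ?thesis"
  have vL: "v \<in> RL" using v n2 by (auto simp: RL_def)
  have Zn: "pl zn u = pl zn v" using Z X KL unfolding L_zr_lin[OF u(1)] L_zr_lin[OF vL] by simp
  have vv: "of_int (N - 3) \<le> v" "v \<le> of_int (N - 3) + 1" using v by auto
  have N3: "xn (N - 3) = x (n - 1)" "zn (N - 3) = z (n - 1)"
    using L_node[of "N - 3"] n2 cx_odd'[of x "n - 1"] cx_odd'[of z "n - 1"] by (auto simp: algebra_simps)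
  have e: "pl xn v = x (n - 1)" "pl zn v = z (n - 1)"
    unfolding pl_edge[OF vv] using node_ends N3 by (simp_all add: algebra_simps)
  have l: "2 * \<mu> < N - 3" using n2 by simp
  have uu: "u \<in> {of_int (2 * \<mu>)..of_int (N - 3)}" using u by (auto simp: RL_def)
  obtain k where k: "k \<in> {2 * \<mu>..<N - 3}" "of_int k \<le> u" "u \<le> of_int k + 1"
    using in_edge[OF uu l] .
  have kL: "k \<in> {2 * \<mu>..N - 2}" "k + 1 \<in> {2 * \<mu>..N - 2}" using k by auto
  define s where "s = u - of_int k"
  have s: "0 \<le> s" "s \<le> 1" using k by (auto simp: s_def)
  have px: "(1 - s) * cx x (k - 2 * \<mu>) + s * cx x (k - 2 * \<mu> + 1) = x (n - 1)"
    using X e unfolding pl_edge[OF k(2,3)] L_node[OF kL(1)] L_node[OF kL(2)] by (simp add: s_def algebra_simps)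
  have py: "pl yn u = (1 - s) * cy y (k - 2 * \<mu>) + s * cy y (k - 2 * \<mu> + 1)"
    unfolding pl_edge[OF k(2,3)] L_node[OF kL(1)] L_node[OF kL(2)] by (simp add: s_def algebra_simps)
  have pz: "(1 - s) * cx z (k - 2 * \<mu>) + s * cx z (k - 2 * \<mu> + 1) = z (n - 1)"
    using Zn e unfolding pl_edge[OF k(2,3)] L_node[OF kL(1)] L_node[OF kL(2)] by (simp add: s_def algebra_simps)
  define i where "i = (k - 2 * \<mu>) div 2"
  show False
  proof (cases "even (k - 2 * \<mu>)")
    case True
    hence ki: "k - 2 * \<mu> = 2 * i" by (simp add: i_def)
    have i: "i \<in> {0..n-2}" using k(1) ki by auto
    have yi: "pl yn u = y i" using py unfolding ki cy_even cy_odd by (simp add: algebra_simps)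
    have "i \<noteq> n - 2" using H yi by auto
    hence i3: "i \<in> {0..n-3}" using i by auto
    have xx: "(1 - s) * x i + s * x (i + 1) = x (n - 1)" using px unfolding ki cx_even cx_odd by simp
    have ne: "x (i + 1) \<noteq> x (n - 1)" using xinj[of "i + 1"] i3 by auto
    have ne0: "x i \<noteq> x (n - 1)" using xinj[of i] i3 x0 xR[of "n - 1"] n2 by (cases "i = 0") auto
    have s01: "s \<noteq> 0" "s \<noteq> 1" using xx ne ne0 by auto
    have d: "x (n - 1) - x i = s * (x (i + 1) - x i)" "x (i + 1) - x (n - 1) = (1 - s) * (x (i + 1) - x i)"
      using xx by (auto simp: algebra_simps)
    have "x (n - 1) \<in> {x i<..<x (i+1)} \<union> {x (i+1)<..<x i}"
    proof (cases "x i < x (i + 1)")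
      case True
      hence "0 < x (n - 1) - x i" "0 < x (i + 1) - x (n - 1)" unfolding d using s s01 by auto
      thus ?thesis by simp
    next
      case False
      hence "x (i + 1) < x i" using d(2) ne by (cases "x (i+1) = x i") auto
      hence "x (n - 1) - x i < 0" "x (i + 1) - x (n - 1) < 0" unfolding d using s s01
        by (auto simp: mult_less_0_iff)
      thus ?thesis by simp
    qed
    moreover have "y i \<in> {y (n - 2)<..<T}" using H yi yl[OF i] by simp
    ultimately have "z i + y i * (x (n - 1) - x i) \<noteq> z (n - 1)" using crossing i3 by blast
    moreover have "z (n - 1) = z i + y i * (x (n - 1) - x i)"
      unfolding d(1) using pz unfolding ki cx_even cx_odd zrec[of i] by (simp add: algebra_simps)
    ultimately show False by simp
  next
    case False
    hence ki: "k - 2 * \<mu> = 2 * i + 1" unfolding i_def by presburger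
    have i: "i + 1 \<in> {1..n-2}" using k(1) ki by auto
    have e: "cx x (2 * i + 1 + 1) = x (i + 1)" using cx_even[of x "i + 1"] by (simp add: algebra_simps)
    have "x (i + 1) = x (n - 1)" using px unfolding ki e cx_odd by (simp add: algebra_simps)
    thus False using xinj[OF i] by simp
  qed
qed

text \<open>Three encounters are settled neither by an affine map nor by strictly monotone heights.
  Path against right edge: over the corner column the path runs above that edge, by
  \<open>above\<close>. Path against kept part: by height only the first edge of the path is
  involved, and it lies in the top row. Kept part against its own last edge:
  \<open>rise_edge\<close>.\<close>

lemma move_y: assumes uv: "u \<in> I" "v \<in> I" "u \<le> v"
  and X': "pl (cx x') u = pl (cx x') v" and Z: "pl zr u = pl zr v"
  shows "sgn (pl yn u - pl yn v) = sgn (pl (cy y') u - pl (cy y') v)"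
  using uv
proof (cases rule: region_cases)
  case 1
    hence "u = v" using T_zr_inj Z by blast
    thus ?thesis by simp
next
  case 2
  show ?thesis
  proof (cases "v = 2 * of_int \<mu> - 1")
    case True
    hence "v \<in> RT" using mu by (simp add: RT_def)
    hence "u = v" using T_zr_inj Z 2 by blast
    thus ?thesis by simp
  next
    case False
    hence v: "2 * of_int \<mu> - 1 < v" using 2 by (auto simp: RD_def)
    have "pl yn v < T" using D_y[OF 2(2)] yl[of 0] n2 v by simp
    hence 1: "pl yn v < pl yn u" using T_y 2 by simp
    have ux: "pl (cx x') u = K * R + c1" using X' D_x' 2 by simp
    \<comment> \<open>The first edge starts at \<open>x' (-1)\<close>, already left of the corner
      column, and runs further left; so it never reaches that column.\<close>
    have xm: "x' (-1) < K * R + c1"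
      using x'[of "n - 1"] per'(1)[of "-1"] mult_strict_left_mono[OF xR[of "n - 1"] KL(1)] n2 by (simp add: algebra_simps)
    have um: "-1 \<le> u"
    proof (rule ccontr)
      assume "\<not> -1 \<le> u"
      hence e: "of_int (-2) \<le> u" "u \<le> of_int (-2) + 1" and u: "u < -1" using 2 by (auto simp: RT_def)
      have "cx x' (-2) = x' (-1)" "cx x' (-2 + 1) = x' 0"
        using cx_even[of x' "-1"] cx_odd'[of x' 0] by simp_all
      hence "pl (cx x') u = (1 - (u + 2)) * x' (-1) + (u + 2) * x' 0"
        unfolding pl_edge[OF e] by simp
      also have "\<dots> = x' (-1) + (u + 2) * (x' 0 - x' (-1))" by (simp add: algebra_simps)
      also have "\<dots> \<le> x' (-1)" using left e by (simp add: mult_nonneg_nonpos)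
      finally show False using ux xm by simp
    qed
    have "u \<noteq> 2 * of_int \<mu> - 1"
    proof
      assume u: "u = 2 * of_int \<mu> - 1"
      hence "u \<in> RD" by (simp add: RD_def)
      thus False using D_zr_inj Z 2 u v by auto
    qed
    hence "y' (\<mu> - 1) < pl (cy y') u" using above[of u] um ux 2 by (auto simp: RT_def)
    hence "pl (cy y') v < pl (cy y') u" using D_y'[OF 2(2)] by simp
    thus ?thesis using 1 by (simp add: sgn_if)
  qed
next
  case 3
  have "u < -1" using T_zr_high[OF 3(1)] L_zr_le[OF 3(2)] Z by fastforce
  hence e: "of_int (-2) \<le> u" "u \<le> of_int (-2) + 1" using 3 by (auto simp: RT_def)
  have y1: "cy y' (-2) = y' (\<mu> + n - 1)" "cy y' (-2 + 1) = y' (\<mu> + n - 1)"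
    using cy_even[of y' "-1"] cy_odd[of y' "-1"] per'(2)[of "-1"] by (auto simp: algebra_simps)
  have uy: "pl (cy y') u = y' (\<mu> + n - 1)" unfolding pl_edge[OF e] y1 by (simp add: algebra_simps)
  show ?thesis
  proof (cases "v = 2 * of_int (\<mu> + n) - 2")
    case True
    have "pl zr u = pl zr (-2)" using Z node_ends True by (simp only: pl_ends)
    hence "u = -2" using 3 T_zr_inj[of u "-2"] mu by (auto simp: RT_def)
    moreover have "yn (-2) = yn (N - 2)" using L_node[of "N - 2"] n2 mu yT by (auto simp: yn_def cy_def)
    ultimately show ?thesis using True node_ends by (simp only: pl_ends diff_self)
  next
    case False
    hence "pl yn v < T" "pl (cy y') v < y' (\<mu> + n - 1)"
      using L_y_le L_y_eq L_y'_le L_y'_eq 3 by (auto simp: less_le)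
    thus ?thesis using T_y[OF 3(1)] uy by (simp add: sgn_if)
  qed
next
  case 4
  hence "u = v" using D_zr_inj Z by blast
  thus ?thesis by simp
next
  case 5
  have "pl xn v = R" using X' DL_x'[of u] DL_x'[of v] 5 D_x KL by auto
  hence v: "v = 2 * of_int \<mu>" using L_x_eq 5 by auto
  hence "v \<in> RD" by (simp add: RD_def)
  hence "u = v" using 5 D_zr_inj Z by blast
  thus ?thesis by simp
next
  case 6
  have X: "pl xn u = pl xn v" using X' L_x' 6 KL by simp
  show ?thesis
  proof (cases "v \<le> 2 * of_int (\<mu> + n) - 3")
    case True
    have "pl (cy y') u - pl (cy y') v = L * (pl yn u - pl yn v)"
      using True 6 uv(3) by (simp add: L_y'_lin algebra_simps)
    thus ?thesis using KL by (simp add: sgn_mult)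
  next
    case False
    have rise: "pl yn w = y (n - 2) + (w - (2 * of_int (\<mu> + n) - 3)) * (T - y (n - 2))"
       "pl (cy y') w = (L * y (n - 2) + c2) + (w - (2 * of_int (\<mu> + n) - 3)) * (y' (\<mu> + n - 1) - (L * y (n - 2) + c2))"
      if w: "2 * of_int (\<mu> + n) - 3 \<le> w" "w \<le> 2 * of_int (\<mu> + n) - 2" for w
    proof -
      have e: "of_int (N - 3) \<le> w" "w \<le> of_int (N - 3) + 1" using w by auto
      have n3: "yn (N - 3) = y (n - 2)" "yn (N - 3 + 1) = T"
        using L_node[of "N - 3"] L_node[of "N - 2"] n2 cy_odd'[of y "n - 1"] cy_even[of y "n - 1"] yT by (auto simp: algebra_simps)
      have n4: "cy y' (N - 3) = L * y (n - 2) + c2" "cy y' (N - 3 + 1) = y' (\<mu> + n - 1)"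
        using cy_odd'[of y' "\<mu> + n - 1"] cy_even[of y' "\<mu> + n - 1"] y'[of "n - 2"] n2 by (auto simp: algebra_simps)
      show "pl yn w = y (n - 2) + (w - (2 * of_int (\<mu> + n) - 3)) * (T - y (n - 2))"
        unfolding pl_edge[OF e] n3 by (simp add: algebra_simps)
      show "pl (cy y') w = (L * y (n - 2) + c2) + (w - (2 * of_int (\<mu> + n) - 3)) * (y' (\<mu> + n - 1) - (L * y (n - 2) + c2))"
        unfolding pl_edge[OF e] n4 by (simp add: algebra_simps)
    qed
    have pos: "0 < T - y (n - 2)" "0 < y' (\<mu> + n - 1) - (L * y (n - 2) + c2)"
      using yl[of "n - 2"] Y'[of "n - 2"] n2 by auto
    have v: "2 * of_int (\<mu> + n) - 3 < v" "v \<le> 2 * of_int (\<mu> + n) - 2" using False 6 by (auto simp: RL_def)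
    show ?thesis
    proof (cases "u \<le> 2 * of_int (\<mu> + n) - 3")
      case True
      have "pl yn u \<le> y (n - 2)" by (rule rise_edge[OF 6(1) True v X Z])
      moreover have "pl (cy y') u \<le> L * y (n - 2) + c2" unfolding L_y'_lin[OF 6(1) True] using calculation KL by simp
      moreover have "y (n - 2) < pl yn v" "L * y (n - 2) + c2 < pl (cy y') v"
        using rise[of v] v pos by simp_all
      ultimately show ?thesis by (simp add: sgn_if)
    next
      case False
      define r where "r = 2 * real_of_int (\<mu> + n) - 3"
      have "pl yn u - pl yn v = (u - v) * (T - y (n - 2))"
        "pl (cy y') u - pl (cy y') v = (u - v) * (y' (\<mu> + n - 1) - (L * y (n - 2) + c2))"
        using rise[of v] rise[of u] v False uv(3) unfolding r_def[symmetric] by (simp_all add: algebra_simps)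
      thus ?thesis using pos by (simp add: sgn_mult)
    qed
  qed
qed

text \<open>In the final planar position double points occur only within the kept part, by
  \<open>planar\<close>, and there \<open>zr\<close> is already the final height.\<close>

lemma move_lower: assumes uv: "u \<in> I" "v \<in> I"
  and "pl (cx x') u = pl (cx x') v" "pl (cy y') u = pl (cy y') v"
  shows "sgn (pl zr u - pl zr v) = sgn (pl (cx z') u - pl (cx z') v)"
proof -
  have "pl zr w = pl (cx z') w" if "w \<in> I" "w = -2 \<or> 2 * of_int \<mu> \<le> w" for w
    using that(2)
  proof
    assume "w = -2" thus ?thesis using node_ends by (simp only: pl_ends)
  qed (use that L_zr in \<open>auto simp: RL_def\<close>)
  moreover have "u = v \<or> (u = -2 \<or> 2 * of_int \<mu> \<le> u) \<and> (v = -2 \<or> 2 * of_int \<mu> \<le> v)"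
    by (rule planar[OF assms])
  ultimately show ?thesis using uv by fastforce
qed

text \<open>Subdividing the top edge and counting the vertices from its left end changes the
  parametrisation but not the set of points.\<close>

lemma start_knot: "pl (tri xn yn zn) ` I = knot x y z"
proof -
  define V where "V = tri (cx x) (cy y) (cx z)"
  have knot: "knot x y z = pl V ` {of_int 0..of_int (0 + 2 * n)}"
    unfolding V_def by (rule knot_interval) (use per n2 in auto)
  define \<phi> where "\<phi> = (\<lambda>u. if u < 2 * real_of_int \<mu> - 1 then 2 * of_int n - 2 + (u + 2) / (2 * of_int \<mu> + 1)
     else if u < 2 * of_int \<mu> then u - 2 * of_int \<mu> + 2 * of_int n else u - 2 * of_int \<mu>)"
  have low: "pl (tri xn yn zn) u = pl V (u - 2 * of_int \<mu>)" if "u \<in> RL" for u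
  proof -
    have "pl (tri xn yn zn) u = pl (\<lambda>k. V (k + (- (2 * \<mu>)))) u"
      by (rule pl_cong[of "2 * \<mu>" "N - 2"]) (use that region_ivl L_node in \<open>auto simp: V_def tri_def\<close>)
    also have "\<dots> = pl V (u + of_int (- (2 * \<mu>)))" by (rule pl_shift[symmetric])
    finally show ?thesis by simp
  qed
  have Vn: "V (2 * n - 2) = vector [x (n - 1), T, z (n - 1)]" "V (2 * n - 1) = vector [R, T, z (n - 1) + T * (R - x (n - 1))]"
    "V (2 * n) = vector [R, y 0, z (n - 1) + T * (R - x (n - 1))]"
  proof -
    have "x n = R" "y n = y 0" using per(1,2)[of 0] x0 by auto
    moreover have "z n = z (n - 1) + T * (R - x (n - 1))" using zrec[of "n - 1"] yT calculation by simp
    ultimately show "V (2 * n - 2) = vector [x (n - 1), T, z (n - 1)]" "V (2 * n - 1) = vector [R, T, z (n - 1) + T * (R - x (n - 1))]"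
       "V (2 * n) = vector [R, y 0, z (n - 1) + T * (R - x (n - 1))]"
      using yT cx_even[of x "n - 1"] cx_even[of z "n - 1"] cy_even[of y "n - 1"] cy_odd'[of y n]
      by (simp_all add: V_def tri_def right_diff_distrib)
  qed
  have zn2: "zn (2 * \<mu> - 1) = z (n - 1) + T * (R - x (n - 1))" "zn (2 * \<mu>) = z (n - 1) + T * (R - x (n - 1))"
  proof -
    show "zn (2 * \<mu> - 1) = z (n - 1) + T * (R - x (n - 1))" using xn_nodes by (simp add: zn_def)
    show "zn (2 * \<mu>) = z (n - 1) + T * (R - x (n - 1))"
      using cx_even[of z 0] zrec[of "n - 1"] per(1,3)[of 0] x0 yT by (simp add: zn_def)
  qed
  have mid: "pl (tri xn yn zn) u = pl V (u - 2 * of_int \<mu> + 2 * of_int n)" if u: "u \<in> RD" for u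
  proof -
    have e: "of_int (2 * n - 1) \<le> u - 2 * of_int \<mu> + 2 * of_int n" "u - 2 * of_int \<mu> + 2 * of_int n \<le> of_int (2 * n - 1) + 1"
      "of_int (2 * \<mu> - 1) \<le> u" "u \<le> of_int (2 * \<mu> - 1) + 1"
      using u by (auto simp: RD_def)
    have "tri xn yn zn (2 * \<mu> - 1) = V (2 * n - 1)" "tri xn yn zn (2 * \<mu>) = V (2 * n)"
      using Vn xn_nodes zn2 cy_even[of y 0] by (simp_all add: tri_def yn_def)
    thus ?thesis unfolding pl_edge[OF e(1,2)] pl_edge[OF e(3,4)] by (simp add: algebra_simps)
  qed
  have high: "pl (tri xn yn zn) u = pl V (2 * of_int n - 2 + (u + 2) / (2 * of_int \<mu> + 1))" if u: "u \<in> RT" for u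
  proof -
    have "0 \<le> (u + 2) / (2 * of_int \<mu> + 1)" "(u + 2) / (2 * of_int \<mu> + 1) \<le> 1"
      using u mu by (auto simp: RT_def)
    hence e: "of_int (2 * n - 2) \<le> 2 * of_int n - 2 + (u + 2) / (2 * of_int \<mu> + 1)"
       "2 * of_int n - 2 + (u + 2) / (2 * of_int \<mu> + 1) \<le> of_int (2 * n - 2) + 1" by auto
    have zz: "pl zn u = T * pl xn u + 0 * pl xn u + (z (n - 1) - T * x (n - 1))"
      by (rule pl_linear[of "-2" "2 * \<mu> - 1"]) (use u mu in \<open>auto simp: zn_def RT_def algebra_simps\<close>)
    define t where "t = (u + 2) / (2 * of_int \<mu> + 1)"
    have xx: "pl xn u = x (n - 1) + t * (R - x (n - 1))"
    proof -
      have "pl xn u = x (n - 1) + (u + 2) * sl" by (simp add: T_x[OF u] algebra_simps)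
      also have "(u + 2) * sl = t * (R - x (n - 1))" by (simp add: sl_def t_def)
      finally show ?thesis .
    qed
    have tt: "2 * of_int n - 2 + t - of_int (2 * n - 2) = t" by simp
    have V1: "V (2 * n - 2 + 1) = V (2 * n - 1)" by (rule arg_cong[where f = V]) simp
    show ?thesis unfolding pl_edge[OF e] unfolding t_def[symmetric] tt V1 Vn pl_tri
      by (simp add: vec_eq_iff forall_3 vector_3 xx T_y[OF u] zz algebra_simps)
  qed
  \<comment> \<open>One period of the old curve, cut into the kept part, the right edge and the top
    edge; the last is rescaled from parameter length \<open>2 * \<mu> + 1\<close> to 1.\<close>
  have im: "{0..2 * real_of_int n} = (\<lambda>u. u - 2 * of_int \<mu>) ` RL \<union> (\<lambda>u. u - 2 * of_int \<mu> + 2 * of_int n) ` RD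
     \<union> (\<lambda>u. 2 * of_int n - 2 + (u + 2) / (2 * of_int \<mu> + 1)) ` RT" (is "?I = ?A \<union> ?B \<union> ?C")
  proof
    show "?I \<subseteq> ?A \<union> ?B \<union> ?C"
    proof
      fix w assume w: "w \<in> ?I"
      consider "w \<le> 2 * of_int n - 2" | "2 * of_int n - 2 \<le> w" "w \<le> 2 * of_int n - 1" | "2 * of_int n - 1 \<le> w" by linarith
      thus "w \<in> ?A \<union> ?B \<union> ?C"
      proof cases
        case 1
        hence "w + 2 * of_int \<mu> \<in> RL" using w by (auto simp: RL_def)
        hence "w \<in> ?A" by (rule rev_image_eqI) simp
        thus ?thesis by blast
      next
        case 2
        define p where "p = (w - (2 * of_int n - 2)) * (2 * real_of_int \<mu> + 1)"
        have "p \<le> 1 * (2 * of_int \<mu> + 1)" unfolding p_def using 2 mu by (intro mult_right_mono) auto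
        moreover have "0 \<le> p" unfolding p_def using 2 mu by (intro mult_nonneg_nonneg) auto
        ultimately have "p - 2 \<in> RT" by (simp add: RT_def)
        moreover have "w = 2 * of_int n - 2 + (p - 2 + 2) / (2 * of_int \<mu> + 1)"
          using mu by (simp add: p_def)
        ultimately have "w \<in> ?C" by blast
        thus ?thesis by blast
      next
        case 3
        hence "w + 2 * of_int \<mu> - 2 * of_int n \<in> RD" using w by (auto simp: RD_def)
        hence "w \<in> ?B" by (rule rev_image_eqI) simp
        thus ?thesis by blast
      qed
    qed
    show "?A \<union> ?B \<union> ?C \<subseteq> ?I"
    proof -
      have "0 \<le> (u + 2) / (2 * of_int \<mu> + 1)" "(u + 2) / (2 * of_int \<mu> + 1) \<le> 1" if "u \<in> RT" for u
        using that mu by (auto simp: RT_def)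
      thus ?thesis using n2 by (fastforce simp: RL_def RD_def)
    qed
  qed
  have "pl V ` {0..2 * real_of_int n} = pl (tri xn yn zn) ` RL \<union> pl (tri xn yn zn) ` RD \<union> pl (tri xn yn zn) ` RT"
    unfolding im image_Un image_image using low mid high by (simp cong: image_cong_simp)
  thus ?thesis unfolding regions knot by (auto simp: image_Un)
qed

theorem isotopic: "ambient_isotopic (knot x y z) (knot x' y' z')"
proof -
  have ivl: "I = {real_of_int (-2)..of_int (N - 2)}" by simp
  have less: "-2 < N - 2" using mu n2 by simp
  have s1: "ambient_isotopic (pl (tri xn yn zn) ` I) (pl (tri xn yn zr) ` I)"
    unfolding ivl by (rule isotopy_coord3[OF less]) (use move_raise in \<open>simp only: ivl\<close>)
  have s2: "ambient_isotopic (pl (tri xn yn zr) ` I) (pl (tri (cx x') yn zr) ` I)"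
    unfolding ivl by (rule isotopy_coord1[OF less]) (use move_x in \<open>simp only: ivl\<close>)
  have s3: "ambient_isotopic (pl (tri (cx x') yn zr) ` I) (pl (tri (cx x') (cy y') zr) ` I)"
    unfolding ivl by (rule isotopy_coord2[OF less]) (use move_y in \<open>simp only: ivl\<close>)
  have s4: "ambient_isotopic (pl (tri (cx x') (cy y') zr) ` I) (pl (tri (cx x') (cy y') (cx z')) ` I)"
    unfolding ivl by (rule isotopy_coord3[OF less]) (use move_lower in \<open>simp only: ivl\<close>)
  have k: "knot x' y' z' = pl (tri (cx x') (cy y') (cx z')) ` I"
    using knot_interval[of x' "\<mu> + n" y' z' "-2"] per' mu n2 by simp
  show ?thesis
    using ambient_isotopic_trans[OF ambient_isotopic_trans[OF ambient_isotopic_trans[OF s1 s2] s3] s4]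
    unfolding start_knot k .
qed

end

subsection \<open>Grid diagrams as pairs of integer sequences\<close>

text \<open>A proper crossing of horizontal edge \<open>i\<close>, in row \<open>y i\<close>, with
  the vertical edge in column \<open>x j\<close>, which joins the rows \<open>y (j - 1)\<close> and
  \<open>y j\<close>.\<close>

definition cross :: "(int \<Rightarrow> 'a::linorder) \<Rightarrow> (int \<Rightarrow> 'a) \<Rightarrow> int \<Rightarrow> int \<Rightarrow> bool" where
  "cross x y i j \<longleftrightarrow> (x i < x j \<and> x j < x (i + 1) \<or> x (i + 1) < x j \<and> x j < x i) \<and>
     (y (j - 1) < y i \<and> y i < y j \<or> y j < y i \<and> y i < y (j - 1))"

lemma pl_horizontal:
  fixes u :: real and x y :: "int \<Rightarrow> real"
  assumes "2 * of_int i \<le> u" "u \<le> 2 * of_int i + 1"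
  shows "pl (cx x) u = x i + (u - 2 * of_int i) * (x (i + 1) - x i)" "pl (cy y) u = y i"
proof -
  have e: "of_int (2 * i) \<le> u" "u \<le> of_int (2 * i) + 1" using assms by auto
  have n: "cx x (2 * i) = x i" "cx x (2 * i + 1) = x (i + 1)" "cy y (2 * i) = y i" "cy y (2 * i + 1) = y i"
    unfolding cx_def cy_def by (rule arg_cong[where f = x] arg_cong[where f = y], presburger)+
  show "pl (cx x) u = x i + (u - 2 * of_int i) * (x (i + 1) - x i)" "pl (cy y) u = y i"
    unfolding pl_edge[OF e] n by (simp_all add: algebra_simps)
qed

lemma pl_vertical:
  fixes u :: real and x y :: "int \<Rightarrow> real"
  assumes "2 * of_int j - 1 \<le> u" "u \<le> 2 * of_int j"
  shows "pl (cx x) u = x j" "pl (cy y) u = y (j - 1) + (u - (2 * of_int j - 1)) * (y j - y (j - 1))"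
proof -
  have e: "of_int (2 * j - 1) \<le> u" "u \<le> of_int (2 * j - 1) + 1" using assms by auto
  have n: "cx x (2 * j - 1) = x j" "cx x (2 * j - 1 + 1) = x j" "cy y (2 * j - 1) = y (j - 1)" "cy y (2 * j - 1 + 1) = y j"
    unfolding cx_def cy_def by (rule arg_cong[where f = x] arg_cong[where f = y], presburger)+
  show "pl (cx x) u = x j" "pl (cy y) u = y (j - 1) + (u - (2 * of_int j - 1)) * (y j - y (j - 1))"
    unfolding pl_edge[OF e] n by (simp_all add: algebra_simps)
qed

lemma edge_cases:
  fixes u :: real
  obtains i where "2 * of_int i \<le> u" "u < 2 * of_int i + 1" | j where "2 * of_int j - 1 \<le> u" "u < 2 * of_int j"
proof -
  define k where "k = \<lfloor>u\<rfloor>"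
  have k: "of_int k \<le> u" "u < of_int k + 1" by (simp_all add: k_def)
  show ?thesis
  proof (cases "even k")
    case True
    then obtain i where "k = 2 * i" by blast
    thus ?thesis using that(1)[of i] k by simp
  next
    case False
    then obtain i where "k = 2 * i + 1" by (rule oddE)
    thus ?thesis using that(2)[of "i + 1"] k by simp
  qed
qed

lemma strictly_between:
  fixes a b c s :: real
  assumes "c = a + s * (b - a)" "0 < s" "s < 1" "a \<noteq> b"
  shows "a < c \<and> c < b \<or> b < c \<and> c < a"
proof -
  have e: "c - a = s * (b - a)" "b - c = (1 - s) * (b - a)" using assms(1) by (auto simp: algebra_simps)
  show ?thesis
  proof (cases "a < b")
    case True
    hence "0 < c - a" "0 < b - c" unfolding e using assms by auto
    thus ?thesis by simp
  next
    case False
    hence "c - a < 0" "b - c < 0" unfolding e using assms by (auto simp: mult_less_0_iff)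
    thus ?thesis by simp
  qed
qed

text \<open>Injectivity modulo \<open>n\<close> gives every column one vertical and every row one
  horizontal edge, so parallel edges never overlap and no corner lies on a third edge. What remains
  is the same parameter modulo the period, or a proper crossing.\<close>

lemma planar_coincidence:
  fixes x y :: "int \<Rightarrow> real" and n :: int
  assumes n: "2 \<le> n" and per: "\<And>i. x (i + n) = x i" "\<And>i. y (i + n) = y i"
    and inj: "\<And>i j. x i = x j \<Longrightarrow> n dvd i - j" "\<And>i j. y i = y j \<Longrightarrow> n dvd i - j"
    and X: "pl (cx x) u = pl (cx x) w" and Y: "pl (cy y) u = pl (cy y) w"
  obtains k where "u = w + 2 * of_int n * of_int k"
    | i j where "cross x y i j" "2 * of_int i < u" "u < 2 * of_int i + 1" "2 * of_int j - 1 < w" "w < 2 * of_int j"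
    | i j where "cross x y i j" "2 * of_int i < w" "w < 2 * of_int i + 1" "2 * of_int j - 1 < u" "u < 2 * of_int j"
proof -
  have nx: "x i \<noteq> x (i + 1)" and ny: "y (i - 1) \<noteq> y i" for i
    using inj(1)[of "i + 1" i] inj(2)[of i "i - 1"] n by (auto dest: zdvd_imp_le)
  have shift: "x (i + n * k) = x i" "y (i + n * k) = y i" for i k
    using periodic_mult[of x n] periodic_mult[of y n] per by auto
  \<comment> \<open>Edges are taken half-open, so only their starting points have to be excluded as
    meeting points of a horizontal and a vertical edge.\<close>
  have HV: "cross x y i j \<and> 2 * of_int i < u \<and> 2 * of_int j - 1 < w"
    if u: "2 * of_int i \<le> u" "u < 2 * of_int i + 1" and w: "2 * of_int j - 1 \<le> w" "w < 2 * of_int j"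
      and X: "pl (cx x) u = pl (cx x) w" and Y: "pl (cy y) u = pl (cy y) w" for i j u w
  proof -
    have ex: "x j = x i + (u - 2 * of_int i) * (x (i + 1) - x i)"
      using X pl_horizontal(1)[of i u x] pl_vertical(1)[of j w x] u w by simp
    have ey: "y i = y (j - 1) + (w - (2 * of_int j - 1)) * (y j - y (j - 1))"
      using Y pl_horizontal(2)[of i u y] pl_vertical(2)[of j w y] u w by simp
    have s: "u \<noteq> 2 * of_int i"
    proof
      assume "u = 2 * of_int i"
      hence "n dvd j - i" using ex inj(1) by simp
      then obtain k where "j = i + n * k" by (metis add.commute diff_add_cancel dvdE)
      hence y: "y j = y i" using shift by simp
      have "(1 - (w - (2 * of_int j - 1))) * (y i - y (j - 1)) = 0" using ey unfolding y by (simp add: algebra_simps)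
      thus False using w ny[of j] y by auto
    qed
    have t: "w \<noteq> 2 * of_int j - 1"
    proof
      assume "w = 2 * of_int j - 1"
      hence "n dvd (j - 1) - i" using ey inj(2)[of "j - 1" i] by simp
      then obtain k where "j = (i + 1) + n * k" by (metis add.commute add.left_commute diff_add_cancel dvdE)
      hence xj: "x j = x (i + 1)" using shift by simp
      have "(1 - (u - 2 * of_int i)) * (x (i + 1) - x i) = 0" using ex unfolding xj by (simp add: algebra_simps)
      thus False using u nx[of i] by auto
    qed
    have "x i < x j \<and> x j < x (i + 1) \<or> x (i + 1) < x j \<and> x j < x i"
      by (rule strictly_between[OF ex]) (use u s nx in auto)
    moreover have "y (j - 1) < y i \<and> y i < y j \<or> y j < y i \<and> y i < y (j - 1)"
      by (rule strictly_between[OF ey]) (use w t ny in auto)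
    ultimately show ?thesis using s t u w by (auto simp: cross_def)
  qed
  show thesis
  proof (cases u rule: edge_cases)
    case (1 i)
    show thesis
    proof (cases w rule: edge_cases)
      case (1 i')
      have "y i = y i'" using Y pl_horizontal(2)[of i u y] pl_horizontal(2)[of i' w y] 1 \<open>2 * of_int i \<le> u\<close> \<open>u < 2 * of_int i + 1\<close> by simp
      hence "n dvd i - i'" by (rule inj(2))
      then obtain k where k: "i = i' + n * k" by (metis add.commute diff_add_cancel dvdE)
      have sx: "x i = x i'" "x (i + 1) = x (i' + 1)" using shift(1)[of i' k] shift(1)[of "i' + 1" k] k by (simp_all add: algebra_simps)
      have "(u - 2 * of_int i) * (x (i + 1) - x i) = (w - 2 * of_int i') * (x (i + 1) - x i)"
        using X pl_horizontal(1)[of i u x] pl_horizontal(1)[of i' w x] 1 \<open>2 * of_int i \<le> u\<close> \<open>u < 2 * of_int i + 1\<close> sx by simp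
      hence "u - 2 * of_int i = w - 2 * of_int i'" using nx[of i] by simp
      hence "u = w + 2 * of_int n * of_int k" using k by simp
      thus ?thesis by (rule that(1))
    next
      case (2 j)
      show ?thesis using HV[OF \<open>2 * of_int i \<le> u\<close> \<open>u < 2 * of_int i + 1\<close> 2 X Y] that(2)[of i j] 2 1 by auto
    qed
  next
    case (2 j)
    show thesis
    proof (cases w rule: edge_cases)
      case (1 i)
      show ?thesis using HV[OF 1 2 X[symmetric] Y[symmetric]] that(3)[of i j] 2 1 by auto
    next
      case (2 j')
      have "x j = x j'" using X pl_vertical(1)[of j u x] pl_vertical(1)[of j' w x] 2 \<open>2 * of_int j - 1 \<le> u\<close> \<open>u < 2 * of_int j\<close> by simp
      hence "n dvd j - j'" by (rule inj(1))
      then obtain k where k: "j = j' + n * k" by (metis add.commute diff_add_cancel dvdE)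
      have sy: "y j = y j'" "y (j - 1) = y (j' - 1)" using shift(2)[of j' k] shift(2)[of "j' - 1" k] k by (simp_all add: algebra_simps)
      have "(u - (2 * of_int j - 1)) * (y j - y (j - 1)) = (w - (2 * of_int j' - 1)) * (y j - y (j - 1))"
        using Y pl_vertical(2)[of j u y] pl_vertical(2)[of j' w y] 2 \<open>2 * of_int j - 1 \<le> u\<close> \<open>u < 2 * of_int j\<close> sy by simp
      hence "u - (2 * of_int j - 1) = w - (2 * of_int j' - 1)" using ny[of j] by (metis eq_iff_diff_eq_0 mult_right_cancel)
      hence "u = w + 2 * of_int n * of_int k" using k by simp
      thus ?thesis by (rule that(1))
    qed
  qed
qed

text \<open>The height grows by \<open>y i\<close> per unit of \<open>x\<close> along horizontal
  edge \<open>i\<close> and is constant along a vertical edge.\<close>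

lemma crossing_height:
  fixes x y z :: "int \<Rightarrow> real"
  assumes zrec: "\<And>i. z (i + 1) = z i + y i * (x (i + 1) - x i)"
    and u: "2 * of_int i \<le> u" "u \<le> 2 * of_int i + 1" and w: "2 * of_int j - 1 \<le> w" "w \<le> 2 * of_int j"
    and X: "pl (cx x) u = pl (cx x) w"
  shows "pl (cx z) u - pl (cx z) w = z i + y i * (x j - x i) - z j"
proof -
  have "x j - x i = (u - 2 * of_int i) * (x (i + 1) - x i)"
    using X pl_horizontal(1)[OF u, of x] pl_vertical(1)[OF w, of x] by simp
  hence e: "y i * (x j - x i) = (u - 2 * of_int i) * (z (i + 1) - z i)" using zrec[of i] by simp
  show ?thesis unfolding pl_horizontal(1)[OF u, of z] pl_vertical(1)[OF w, of z] e by simp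
qed

text \<open>\<open>x i\<close> is the column of the \<open>i\<close>-th vertical edge and
  \<open>y i\<close> the row of the \<open>i\<close>-th horizontal edge in order of traversal,
  continued periodically so that no index is special.\<close>

definition grid_seq :: "int \<Rightarrow> (int \<Rightarrow> int) \<Rightarrow> (int \<Rightarrow> int) \<Rightarrow> bool" where
  "grid_seq n x y \<longleftrightarrow> 2 \<le> n \<and> (\<forall>i. x (i + n) = x i) \<and> (\<forall>i. y (i + n) = y i) \<and>
     x ` {0..<n} = {0..<n} \<and> y ` {0..<n} = {0..<n}"

lemma periodic_mod:
  fixes f :: "int \<Rightarrow> 'a" assumes "\<And>i. f (i + n) = f i" shows "f (i mod n) = f i"
  using periodic_mult[of f n "i mod n" "i div n"] assms by simp

lemma periodic_perm_inj:
  fixes f :: "int \<Rightarrow> int" assumes "\<And>i. f (i + n) = f i" "f ` {0..<n} = {0..<n}" "f i = f j" "0 < n"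
  shows "n dvd i - j"
proof -
  have "inj_on f {0..<n}" by (rule eq_card_imp_inj_on) (simp_all add: assms(2))
  moreover have "f (i mod n) = f (j mod n)" using periodic_mod[of f n] assms by simp
  ultimately have "i mod n = j mod n" using assms(4) by (auto dest: inj_onD)
  thus ?thesis by (simp add: mod_eq_dvd_iff)
qed

lemma periodic_perm_range:
  fixes f :: "int \<Rightarrow> int" assumes "\<And>i. f (i + n) = f i" "f ` {0..<n} = {0..<n}" "0 < n"
  shows "f i \<in> {0..<n}"
proof -
  have "f (i mod n) \<in> f ` {0..<n}" using assms(3) by (intro imageI) simp
  thus ?thesis using assms(2) periodic_mod[of f n i] assms(1) by simp
qed

lemma grid_seqD:
  assumes "grid_seq n x y"
  shows "2 \<le> n" "x (i + n) = x i" "y (i + n) = y i" "x i \<in> {0..<n}" "y i \<in> {0..<n}"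
    "x i = x j \<Longrightarrow> n dvd i - j" "y i = y j \<Longrightarrow> n dvd i - j"
  using assms periodic_perm_inj[of x n i j] periodic_perm_inj[of y n i j]
    periodic_perm_range[of x n i] periodic_perm_range[of y n i] unfolding grid_seq_def by auto

definition half :: "(int \<Rightarrow> int) \<Rightarrow> int \<Rightarrow> real" where "half x i = of_int (x i) + 1/2"
text \<open>Corners are cell centres, so the integrand is \<open>y + 1/2\<close>; the extra half
  integrates to \<open>x / 2\<close>, and \<open>z\<close> itself can remain an integer
  sequence.\<close>

definition height :: "(int \<Rightarrow> int) \<Rightarrow> (int \<Rightarrow> int) \<Rightarrow> int \<Rightarrow> real" where
  "height x z i = of_int (z i) + of_int (x i) / 2"

definition heights :: "(int \<Rightarrow> int) \<Rightarrow> (int \<Rightarrow> int) \<Rightarrow> (int \<Rightarrow> int) \<Rightarrow> bool" where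
  "heights x y z \<longleftrightarrow> (\<forall>i. z (i + 1) = z i + y i * (x (i + 1) - x i))"

lemma height_rec: "heights x y z \<Longrightarrow> height x z (i + 1) = height x z i + half y i * (half x (i + 1) - half x i)"
proof -
  assume "heights x y z"
  hence "real_of_int (z (i + 1)) = of_int (z i + y i * (x (i + 1) - x i))" by (simp only: heights_def)
  thus ?thesis by (simp add: height_def half_def field_simps)
qed

text \<open>The halves cancel, so height differences at crossings are integers.\<close>

lemma height_cross: "height x z i + half y i * (half x j - half x i) - height x z j = of_int (z i + y i * (x j - x i) - z j)"
  by (simp add: height_def half_def field_simps)

lemma cross_half [simp]: "cross (half x) (half y) i j = cross x y i j"
  by (simp add: cross_def half_def)

lemma heights_exist: "\<exists>z. z 0 = 0 \<and> heights x y z"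
proof -
  define f where "f i = y i * (x (i + 1) - x i)" for i :: int
  define z where "z i = (if 0 \<le> i then \<Sum>j\<in>{0..<i}. f j else - (\<Sum>j\<in>{i..<0}. f j))" for i :: int
  have "z 0 = 0" by (simp add: z_def)
  moreover have "z (i + 1) = z i + f i" for i
  proof -
    consider "0 \<le> i" | "i = -1" | "i < -1" by linarith
    thus ?thesis
    proof cases
      case 1
      hence "{0..<i + 1} = insert i {0..<i}" by auto
      thus ?thesis using 1 by (simp add: z_def)
    next
      case 2
      have "{-1..<0} = {-1::int}" by auto
      thus ?thesis using 2 by (simp add: z_def)
    next
      case 3
      hence "{i..<0} = insert i {i + 1..<0}" by auto
      thus ?thesis using 3 by (simp add: z_def)
    qed
  qed
  ultimately show ?thesis by (auto simp: heights_def f_def)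
qed

lemma heights_sum:
  assumes "heights x y z" "0 \<le> m"
  shows "z (k + m) = z k + (\<Sum>j\<in>{0..<m}. y (k + j) * (x (k + j + 1) - x (k + j)))"
  using assms(2)
proof (induction m rule: int_ge_induct)
  case (step m)
  have "{0..<m + 1} = insert m {0..<m}" using step by auto
  thus ?case using step.IH assms(1)[unfolded heights_def, rule_format, of "k + m"] by (simp add: add.assoc)
qed simp

lemma heights_periodic:
  assumes "heights x y z" "\<And>i. x (i + n) = x i" "\<And>i. y (i + n) = y i" "z n = z 0"
  shows "z (i + n) = z i"
proof (induction i rule: int_induct[where k = 0])
  case base thus ?case using assms(4) by simp
next
  case (step1 i)
  have "z ((i + n) + 1) = z (i + n) + y i * (x (i + 1) - x i)"
    using assms(1)[unfolded heights_def, rule_format, of "i + n"] assms(2)[of i] assms(2)[of "i + 1"] assms(3)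
    by (simp add: algebra_simps)
  also have "\<dots> = z (i + 1)" using step1 assms(1) by (simp add: heights_def)
  finally show ?case by (simp add: algebra_simps)
next
  case (step2 i)
  have "z i = z (i - 1) + y (i - 1) * (x i - x (i - 1))" "z (i + n) = z (i + n - 1) + y (i + n - 1) * (x (i + n) - x (i + n - 1))"
    using assms(1)[unfolded heights_def, rule_format, of "i - 1"] assms(1)[unfolded heights_def, rule_format, of "i + n - 1"] by auto
  moreover have "x (i + n - 1) = x (i - 1)" "y (i + n - 1) = y (i - 1)" "x (i + n) = x i"
    using assms(2)[of "i - 1"] assms(3)[of "i - 1"] assms(2)[of i] by (auto simp: algebra_simps)
  ultimately show ?case using step2 by (simp add: algebra_simps)
qed

text \<open>\<open>x 0 = 0\<close> reflects that \<open>gcol\<close> starts in column 0. The O in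
  the row of the \<open>i\<close>-th X lies in the column of the next X.\<close>

definition represents :: "grid \<Rightarrow> int \<Rightarrow> (int \<Rightarrow> int) \<Rightarrow> (int \<Rightarrow> int) \<Rightarrow> bool" where
  "represents G n x y \<longleftrightarrow> gsize G = nat n \<and> x 0 = 0 \<and>
     (\<forall>i. Xrow G (nat (x i)) = nat (y i) \<and> Orow G (nat (x (i + 1))) = nat (y i))"

text \<open>Size 1 is impossible because both markings of the only column would share a cell.
  Surjectivity of \<open>gcol\<close> makes it a cycle: \<open>gcol n\<close> must repeat an earlier
  value, and a repetition of any value but the first could be pulled back along the injective
  \<open>gsigma\<close>.\<close>

lemma immersed_grid_sequences:
  assumes "immersed_grid G"
  shows "\<exists>x y. grid_seq (int (gsize G)) x y \<and> represents G (int (gsize G)) x y"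
proof -
  define n where "n = gsize G"
  note A = assms[unfolded immersed_grid_def, folded n_def]
  have n1: "1 \<le> n" and bX: "bij_betw (Xrow G) {..<n} {..<n}" and bO: "bij_betw (Orow G) {..<n} {..<n}"
    and ne: "\<And>c. c < n \<Longrightarrow> Xrow G c \<noteq> Orow G c" and im: "gcol G ` {..<n} = {..<n}" using A by auto
  have n2: "2 \<le> n"
  proof (rule ccontr)
    assume "\<not> 2 \<le> n"
    hence n: "n = 1" using n1 by simp
    have "Xrow G 0 \<in> {..<n}" "Orow G 0 \<in> {..<n}" using bX bO n by (auto simp: bij_betw_def)
    thus False using ne[of 0] n by simp
  qed
  have sO: "Orow G (gsigma G c) = Xrow G c" and sn: "gsigma G c < n" if "c < n" for c
  proof -
    have c: "Xrow G c \<in> Orow G ` {..<n}" using bX bO that by (auto simp: bij_betw_def)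
    show "Orow G (gsigma G c) = Xrow G c"
      unfolding gsigma_def n_def[symmetric] by (rule f_the_inv_into_f) (use bO c in \<open>auto simp: bij_betw_def\<close>)
    have "gsigma G c \<in> {..<n}"
      unfolding gsigma_def n_def[symmetric] by (rule the_inv_into_into) (use bO c in \<open>auto simp: bij_betw_def\<close>)
    thus "gsigma G c < n" by simp
  qed
  have sinj: "c = d" if "c < n" "d < n" "gsigma G c = gsigma G d" for c d
    using sO[OF that(1)] sO[OF that(2)] that bX by (auto simp: bij_betw_def dest: inj_onD)
  have gS: "gcol G (Suc k) = gsigma G (gcol G k)" for k by (simp add: gcol_def)
  have g0: "gcol G 0 = 0" by (simp add: gcol_def)
  have gn: "gcol G k < n" for k by (induction k) (use n1 g0 gS sn in auto)
  have ginj: "inj_on (gcol G) {..<n}" by (rule eq_card_imp_inj_on) (simp_all add: im)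
  have gper: "gcol G n = 0"
  proof -
    have "gcol G n \<in> gcol G ` {..<n}" using gn im by auto
    then obtain j where j: "j < n" "gcol G n = gcol G j" by auto
    show ?thesis
    proof (cases j)
      case 0 thus ?thesis using j g0 by simp
    next
      case (Suc j')
      obtain m where m: "n = Suc m" using n1 by (cases n) auto
      have "gcol G m = gcol G j'" using j sinj gn gS m Suc by metis
      hence "m = j'" using ginj j m Suc by (auto dest: inj_onD)
      thus ?thesis using j m Suc by simp
    qed
  qed
  define x where "x i = int (gcol G (nat (i mod int n)))" for i
  define y where "y i = int (Xrow G (gcol G (nat (i mod int n))))" for i
  have xs: "nat (x (i + 1)) = gsigma G (nat (x i))" for i
  proof (cases "i mod int n = int n - 1")
    case True
    hence "(i + 1) mod int n = 0" by (metis diff_add_cancel mod_add_left_eq mod_self)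
    moreover have "Suc (nat (int n - 1)) = n" using n1 by simp
    ultimately show ?thesis using gper gS[of "nat (int n - 1)"] g0 True by (simp add: x_def)
  next
    case False
    moreover have "i mod int n < int n" "0 \<le> i mod int n" using n1 by auto
    ultimately have "i mod int n + 1 < int n" by linarith
    hence "(i + 1) mod int n = i mod int n + 1" using n1
      by (metis add_nonneg_nonneg mod_add_left_eq mod_pos_pos_trivial pos_mod_sign zero_le_one of_nat_0_less_iff less_le_trans zero_less_one)
    thus ?thesis using gS[of "nat (i mod int n)"] \<open>0 \<le> i mod int n\<close> by (simp add: x_def nat_add_distrib)
  qed
  have rep: "represents G (int n) x y"
    unfolding represents_def
  proof (intro conjI allI)
    show "Orow G (nat (x (i + 1))) = nat (y i)" for i
      unfolding xs using sO gn by (simp add: x_def y_def)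
  qed (use g0 in \<open>simp_all add: n_def x_def y_def\<close>)
  have nat_im: "nat ` {0..<int n} = {..<n}"
    by (auto, metis atLeastLessThan_iff image_eqI nat_int of_nat_0_le_iff of_nat_less_iff)
  have xi: "x ` {0..<int n} = {0..<int n}"
  proof -
    have "x ` {0..<int n} = int ` gcol G ` nat ` {0..<int n}"
      by (auto simp: x_def image_image intro!: image_cong)
    also have "nat ` {0..<int n} = {..<n}" by (rule nat_im)
    also note im
    finally show ?thesis by (simp add: image_int_atLeastLessThan lessThan_atLeast0)
  qed
  have yi: "y ` {0..<int n} = {0..<int n}"
  proof -
    have "y ` {0..<int n} = int ` Xrow G ` gcol G ` nat ` {0..<int n}"
      by (auto simp: y_def image_image intro!: image_cong)
    also have "nat ` {0..<int n} = {..<n}" by (rule nat_im)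
    also note im
    also have "Xrow G ` {..<n} = {..<n}" using bX by (simp add: bij_betw_def)
    finally show ?thesis by (simp add: image_int_atLeastLessThan lessThan_atLeast0)
  qed
  have "grid_seq (int n) x y" unfolding grid_seq_def using n2 xi yi by (simp add: x_def y_def)
  thus ?thesis using rep n_def by blast
qed

lemma represented_exists:
  assumes "grid_seq n x y" "x 0 = 0"
  shows "\<exists>G. represents G n x y"
proof -
  define ix where "ix c = the_inv_into {0..<n} x (int c)" for c
  have inj: "inj_on x {0..<n}" by (rule eq_card_imp_inj_on) (use assms in \<open>auto simp: grid_seq_def\<close>)
  have ix: "ix (nat (x i)) = i mod n" for i
  proof -
    have "x i = x (i mod n)" using periodic_mod[of x n i] grid_seqD(2)[OF assms(1)] by simp
    moreover have "i mod n \<in> {0..<n}" using grid_seqD(1)[OF assms(1)] by simp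
    ultimately show ?thesis using the_inv_into_f_f[OF inj, of "i mod n"] grid_seqD(4)[OF assms(1), of i]
      by (simp add: ix_def)
  qed
  define G where "G = \<lparr>gsize = nat n, Xrow = (\<lambda>c. nat (y (ix c))), Orow = (\<lambda>c. nat (y (ix c - 1)))\<rparr>"
  have "y ((i + 1) mod n - 1) = y i" for i
  proof -
    have "y ((i + 1) mod n - 1) = y ((i + 1) mod n - 1 + n * ((i + 1) div n))"
      using periodic_mult[of y n] grid_seqD(3)[OF assms(1)] by simp
    also have "(i + 1) mod n - 1 + n * ((i + 1) div n) = i" by (simp add: algebra_simps)
    finally show ?thesis .
  qed
  hence "represents G n x y"
    using periodic_mod[of y n] grid_seqD(3)[OF assms(1)] assms(2) by (simp add: represents_def G_def ix)
  thus ?thesis by blast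
qed

section \<open>The curve of a grid: area integral, double points, turning\<close>

lemma pl_continuous: "continuous_on A (pl V)" for V :: "int \<Rightarrow> real"
proof -
  have edge: "continuous_on {of_int k..of_int k + 1} (pl V)" for k
  proof -
    have "continuous_on {of_int k..of_int k + 1} (\<lambda>u. (1 - (u - of_int k)) *\<^sub>R V k + (u - of_int k) *\<^sub>R V (k + 1))"
      by (intro continuous_intros)
    thus ?thesis by (rule continuous_on_cong[THEN iffD1, rotated 2]) (auto simp: pl_edge)
  qed
  have ivl: "continuous_on {of_int a..of_int b} (pl V)" if "a \<le> b" for a b
    using that
  proof (induction b rule: int_ge_induct)
    case base thus ?case by (rule continuous_on_subset[OF edge[of a]]) auto
  next
    case (step b)
    have "{real_of_int a..of_int (b + 1)} = {of_int a..of_int b} \<union> {of_int b..of_int b + 1}" using step by auto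
    thus ?case using continuous_on_closed_Un[OF _ _ step.IH edge[of b]] by simp
  qed
  have "isCont (pl V) u" for u
  proof -
    have "continuous_on {of_int (\<lfloor>u\<rfloor> - 1)..of_int (\<lfloor>u\<rfloor> + 2)} (pl V)" by (rule ivl) simp
    moreover have "u \<in> interior {real_of_int (\<lfloor>u\<rfloor> - 1)..of_int (\<lfloor>u\<rfloor> + 2)}" 
      unfolding interior_atLeastAtMost_real by (simp, linarith)
    ultimately show ?thesis by (rule continuous_on_interior)
  qed
  thus ?thesis by (simp add: continuous_at_imp_continuous_on)
qed

lemma pl_derivative:
  fixes V :: "int \<Rightarrow> real"
  assumes "of_int k < u" "u < of_int k + 1"
  shows "(pl V has_real_derivative V (k + 1) - V k) (at u)"
proof (rule has_field_derivative_transform_within_open)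
  show "((\<lambda>u. (1 - (u - of_int k)) * V k + (u - of_int k) * V (k + 1)) has_real_derivative V (k + 1) - V k) (at u)"
    by (auto intro!: derivative_eq_intros)
  show "u \<in> {of_int k<..<of_int k + 1}" using assms by simp
  show "(1 - (t - of_int k)) * V k + (t - of_int k) * V (k + 1) = pl V t" if "t \<in> {of_int k<..<of_int k + 1}" for t
    using that pl_edge[of k t V] by simp
qed simp

text \<open>Term \<open>i\<close> collects the turns at both ends of horizontal edge
  \<open>i\<close>, each being the sign of the cross product of two consecutive edges.\<close>

definition rot_seq :: "int \<Rightarrow> (int \<Rightarrow> int) \<Rightarrow> (int \<Rightarrow> int) \<Rightarrow> int" where
  "rot_seq n x y = (\<Sum>i\<in>{0..<n}. sgn (x (i + 1) - x i) * (sgn (y (i + 1) - y i) - sgn (y i - y (i - 1))))"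

locale represented_grid =
  fixes G :: grid and n :: int and x y :: "int \<Rightarrow> int"
  assumes seq: "grid_seq n x y" and rep: "represents G n x y"
begin

lemma n2: "2 \<le> n" using grid_seqD[OF seq] by simp
lemma perx: "x (i + n) = x i" and pery: "y (i + n) = y i" using grid_seqD[OF seq] by auto
lemma xr: "0 \<le> x i" "x i < n" and yr: "0 \<le> y i" "y i < n" using grid_seqD(4,5)[OF seq, of i] by auto
lemma size: "gsize G = nat n" using rep by (simp add: represents_def)
lemma x0: "x 0 = 0" using rep by (simp add: represents_def)
lemma Xrow: "Xrow G (nat (x i)) = nat (y i)" and Orow: "Orow G (nat (x (i + 1))) = nat (y i)"
  using rep by (simp_all add: represents_def)

lemma x_onto: "c < nat n \<Longrightarrow> \<exists>i\<in>{0..<n}. nat (x i) = c"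
proof -
  assume "c < nat n"
  hence "int c \<in> x ` {0..<n}" using seq by (auto simp: grid_seq_def)
  thus ?thesis by force
qed

lemma y_onto: "c < nat n \<Longrightarrow> \<exists>i\<in>{0..<n}. nat (y i) = c"
proof -
  assume "c < nat n"
  hence "int c \<in> y ` {0..<n}" using seq by (auto simp: grid_seq_def)
  thus ?thesis by force
qed

lemma bij_Xrow: "bij_betw (Xrow G) {..<nat n} {..<nat n}"
proof -
  have "Xrow G ` {..<nat n} = {..<nat n}"
  proof
    show "Xrow G ` {..<nat n} \<subseteq> {..<nat n}"
      using x_onto Xrow yr by (force simp: nat_less_iff)
    show "{..<nat n} \<subseteq> Xrow G ` {..<nat n}"
    proof
      fix c assume "c \<in> {..<nat n}"
      then obtain i where "nat (y i) = c" using y_onto by auto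
      hence "c = Xrow G (nat (x i))" "nat (x i) \<in> {..<nat n}" using Xrow xr n2 by (auto simp: nat_less_iff)
      thus "c \<in> Xrow G ` {..<nat n}" by blast
    qed
  qed
  thus ?thesis unfolding bij_betw_def by (simp add: eq_card_imp_inj_on)
qed

lemma bij_Orow: "bij_betw (Orow G) {..<nat n} {..<nat n}"
proof -
  have "Orow G ` {..<nat n} = {..<nat n}"
  proof
    show "Orow G ` {..<nat n} \<subseteq> {..<nat n}"
    proof
      fix r assume "r \<in> Orow G ` {..<nat n}"
      then obtain i where "r = Orow G (nat (x (i - 1 + 1)))" using x_onto by fastforce
      hence "r = nat (y (i - 1))" unfolding Orow .
      thus "r \<in> {..<nat n}" using yr n2 by (auto simp: nat_less_iff)
    qed
    show "{..<nat n} \<subseteq> Orow G ` {..<nat n}"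
    proof
      fix c assume "c \<in> {..<nat n}"
      then obtain i where "nat (y i) = c" using y_onto by auto
      hence "c = Orow G (nat (x (i + 1)))" "nat (x (i + 1)) \<in> {..<nat n}" using Orow xr n2 by (auto simp: nat_less_iff)
      thus "c \<in> Orow G ` {..<nat n}" by blast
    qed
  qed
  thus ?thesis unfolding bij_betw_def by (simp add: eq_card_imp_inj_on)
qed

lemma gsigma: "gsigma G (nat (x i)) = nat (x (i + 1))"
proof -
  have "Xrow G (nat (x i)) = Orow G (nat (x (i + 1)))" using Xrow Orow by simp
  thus ?thesis unfolding gsigma_def size
    using bij_Orow xr n2 by (simp add: bij_betw_def the_inv_into_f_f nat_less_iff)
qed

lemma gcol: "gcol G k = nat (x (int k))"
  by (induction k) (use gsigma x0 in \<open>simp_all add: gcol_def add.commute\<close>)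

lemma immersed: "immersed_grid G"
  unfolding immersed_grid_def size
proof (intro conjI allI impI)
  show "1 \<le> nat n" using n2 by simp
  show "Xrow G c \<noteq> Orow G c" if c: "c < nat n" for c
  proof
    assume e: "Xrow G c = Orow G c"
    obtain i where i: "nat (x i) = c" using x_onto[OF c] by auto
    have "nat (y i) = nat (y (i - 1))" using e i Xrow[of i] Orow[of "i - 1"] by simp
    hence "y i = y (i - 1)" using yr by (metis eq_nat_nat_iff)
    hence "n dvd i - (i - 1)" by (rule grid_seqD(7)[OF seq])
    thus False using n2 by (auto dest: zdvd_imp_le)
  qed
  show "gcol G ` {..<nat n} = {..<nat n}"
  proof
    show "gcol G ` {..<nat n} \<subseteq> {..<nat n}" using xr n2 by (auto simp: gcol nat_less_iff)
    show "{..<nat n} \<subseteq> gcol G ` {..<nat n}"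
    proof
      fix c assume "c \<in> {..<nat n}"
      hence "c < nat n" by simp
      then obtain i where "i \<in> {0..<n}" "nat (x i) = c" using x_onto by blast
      hence "c = gcol G (nat i)" "nat i \<in> {..<nat n}" by (auto simp: gcol)
      thus "c \<in> gcol G ` {..<nat n}" by blast
    qed
  qed
qed (use bij_Xrow bij_Orow in auto)

abbreviation "X \<equiv> cx (half x)"
abbreviation "Y \<equiv> cy (half y)"

lemma vertex_nat: "vertex G j = (X (int j), Y (int j))"
proof -
  have e: "real (gcol G k) + 1/2 = half x (int k)" "real (Xrow G (gcol G k)) + 1/2 = half y (int k)" for k
    using xr yr by (simp_all add: gcol Xrow half_def)
  have d: "(int j + 1) div 2 = int (if even j then j div 2 else Suc (j div 2))" "int j div 2 = int (j div 2)"
    by (cases "even j") (auto elim!: evenE oddE)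
  show ?thesis unfolding vertex_def Let_def cx_def cy_def d by (simp only: e split: if_splits) simp
qed

lemma X_mod: "X (k mod (2 * n)) = X k" "X (k mod (2 * n) + 1) = X (k + 1)"
  and Y_mod: "Y (k mod (2 * n)) = Y k" "Y (k mod (2 * n) + 1) = Y (k + 1)"
proof -
  have pX: "X (i + 2 * n) = X i" and pY: "Y (i + 2 * n) = Y i" for i
    by (intro cx_periodic cy_periodic; simp add: half_def perx pery)+
  show "X (k mod (2 * n)) = X k" "Y (k mod (2 * n)) = Y k" using periodic_mod pX pY by metis+
  have e: "k mod (2 * n) + 1 + 2 * n * (k div (2 * n)) = k + 1"
    using mult_div_mod_eq[of "2 * n" k] by linarith
  show "X (k mod (2 * n) + 1) = X (k + 1)" "Y (k mod (2 * n) + 1) = Y (k + 1)"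
    using periodic_mult[of X "2 * n", OF pX, of "k mod (2 * n) + 1" "k div (2 * n)"]
      periodic_mult[of Y "2 * n", OF pY, of "k mod (2 * n) + 1" "k div (2 * n)"] unfolding e by simp_all
qed

text \<open>Converts the angle to the parameter of \<open>pl\<close>, in which every edge has length
  1 and the whole curve length \<open>2 * n\<close>.\<close>

definition scale :: real where "scale = of_int n / pi"

lemma scale_pos: "0 < scale" using n2 by (simp add: scale_def)

lemma gamma: "gamma G \<theta> = (pl X (\<theta> * scale), pl Y (\<theta> * scale))"
proof -
  have s: "\<theta> * real (2 * gsize G) / (2 * pi) = \<theta> * scale" using n2 by (simp add: size scale_def)
  define k where "k = \<lfloor>\<theta> * scale\<rfloor>"
  have N: "int (2 * gsize G) = 2 * n" using n2 by (simp add: size)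
  have j: "int (nat (k mod (2 * n))) = k mod (2 * n)" using n2 by simp
  hence j': "int (Suc (nat (k mod (2 * n)))) = k mod (2 * n) + 1" by simp
  show ?thesis unfolding gamma_def Let_def s N k_def[symmetric] vertex_nat j j' X_mod Y_mod
    by (simp add: pl_def k_def frac_def)
qed

context
  fixes z assumes h: "heights x y z"
begin

abbreviation "Z \<equiv> cx (height x z)"

text \<open>\<open>Z\<close> is a primitive of the integrand off the corners: on horizontal edges by
  the recursion for the heights, on vertical edges because both sides vanish. As \<open>Z\<close> is
  continuous, the finitely many corners do no harm in the fundamental theorem of calculus.\<close>

lemma tint_eq: "tint G a b = pl Z (b * scale) - pl Z (a * scale)"
proof -
  define f where "f \<theta> = gy G \<theta> * deriv (gw G) \<theta>" for \<theta>
  have main: "integral {a..b} f = pl Z (b * scale) - pl Z (a * scale)" if "a \<le> b" for a b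
  proof (rule integral_unique, rule fundamental_theorem_of_calculus_interior_strong)
    define S where "S = (\<lambda>k. of_int k / scale) ` {\<lfloor>a * scale\<rfloor>..\<lceil>b * scale\<rceil>}"
    show "finite S" by (simp add: S_def)
    show "a \<le> b" by fact
    show "continuous_on {a..b} (\<lambda>\<theta>. pl Z (\<theta> * scale))"
      by (rule continuous_on_compose2[OF pl_continuous[of UNIV]]) (auto intro!: continuous_intros)
    fix \<theta> assume t: "\<theta> \<in> {a<..<b} - S"
    define k where "k = \<lfloor>\<theta> * scale\<rfloor>"
    have "a * scale < \<theta> * scale" "\<theta> * scale < b * scale" using t scale_pos by auto
    hence kr: "k \<in> {\<lfloor>a * scale\<rfloor>..\<lceil>b * scale\<rceil>}" unfolding k_def by (auto simp: floor_mono) linarith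
    have "\<theta> * scale \<noteq> of_int k"
    proof
      assume "\<theta> * scale = of_int k"
      hence "\<theta> = of_int k / scale" using scale_pos by (simp add: field_simps)
      thus False using t kr by (auto simp: S_def)
    qed
    hence k: "of_int k < \<theta> * scale" "\<theta> * scale < of_int k + 1" unfolding k_def by linarith+
    have D: "((\<lambda>\<theta>. pl V (\<theta> * scale)) has_real_derivative (V (k + 1) - V k) * scale) (at \<theta>)" for V
      by (rule DERIV_chain'[of "\<lambda>\<theta>. \<theta> * scale", OF _ pl_derivative[OF k], simplified]) (auto intro!: derivative_eq_intros)
    have gwe: "gw G = (\<lambda>\<theta>. pl X (\<theta> * scale))" by (auto simp: gw_def gamma)
    have gye: "gy G \<theta> = pl Y (\<theta> * scale)" by (simp add: gy_def gamma)
    have "f \<theta> = pl Y (\<theta> * scale) * ((X (k + 1) - X k) * scale)"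
      unfolding f_def gwe gye using DERIV_imp_deriv[OF D[of X]] by simp
    also have "\<dots> = (Z (k + 1) - Z k) * scale"
    proof (cases "even k")
      case True
      then obtain i where i: "k = 2 * i" by blast
      have "pl Y (\<theta> * scale) = half y i" using pl_horizontal(2)[of i "\<theta> * scale" "half y"] k i by simp
      moreover have n: "cx f (2 * i) = f i" "cx f (2 * i + 1) = f (i + 1)" for f :: "int \<Rightarrow> real"
        unfolding cx_def by (rule arg_cong[where f = f], presburger)+
      ultimately show ?thesis unfolding i n using height_rec[OF h, of i] by simp
    next
      case False
      then obtain i where i: "k = 2 * i + 1" by (rule oddE)
      have n: "cx f (2 * i + 1 + 1) = cx f (2 * i + 1)" for f :: "int \<Rightarrow> real"
        unfolding cx_def by (rule arg_cong[where f = f], presburger)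
      show ?thesis unfolding i n by simp
    qed
    finally show "((\<lambda>\<theta>. pl Z (\<theta> * scale)) has_vector_derivative f \<theta>) (at \<theta>)"
      using D[of Z] by (simp add: has_real_derivative_iff_has_vector_derivative)
  qed
  show ?thesis
  proof (cases "a \<le> b")
    case True thus ?thesis using main[of a b] by (simp add: tint_def f_def[abs_def])
  next
    case False thus ?thesis using main[of b a] by (simp add: tint_def f_def[abs_def])
  qed
qed

lemma total: "tint G 0 (2 * pi) = of_int (z n - z 0)"
proof -
  have s: "2 * pi * scale = of_int (2 * n)" by (simp add: scale_def)
  have n: "Z (2 * i) = height x z i" for i unfolding cx_def by (rule arg_cong[where f = "height x z"]) presburger
  have "x n = x 0" using perx[of 0] by simp
  thus ?thesis unfolding tint_eq s pl_int n using n[of 0] pl_int[of Z 0] by (simp add: height_def)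
qed

lemma Z_mod:
  assumes "z n = z 0" shows "pl Z (u + of_int (2 * n * k)) = pl Z u"
proof -
  have "height x z (i + n) = height x z i" for i
    using heights_periodic[OF h perx pery assms] perx by (simp add: height_def)
  hence "Z (i + 2 * n) = Z i" for i by (rule cx_periodic)
  thus ?thesis unfolding pl_shift by (subst periodic_mult) auto
qed

lemma XY_mod: "pl X (u + of_int (2 * n * k)) = pl X u" "pl Y (u + of_int (2 * n * k)) = pl Y u"
proof -
  have pX: "X (i + 2 * n) = X i" and pY: "Y (i + 2 * n) = Y i" for i
    by (intro cx_periodic cy_periodic; simp add: half_def perx pery)+
  show "pl X (u + of_int (2 * n * k)) = pl X u" "pl Y (u + of_int (2 * n * k)) = pl Y u"
    unfolding pl_shift using periodic_mult[of X "2 * n", OF pX] periodic_mult[of Y "2 * n", OF pY] by simp_all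
qed

text \<open>\<open>x 0 = 0\<close> and \<open>z 0 = 0\<close> together make \<open>Z\<close> vanish
  at parameter 0, where the integral defining the lift begins.\<close>

lemma lift_knot_eq:
  assumes "z n = z 0" "z 0 = 0"
  shows "lift_knot G = knot (half x) (half y) (height x z)"
proof -
  have z0: "pl Z 0 = 0"
  proof -
    have "Z 0 = 0" using assms(2) x0 by (simp add: cx_def height_def)
    thus ?thesis using pl_int[of Z 0] by simp
  qed
  have l: "legendrian_lift G \<theta> = pl (tri X Y Z) (\<theta> * scale)" for \<theta>
    by (simp add: legendrian_lift_def pl_tri tint_eq z0 gw_def gy_def gamma)
  have im: "(\<lambda>\<theta>. \<theta> * scale) ` {0..2 * pi} = {of_int 0..of_int (0 + 2 * n)}"
  proof -
    have e: "2 * pi * scale = 2 * of_int n" by (simp add: scale_def)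
    have "(\<lambda>\<theta>. \<theta> * scale) ` {0..2 * pi} = {0 * scale..(2 * pi) * scale}"
      using scale_pos image_mult_atLeastAtMost[of scale 0 "2 * pi"] by (simp add: mult.commute)
    thus ?thesis unfolding e by simp
  qed
  have "lift_knot G = pl (tri X Y Z) ` ((\<lambda>\<theta>. \<theta> * scale) ` {0..2 * pi})"
    by (simp add: lift_knot_def image_image l)
  also have "\<dots> = knot (half x) (half y) (height x z)"
    unfolding im by (rule knot_interval[symmetric])
      (use n2 perx pery heights_periodic[OF h perx pery assms(1)] in \<open>simp_all add: half_def height_def\<close>)
  finally show ?thesis .
qed

lemma double_point_cross:
  assumes z: "z n = z 0" and t: "\<theta>0 \<in> {0..<2*pi}" "\<theta>1 \<in> {0..<2*pi}" "\<theta>0 \<noteq> \<theta>1" "gamma G \<theta>0 = gamma G \<theta>1"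
  shows "\<exists>i j. cross x y i j \<and> \<bar>tint G \<theta>0 \<theta>1\<bar> = \<bar>of_int (z i + y i * (x j - x i) - z j)\<bar>"
proof -
  have e: "pl X (\<theta>0 * scale) = pl X (\<theta>1 * scale)" "pl Y (\<theta>0 * scale) = pl Y (\<theta>1 * scale)"
    using t(4) by (simp_all add: gamma)
  have inj: "half x i = half x j \<Longrightarrow> n dvd i - j" "half y i = half y j \<Longrightarrow> n dvd i - j" for i j
    using grid_seqD(6,7)[OF seq, of i j] by (simp_all add: half_def)
  have per: "half x (i + n) = half x i" "half y (i + n) = half y i" for i by (simp_all add: half_def perx pery)
  show ?thesis
  proof (rule planar_coincidence[OF n2 per inj e])
    fix k assume "\<theta>0 * scale = \<theta>1 * scale + 2 * of_int n * of_int k"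
    hence "(\<theta>0 - \<theta>1) * scale = (2 * pi * of_int k) * scale" by (simp add: scale_def field_simps)
    hence k: "\<theta>0 - \<theta>1 = 2 * pi * of_int k" using scale_pos by simp
    have "2 * pi * of_int k < 2 * pi * 1" "2 * pi * (-1) < 2 * pi * of_int k" using t(1,2) unfolding k[symmetric] by auto
    hence "real_of_int k < 1" "-1 < real_of_int k" by (simp_all only: mult_less_cancel_left_pos[of "2 * pi"] pi_gt_zero mult_pos_pos zero_less_numeral)
    hence "k = 0" by linarith
    thus ?thesis using k t(3) by simp
  next
    fix i j assume H: "cross (half x) (half y) i j" "2 * of_int i < \<theta>0 * scale" "\<theta>0 * scale < 2 * of_int i + 1"
      "2 * of_int j - 1 < \<theta>1 * scale" "\<theta>1 * scale < 2 * of_int j"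
    have "pl Z (\<theta>0 * scale) - pl Z (\<theta>1 * scale) = of_int (z i + y i * (x j - x i) - z j)"
      unfolding height_cross[symmetric] by (rule crossing_height) (use H e height_rec[OF h] in auto)
    thus ?thesis using H(1) unfolding tint_eq by (intro exI[of _ i] exI[of _ j]) simp
  next
    fix i j assume H: "cross (half x) (half y) i j" "2 * of_int i < \<theta>1 * scale" "\<theta>1 * scale < 2 * of_int i + 1"
      "2 * of_int j - 1 < \<theta>0 * scale" "\<theta>0 * scale < 2 * of_int j"
    have "pl Z (\<theta>1 * scale) - pl Z (\<theta>0 * scale) = of_int (z i + y i * (x j - x i) - z j)"
      unfolding height_cross[symmetric] by (rule crossing_height) (use H e height_rec[OF h] in auto)
    thus ?thesis using H(1) unfolding tint_eq by (intro exI[of _ i] exI[of _ j]) simp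
  qed
qed

text \<open>Solve for the positions \<open>s\<close> and \<open>t\<close> on the two edges and
  reduce both parameters to one period. They remain different, because horizontal edges start at
  even and vertical edges at odd parameters and the period is even.\<close>

lemma cross_double_point:
  assumes z: "z n = z 0" and c: "cross x y i j"
  obtains \<theta>0 \<theta>1 where "\<theta>0 \<in> {0..<2*pi}" "\<theta>1 \<in> {0..<2*pi}" "\<theta>0 \<noteq> \<theta>1" "gamma G \<theta>0 = gamma G \<theta>1"
    "\<bar>tint G \<theta>0 \<theta>1\<bar> = \<bar>of_int (z i + y i * (x j - x i) - z j)\<bar>"
proof -
  define s where "s = (half x j - half x i) / (half x (i + 1) - half x i)"
  define t where "t = (half y i - half y (j - 1)) / (half y j - half y (j - 1))"
  have s: "0 < s" "s < 1" and t: "0 < t" "t < 1" using c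
    unfolding cross_def s_def t_def half_def by (auto simp: divide_simps)
  have s': "s * (half x (i + 1) - half x i) = half x j - half x i" and t': "t * (half y j - half y (j - 1)) = half y i - half y (j - 1)"
    using c unfolding cross_def s_def t_def half_def by auto
  define u where "u = 2 * of_int i + s"
  define w where "w = 2 * of_int j - 1 + t"
  have XX: "pl X u = pl X w" and YY: "pl Y u = pl Y w"
    using pl_horizontal[of i u] pl_vertical[of j w] s t s' t' by (auto simp: u_def w_def)
  have ZZ: "pl Z u - pl Z w = of_int (z i + y i * (x j - x i) - z j)"
    unfolding height_cross[symmetric] by (rule crossing_height) (use s t XX height_rec[OF h] in \<open>auto simp: u_def w_def\<close>)
  define red where "red v = v - of_int (2 * n * \<lfloor>v / (2 * of_int n)\<rfloor>)" for v :: real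
  have red: "0 \<le> red v" "red v < 2 * of_int n" for v
  proof -
    define q where "q = \<lfloor>v / (2 * of_int n)\<rfloor>"
    have "of_int q \<le> v / (2 * of_int n)" "v / (2 * of_int n) < of_int q + 1" unfolding q_def by linarith+
    hence "of_int q * (2 * of_int n) \<le> v" "v < (of_int q + 1) * (2 * of_int n)"
      using n2 by (simp_all add: pos_le_divide_eq pos_divide_less_eq)
    moreover have r: "red v = v - of_int (2 * n * q)" by (simp only: red_def q_def)
    ultimately show "0 \<le> red v" "red v < 2 * of_int n" unfolding r by (simp_all add: algebra_simps)
  qed
  have vr: "v = red v + of_int (2 * n * \<lfloor>v / (2 * of_int n)\<rfloor>)" for v by (simp add: red_def)
  have plr: "pl X (red v) = pl X v" "pl Y (red v) = pl Y v" "pl Z (red v) = pl Z v" for v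
    using XY_mod[of "red v" "\<lfloor>v / (2 * of_int n)\<rfloor>"] Z_mod[OF z, of "red v" "\<lfloor>v / (2 * of_int n)\<rfloor>"] vr[of v] by metis+
  have ne: "red u \<noteq> red w"
  proof
    assume "red u = red w"
    moreover define k where "k = \<lfloor>u / (2 * of_int n)\<rfloor> - \<lfloor>w / (2 * of_int n)\<rfloor>"
    ultimately have "u = w + of_int (2 * n * k)"
      unfolding k_def right_diff_distrib of_int_diff using vr[of u] vr[of w] by linarith
    hence "2 * of_int i + s = 2 * of_int (j + n * k) - 1 + t" by (simp add: u_def w_def)
    hence "of_int (2 * i) + s = of_int (2 * (j + n * k) - 1) + t" by simp
    hence "2 * i = 2 * (j + n * k) - 1" using s t by linarith
    thus False by presburger
  qed
  have rs: "red v / scale \<in> {0..<2*pi}" for v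
  proof -
    have "2 * pi = 2 * of_int n / scale" using n2 by (simp add: scale_def)
    thus ?thesis using red[of v] scale_pos by (simp add: divide_strict_right_mono)
  qed
  have sc: "red v / scale * scale = red v" for v using scale_pos by simp
  show thesis
  proof (rule that[of "red u / scale" "red w / scale"])
    show "red u / scale \<noteq> red w / scale" using ne scale_pos by simp
    show "gamma G (red u / scale) = gamma G (red w / scale)" unfolding gamma sc plr using XX YY by simp
    show "\<bar>tint G (red u / scale) (red w / scale)\<bar> = \<bar>of_int (z i + y i * (x j - x i) - z j)\<bar>"
      unfolding tint_eq sc plr using ZZ by simp
  qed (rule rs)+
qed

end

lemma turn_even: "i < nat n \<Longrightarrow> turn G (2 * i) = - of_int ((y (int i) - y (int i - 1)) * (x (int i + 1) - x (int i)))"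
  and turn_odd: "i < nat n \<Longrightarrow> turn G (2 * i + 1) = of_int ((x (int i + 1) - x (int i)) * (y (int i + 1) - y (int i)))"
proof -
  have prev: "vertex G ((j + 2 * gsize G - 1) mod (2 * gsize G)) = (X (int j - 1), Y (int j - 1))" for j
  proof -
    have "int ((j + 2 * gsize G - 1) mod (2 * gsize G)) = (int j - 1) mod (2 * n)"
      using n2 unfolding zmod_int size by (simp add: of_nat_diff) (metis add.commute add_diff_eq mod_add_self1)
    thus ?thesis unfolding vertex_nat by (simp add: X_mod Y_mod)
  qed
  have n: "cx f (2 * int i - 1) = f (int i)" "cx f (2 * int i) = f (int i)" "cx f (2 * int i + 1) = f (int i + 1)" "cx f (2 * int i + 2) = f (int i + 1)"
    "cy f (2 * int i - 1) = f (int i - 1)" "cy f (2 * int i) = f (int i)" "cy f (2 * int i + 1) = f (int i)" "cy f (2 * int i + 2) = f (int i + 1)"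
    for f :: "int \<Rightarrow> real" and i
    unfolding cx_def cy_def by (rule arg_cong[where f = f], presburger)+
  show "turn G (2 * i) = - of_int ((y (int i) - y (int i - 1)) * (x (int i + 1) - x (int i)))"
  proof -
    have v: "vertex G (2 * i) = (half x (int i), half y (int i))" "vertex G (Suc (2 * i)) = (half x (int i + 1), half y (int i))"
      "vertex G ((2 * i + 2 * gsize G - 1) mod (2 * gsize G)) = (half x (int i), half y (int i - 1))"
      unfolding prev using n[of _ i] by (simp_all add: vertex_nat add.commute)
    show ?thesis unfolding turn_def Let_def v by (simp add: half_def)
  qed
  show "turn G (2 * i + 1) = of_int ((x (int i + 1) - x (int i)) * (y (int i + 1) - y (int i)))"
  proof -
    have v: "vertex G (2 * i + 1) = (half x (int i + 1), half y (int i))" "vertex G (Suc (2 * i + 1)) = (half x (int i + 1), half y (int i + 1))"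
      "vertex G ((2 * i + 1 + 2 * gsize G - 1) mod (2 * gsize G)) = (half x (int i), half y (int i))"
      unfolding prev using n[of _ i] by (simp_all add: vertex_nat add.commute)
    show ?thesis unfolding turn_def Let_def v by (simp add: half_def)
  qed
qed

lemma rotation: "rotation_number G = of_int (rot_seq n x y) / 4"
proof -
  have card: "real (card {j. j < m \<and> f j > 0}) - real (card {j. j < m \<and> f j < 0}) = (\<Sum>j<m. sgn (f j))" for f :: "nat \<Rightarrow> real" and m
  proof -
    have "(\<Sum>j<m. sgn (f j)) = (\<Sum>j<m. (if f j > 0 then 1 else 0) - (if f j < 0 then 1 else 0))"
      by (rule sum.cong) (auto simp: sgn_if)
    also have "\<dots> = real (card {j\<in>{..<m}. f j > 0}) - real (card {j\<in>{..<m}. f j < 0})"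
      by (simp add: sum_subtractf sum.If_cases Int_def)
    finally show ?thesis by (simp add: lessThan_def)
  qed
  have dbl: "(\<Sum>j<2 * m. f j) = (\<Sum>i<m. f (2 * i) + f (2 * i + 1))" for f :: "nat \<Rightarrow> real" and m
    by (induction m) (simp_all add: algebra_simps)
  have "(\<Sum>j<2 * gsize G. sgn (turn G j)) = (\<Sum>i<nat n. sgn (turn G (2 * i)) + sgn (turn G (2 * i + 1)))"
    unfolding dbl size ..
  also have "\<dots> = (\<Sum>i<nat n. of_int (sgn (x (int i + 1) - x (int i)) * (sgn (y (int i + 1) - y (int i)) - sgn (y (int i) - y (int i - 1)))))"
  proof (rule sum.cong)
    fix i assume "i \<in> {..<nat n}"
    hence i: "i < nat n" by simp
    have sg: "sgn (real_of_int a) = of_int (sgn a)" for a :: int by (simp add: sgn_if)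
    have "sgn (turn G (2 * i)) = of_int (- (sgn (y (int i) - y (int i - 1)) * sgn (x (int i + 1) - x (int i))))"
      unfolding turn_even[OF i] sgn_minus sg by (simp add: sgn_mult)
    moreover have "sgn (turn G (2 * i + 1)) = of_int (sgn (x (int i + 1) - x (int i)) * sgn (y (int i + 1) - y (int i)))"
      unfolding turn_odd[OF i] sg by (simp add: sgn_mult)
    ultimately show "sgn (turn G (2 * i)) + sgn (turn G (2 * i + 1)) =
      of_int (sgn (x (int i + 1) - x (int i)) * (sgn (y (int i + 1) - y (int i)) - sgn (y (int i) - y (int i - 1))))"
      by (simp add: algebra_simps)
  qed simp
  also have "\<dots> = of_int (rot_seq n x y)"
  proof -
    have "(\<Sum>i\<in>{0..<n}. g i) = (\<Sum>i<nat n. g (int i))" for g :: "int \<Rightarrow> int"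
    proof (rule sum.reindex_cong[of int])
      show "{0..<n} = int ` {..<nat n}" using n2 by (simp add: image_int_atLeastLessThan lessThan_atLeast0)
    qed auto
    thus ?thesis by (simp add: rot_seq_def)
  qed
  finally show ?thesis unfolding rotation_number_def using card by simp
qed

end

subsection \<open>The replacement path\<close>

text \<open>After stretching by \<open>K\<close> and \<open>L\<close>, the corner is replaced by a path that visits all empty
  columns and rows. From the top of the old diagram it runs left to column \<open>0\<close>, then back to the
  right above everything as a step function through the empty columns (rows \<open>Y + h k\<close>); right of
  the old diagram, a thin double staircase descends (rows \<open>\<rho> t + 1\<close>) and comes back up
  (rows \<open>\<rho> t\<close>), using up the empty rows in adjacent pairs.\<close>

locale corner_path =
  fixes n K \<kappa> q :: int and x y h :: "int \<Rightarrow> int"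
  assumes seq: "grid_seq n x y" and corner: "x 0 = n - 1" "y (n - 1) = n - 1"
    and K: "2 \<le> K" and lam: "1 \<le> \<kappa>" and q: "(K - 1) * n + 1 \<le> q"
    and h: "h ` {0..<q} = {1..q}"
begin

text \<open>Below each kept old row there are then \<open>2 * \<kappa>\<close> empty rows, that is
  \<open>\<kappa>\<close> adjacent pairs for the double staircase.\<close>

definition "L = 2 * \<kappa> + 1"
definition "\<nu> = n - 1"
text \<open>The number of pairs: \<open>\<kappa>\<close> below each of the \<open>\<nu>\<close>
  lower old rows, and one more just below the new top row.\<close>

definition "J = \<kappa> * \<nu> + 1"
definition "\<mu> = q + 2 * J"
definition "N = \<mu> + n"
text \<open>Pure stretching would put the top row at \<open>L * \<nu> + L - 1\<close>; placing it
  directly above the last pair instead is what frees area of quadratic order.\<close>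

definition "Y = L * \<nu> + 2"
definition "R0 = q + n"
definition "Xm = K * \<nu> + K - 1"
text \<open>The \<open>k\<close>-th empty column: one of the \<open>n\<close> old columns
  \<open>K * c + K - 1\<close> is skipped after every \<open>K - 1\<close> empty ones.\<close>

definition "\<xi> k = k + min n (k div (K - 1))" for k
text \<open>Lower row of the \<open>j\<close>-th pair; an old row is skipped after every
  \<open>\<kappa>\<close> pairs.\<close>

definition "\<rho> j = 2 * j + j div \<kappa>" for j

text \<open>In order: step function, descending staircase, returning staircase, old columns. The
  final default is the value at index \<open>N\<close>, where the curve is back in column 0.\<close>

definition "px k = (if k < q then \<xi> k else if k < q + J then R0 + 2 * (k - q)
   else if k < \<mu> then R0 + 2 * (\<mu> - k) - 1 else if k < N then K * x (k - \<mu>) + K - 1 else 0)" for k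
text \<open>The first branch serves index \<open>-1\<close>, which is the top row again, as at index
  \<open>N - 1\<close>; along it the path starts.\<close>

definition "py k = (if k < 0 then Y else if k < q then Y + h k else if k < q + J then \<rho> (q + J - 1 - k) + 1
   else if k < \<mu> then \<rho> (k - q - J) else if k < N - 1 then L * y (k - \<mu>) + L - 1 else Y)" for k

definition "x' i = px (i mod N)" for i
definition "y' i = py (i mod N)" for i

lemma n2: "2 \<le> n" and nu: "1 \<le> \<nu>" using grid_seqD(1)[OF seq] by (auto simp: \<nu>_def)

lemma J2: "2 \<le> J" unfolding J_def using mult_mono[of 1 \<kappa> 1 \<nu>] lam nu by simp
lemma q1: "1 \<le> q"
proof -
  have "0 \<le> (K - 1) * n" using K n2 by simp
  thus ?thesis using q by linarith
qed

lemma mu_bounds: "q < q + J" "q + J < \<mu>" "\<mu> < N" "0 < N" using J2 n2 q1 by (auto simp: \<mu>_def N_def)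

lemma perx: "x (i + n) = x i" and pery: "y (i + n) = y i" using grid_seqD[OF seq] by auto

lemma x_lt: "l \<in> {1..n-1} \<Longrightarrow> x l < \<nu>" and x_ge: "0 \<le> x l"
proof -
  show "0 \<le> x l" using grid_seqD(4)[OF seq, of l] by simp
  assume l: "l \<in> {1..n-1}"
  have "x l \<noteq> x 0"
  proof
    assume "x l = x 0"
    hence "n dvd l - 0" by (rule grid_seqD(6)[OF seq])
    thus False using l zdvd_imp_le[of n l] by auto
  qed
  thus "x l < \<nu>" using grid_seqD(4)[OF seq, of l] corner by (simp add: \<nu>_def)
qed

lemma y_lt: "l \<in> {0..n-2} \<Longrightarrow> y l < \<nu>"
proof -
  assume l: "l \<in> {0..n-2}"
  have "y l \<noteq> y (n - 1)"
  proof
    assume "y l = y (n - 1)"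
    hence "y (n - 1) = y l" by simp
    hence "n dvd n - 1 - l" by (rule grid_seqD(7)[OF seq])
    thus False using l zdvd_imp_le[of n "n - 1 - l"] by auto
  qed
  thus "y l < \<nu>" using grid_seqD(5)[OF seq, of l] corner by (simp add: \<nu>_def)
qed

lemma h_pos: "0 \<le> k \<Longrightarrow> k < q \<Longrightarrow> 1 \<le> h k" using h by force

lemma xi_step: "\<xi> k < \<xi> (k + 1)"
proof -
  have "k div (K - 1) \<le> (k + 1) div (K - 1)" by (rule zdiv_mono1) (use K in auto)
  thus ?thesis by (simp add: \<xi>_def)
qed

lemma xi_mono: "i \<le> j \<Longrightarrow> \<xi> i \<le> \<xi> j"
proof (induction j rule: int_ge_induct)
  case (step j) thus ?case using xi_step[of j] by simp
qed simp

lemma xi_0: "\<xi> 0 = 0" using n2 by (simp add: \<xi>_def)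
lemma xi_large: "(K - 1) * n \<le> k \<Longrightarrow> \<xi> k = k + n"
proof -
  assume "(K - 1) * n \<le> k"
  hence "((K - 1) * n) div (K - 1) \<le> k div (K - 1)" by (rule zdiv_mono1) (use K in auto)
  thus ?thesis using K by (simp add: \<xi>_def)
qed
lemma xi_q: "\<xi> q = R0" using xi_large[of q] q by (simp add: R0_def)

lemma Xm_less: "Xm < R0"
  using q by (simp add: Xm_def R0_def \<nu>_def algebra_simps)

lemma rho_step: "\<rho> j + 2 \<le> \<rho> (j + 1)"
proof -
  have "j div \<kappa> \<le> (j + 1) div \<kappa>" by (rule zdiv_mono1) (use lam in auto)
  thus ?thesis by (simp add: \<rho>_def)
qed

lemma rho_mono: "i \<le> j \<Longrightarrow> \<rho> i \<le> \<rho> j"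
proof (induction j rule: int_ge_induct)
  case (step j) thus ?case using rho_step[of j] by simp
qed simp

lemma rho_0: "\<rho> 0 = 0" by (simp add: \<rho>_def)
lemma rho_top: "\<rho> (J - 1) = L * \<nu>" using lam by (simp add: \<rho>_def J_def L_def algebra_simps)
lemma rho_less: "j < J \<Longrightarrow> \<rho> j + 1 < Y" using rho_mono[of j "J - 1"] rho_top by (simp add: Y_def)

lemma old_row: "l \<in> {0..n-2} \<Longrightarrow> L * y l + L - 1 < L * \<nu>"
proof -
  assume "l \<in> {0..n-2}"
  hence "L * (y l + 1) \<le> L * \<nu>" using y_lt[of l] lam by (intro mult_left_mono) (auto simp: L_def)
  thus ?thesis by (simp add: algebra_simps)
qed

lemma old_col: "l \<in> {1..n-1} \<Longrightarrow> K * x l + K - 1 < Xm"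
  using mult_strict_left_mono[OF x_lt[of l], of K] K by (simp add: Xm_def)

lemma px_eqs:
  "0 \<le> k \<Longrightarrow> k \<le> q \<Longrightarrow> px k = \<xi> k"
  "0 \<le> s \<Longrightarrow> s < J \<Longrightarrow> px (q + s) = R0 + 2 * s"
  "0 \<le> t \<Longrightarrow> t < J \<Longrightarrow> px (q + J + t) = R0 + 2 * (J - t) - 1"
  "0 \<le> l \<Longrightarrow> l < n \<Longrightarrow> px (\<mu> + l) = K * x l + K - 1"
  "px N = 0" "px \<mu> = Xm"
  using mu_bounds xi_q corner n2 by (auto simp: px_def \<mu>_def N_def Xm_def \<nu>_def)

lemma py_eqs:
  "0 \<le> k \<Longrightarrow> k < q \<Longrightarrow> py k = Y + h k"
  "0 \<le> s \<Longrightarrow> s < J \<Longrightarrow> py (q + s) = \<rho> (J - 1 - s) + 1"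
  "0 \<le> t \<Longrightarrow> t < J \<Longrightarrow> py (q + J + t) = \<rho> t"
  "0 \<le> l \<Longrightarrow> l < n - 1 \<Longrightarrow> py (\<mu> + l) = L * y l + L - 1"
  "py (N - 1) = Y" "py (-1) = Y"
proof -
  have e: "\<rho> (q + J - 1 - (q + s)) = \<rho> (J - 1 - s)" for s by (rule arg_cong[where f = \<rho>]) simp
  show "0 \<le> s \<Longrightarrow> s < J \<Longrightarrow> py (q + s) = \<rho> (J - 1 - s) + 1"
    using q1 e[of s] by (simp add: py_def)
qed (use mu_bounds q1 n2 in \<open>auto simp: py_def \<mu>_def N_def\<close>)

lemma x'_eq: "0 \<le> i \<Longrightarrow> i \<le> N \<Longrightarrow> x' i = px i"
proof (cases "i = N")
  case True
  have "px 0 = 0" using px_eqs(1)[of 0] q1 xi_0 by simp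
  thus ?thesis using True px_eqs(5) by (simp add: x'_def)
qed (simp add: x'_def)

lemma y'_eq: "-1 \<le> i \<Longrightarrow> i < N \<Longrightarrow> y' i = py i"
proof (cases "i = -1")
  case True
  have "(- 1) mod N = N - 1" using mu_bounds zmod_minus1 by simp
  thus ?thesis using True py_eqs(5,6) by (simp add: y'_def)
qed (simp add: y'_def)

lemma perx': "x' (i + N) = x' i" and pery': "y' (i + N) = y' i"
  by (simp_all add: x'_def y'_def)

text \<open>Counts the columns and then the rows in use; both totals must equal the size of the new
  diagram.\<close>

lemma N_alt: "N = R0 + 2 * J" "N = Y + q + 1"
  by (simp_all add: N_def \<mu>_def R0_def Y_def J_def L_def \<nu>_def algebra_simps)

lemma x_onto: "0 \<le> c \<Longrightarrow> c < n \<Longrightarrow> \<exists>l\<in>{0..<n}. x l = c"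
  and y_onto: "0 \<le> c \<Longrightarrow> c < \<nu> \<Longrightarrow> \<exists>l\<in>{0..<n-1}. y l = c"
proof -
  have im: "x ` {0..<n} = {0..<n}" "y ` {0..<n} = {0..<n}" using seq by (simp_all add: grid_seq_def)
  show "\<exists>l\<in>{0..<n}. x l = c" if "0 \<le> c" "c < n" 
  proof -
    have "c \<in> x ` {0..<n}" unfolding im using that by simp
    thus ?thesis by auto
  qed
  show "\<exists>l\<in>{0..<n-1}. y l = c" if "0 \<le> c" "c < \<nu>"
  proof -
    have "c \<in> y ` {0..<n}" unfolding im using that by (simp add: \<nu>_def)
    then obtain l where l: "l \<in> {0..<n}" "y l = c" by auto
    have "l \<noteq> n - 1" using l that corner by (auto simp: \<nu>_def)
    thus ?thesis using l by (intro bexI[of _ l]) auto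
  qed
qed

lemma perm_image:
  fixes f :: "int \<Rightarrow> int" assumes "{0..<m} \<subseteq> f ` {0..<m}" shows "f ` {0..<m} = {0..<m}"
proof -
  have "card (f ` {0..<m}) \<le> card {0..<m}" by (rule card_image_le) simp
  thus ?thesis using card_seteq[OF _ assms] by simp
qed

text \<open>Left of \<open>K * n\<close>, remainder \<open>K - 1\<close> modulo \<open>K\<close>
  marks the old columns and all others are steps. Further right come the remaining steps and then
  the two staircases, told apart by parity.\<close>

lemma px_onto: assumes c: "0 \<le> c" "c < N" shows "\<exists>k\<in>{0..<N}. px k = c"
proof -
  consider "c < K * n" | "K * n \<le> c" "c < R0" | "R0 \<le> c" "even (c - R0)" | "R0 \<le> c" "odd (c - R0)" by linarith
  thus ?thesis
  proof cases
    case 1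
    define m where "m = c div K"
    define r where "r = c mod K"
    have cm: "c = K * m + r" by (simp add: m_def r_def)
    have r: "0 \<le> r" "r < K" using K by (simp_all add: r_def)
    have m0: "0 \<le> m" using c K by (simp add: m_def pos_imp_zdiv_nonneg_iff)
    have "K * m < K * n" using 1 cm r by linarith
    hence m1: "m < n" using K by simp
    show ?thesis
    proof (cases "r = K - 1")
      case True
      obtain l where l: "l \<in> {0..<n}" "x l = m" using x_onto[OF m0 m1] by auto
      hence "px (\<mu> + l) = c" using px_eqs(4)[of l] cm True by simp
      thus ?thesis using l mu_bounds q1 J2 by (intro bexI[of _ "\<mu> + l"]) (auto simp: N_def \<mu>_def)
    next
      case False
      define k where "k = (K - 1) * m + r"
      have kd: "k div (K - 1) = m" using False r K by (simp add: k_def)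
      have "(K - 1) * (m + 1) \<le> (K - 1) * n" using m1 K by (intro mult_left_mono) auto
      hence kq: "k < q" using q r False by (simp add: k_def algebra_simps)
      have k0: "0 \<le> k" using m0 r K by (simp add: k_def)
      have "\<xi> k = c" using kd m1 by (simp add: \<xi>_def cm k_def algebra_simps)
      thus ?thesis using k0 kq px_eqs(1)[of k] mu_bounds by (intro bexI[of _ k]) auto
    qed
  next
    case 2
    define k where "k = c - n"
    have k: "(K - 1) * n \<le> k" "k < q" using 2 by (auto simp: k_def R0_def algebra_simps)
    have "0 \<le> (K - 1) * n" using K n2 by simp
    hence "0 \<le> k" using k by linarith
    moreover have "\<xi> k = c" using xi_large[OF k(1)] by (simp add: k_def)
    ultimately show ?thesis using k(2) px_eqs(1)[of k] mu_bounds by (intro bexI[of _ k]) auto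
  next
    case 3
    then obtain s where s: "c - R0 = 2 * s" by blast
    hence "0 \<le> s" "s < J" using 3 c N_alt by auto
    thus ?thesis using px_eqs(2)[of s] s mu_bounds q1 by (intro bexI[of _ "q + s"]) auto
  next
    case 4
    then obtain s where s: "c - R0 = 2 * s + 1" by (metis oddE)
    hence "0 \<le> J - 1 - s" "J - 1 - s < J" using 4 c N_alt by auto
    thus ?thesis using px_eqs(3)[of "J - 1 - s"] s mu_bounds q1 J2
      by (intro bexI[of _ "q + J + (J - 1 - s)"]) (auto simp: \<mu>_def)
  qed
qed

text \<open>Below \<open>L * \<nu>\<close>, remainder \<open>L - 1\<close> modulo \<open>L\<close>
  marks an old row; any other remainder \<open>r\<close> over quotient \<open>m\<close> belongs to
  pair number \<open>\<kappa> * m + r div 2\<close>.\<close>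

lemma py_onto: assumes c: "0 \<le> c" "c < N" shows "\<exists>k\<in>{0..<N}. py k = c"
proof -
  have pair: "\<exists>k\<in>{0..<N}. py k = \<rho> j + e" if "0 \<le> j" "j < J" "e = 0 \<or> e = 1" for j e
  proof -
    have "py (q + J + j) = \<rho> j" "py (q + (J - 1 - j)) = \<rho> j + 1"
      using py_eqs(3)[of j] py_eqs(2)[of "J - 1 - j"] that by auto
    moreover have "q + J + j \<in> {0..<N}" "q + (J - 1 - j) \<in> {0..<N}" using that q1 mu_bounds by (auto simp: \<mu>_def)
    ultimately show ?thesis using that(3) by fastforce
  qed
  consider "c < L * \<nu>" | "c = L * \<nu>" | "c = L * \<nu> + 1" | "c = Y" | "Y < c" unfolding Y_def by linarith
  thus ?thesis
  proof cases
    case 1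
    have Lp: "0 < L" using lam by (simp add: L_def)
    define m where "m = c div L"
    define r where "r = c mod L"
    have cm: "c = L * m + r" by (simp add: m_def r_def)
    have r: "0 \<le> r" "r < L" using Lp by (simp_all add: r_def)
    have m0: "0 \<le> m" using c Lp by (simp add: m_def pos_imp_zdiv_nonneg_iff)
    have "L * m < L * \<nu>" using 1 cm r by linarith
    hence m1: "m < \<nu>" using Lp by simp
    show ?thesis
    proof (cases "r = L - 1")
      case True
      obtain l where l: "l \<in> {0..<n-1}" "y l = m" using y_onto[OF m0 m1] by auto
      hence "py (\<mu> + l) = c" using py_eqs(4)[of l] cm True by simp
      thus ?thesis using l mu_bounds q1 J2 by (intro bexI[of _ "\<mu> + l"]) (auto simp: N_def \<mu>_def)
    next
      case False
      define j where "j = \<kappa> * m + r div 2"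
      have r2: "0 \<le> r div 2" "r div 2 < \<kappa>" using r False by (auto simp: L_def)
      hence jd: "j div \<kappa> = m" using lam by (simp add: j_def)
      have "\<kappa> * (m + 1) \<le> \<kappa> * \<nu>" using m1 lam by (intro mult_left_mono) auto
      hence "j < J" using r2 by (simp add: j_def J_def algebra_simps)
      moreover have "0 \<le> j" using m0 r2 lam by (simp add: j_def)
      moreover have "c = \<rho> j + r mod 2" using jd by (simp add: \<rho>_def cm j_def L_def algebra_simps)
      moreover have "r mod 2 = 0 \<or> r mod 2 = 1" by presburger
      ultimately show ?thesis using pair[of j "r mod 2"] by metis
    qed
  next
    case 2 thus ?thesis using pair[of "J - 1" 0] rho_top J2 by simp
  next
    case 3 thus ?thesis using pair[of "J - 1" 1] rho_top J2 by simp
  next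
    case 4 thus ?thesis using py_eqs(5) mu_bounds by (intro bexI[of _ "N - 1"]) auto
  next
    case 5
    hence "c - Y \<in> h ` {0..<q}" unfolding h using c N_alt by auto
    then obtain k where k: "k \<in> {0..<q}" "h k = c - Y" by auto
    hence "py k = c" using py_eqs(1)[of k] by simp
    thus ?thesis using k mu_bounds by (intro bexI[of _ k]) auto
  qed
qed

lemma seq': "grid_seq N x' y'"
  unfolding grid_seq_def
proof (intro conjI allI)
  show "2 \<le> N" using mu_bounds J2 q1 by simp
  show "x' (i + N) = x' i" "y' (i + N) = y' i" for i by (rule perx' pery')+
  have "x' ` {0..<N} = px ` {0..<N}" "y' ` {0..<N} = py ` {0..<N}" by (auto simp: x'_eq y'_eq intro!: image_cong)
  moreover have "{0..<N} \<subseteq> px ` {0..<N}" "{0..<N} \<subseteq> py ` {0..<N}" using px_onto py_onto by force+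
  ultimately show "x' ` {0..<N} = {0..<N}" "y' ` {0..<N} = {0..<N}" using perm_image by metis+
qed

section \<open>Crossings of the new diagram\<close>

lemma vert_high: "1 \<le> j \<Longrightarrow> j < q \<Longrightarrow> Y < py (j - 1) \<and> Y < py j"
  using py_eqs(1)[of j] py_eqs(1)[of "j - 1"] h_pos[of j] h_pos[of "j - 1"] by simp

lemma row_cases:
  assumes "0 \<le> i" "i < N"
  obtains "i < q" | s where "i = q + s" "0 \<le> s" "s < J" | t where "i = q + J + t" "0 \<le> t" "t < J"
    | l where "i = \<mu> + l" "0 \<le> l" "l < n - 1" | "i = N - 1"
proof -
  consider "i < q" | "q \<le> i" "i < q + J" | "q + J \<le> i" "i < \<mu>" | "\<mu> \<le> i" "i < N - 1" | "i = N - 1" using assms by linarith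
  thus thesis
  proof cases
    case 2 thus thesis using that(2)[of "i - q"] by simp
  next
    case 3 thus thesis using that(3)[of "i - q - J"] by (simp add: \<mu>_def)
  next
    case 4 thus thesis using that(4)[of "i - \<mu>"] by (simp add: N_def)
  qed (use that in auto)
qed

lemma row_le: "q \<le> i \<Longrightarrow> i < N \<Longrightarrow> py i \<le> Y"
proof -
  assume i: "q \<le> i" "i < N"
  hence "0 \<le> i" using q1 by simp
  thus ?thesis using i(2)
  proof (cases rule: row_cases)
    case (2 s) thus ?thesis using py_eqs(2) rho_less[of "J - 1 - s"] by simp
  next
    case (3 t) thus ?thesis using py_eqs(3) rho_less[of t] by simp
  next
    case (4 l) thus ?thesis using py_eqs(4)[of l] old_row[of l] by (simp add: Y_def)
  qed (use i py_eqs in auto)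
qed

lemma row_less: "q \<le> i \<Longrightarrow> i < N - 1 \<Longrightarrow> py i < Y"
proof -
  assume i: "q \<le> i" "i < N - 1"
  hence "0 \<le> i" "i < N" using q1 by simp_all
  thus ?thesis
  proof (cases rule: row_cases)
    case (2 s) thus ?thesis using py_eqs(2) rho_less[of "J - 1 - s"] by simp
  next
    case (3 t) thus ?thesis using py_eqs(3) rho_less[of t] by simp
  next
    case (4 l) thus ?thesis using py_eqs(4)[of l] old_row[of l] by (simp add: Y_def)
  qed (use i in auto)
qed

lemma finger_col: "q \<le> i \<Longrightarrow> i < \<mu> \<Longrightarrow> R0 \<le> px i"
  using mu_bounds by (auto simp: px_def \<mu>_def)

lemma old_col_le: "\<mu> \<le> i \<Longrightarrow> i \<le> N \<Longrightarrow> px i \<le> Xm"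
proof -
  assume i: "\<mu> \<le> i" "i \<le> N"
  have "i = \<mu> \<or> i = N \<or> i - \<mu> \<in> {1..n-1}" using i unfolding N_def atLeastAtMost_iff by linarith
  then consider "i = \<mu>" | "i = N" | "i - \<mu> \<in> {1..n-1}" by blast
  thus ?thesis
  proof cases
    case 2
    have "0 \<le> K * \<nu>" using K nu by simp
    thus ?thesis using 2 px_eqs(5) K by (simp add: Xm_def)
  next
    case 3
    thus ?thesis using px_eqs(4)[of "i - \<mu>"] old_col[of "i - \<mu>"] by simp
  qed (use px_eqs in simp)
qed

text \<open>The columns of the descent and of the return have different parity, so a horizontal edge
  of one staircase can only pass a column of the other, and only one. There the vertical edge lies
  below a descending edge and above a returning one.\<close>

lemma finger_no_cross:
  assumes i: "q \<le> i" "i < \<mu>" and j: "q \<le> j" "j < \<mu>"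
    and X: "px i < px j \<and> px j < px (i + 1) \<or> px (i + 1) < px j \<and> px j < px i"
    and Y: "py (j - 1) < py i \<and> py i < py j \<or> py j < py i \<and> py i < py (j - 1)"
  shows False
proof (cases "i < q + J")
  case True
  define s where "s = i - q"
  have s: "i = q + s" "0 \<le> s" "s < J" using i True by (auto simp: s_def)
  have pi: "px i = R0 + 2 * s" "py i = \<rho> (J - 1 - s) + 1" using px_eqs(2) py_eqs(2) s by simp_all
  have pi1: "px (i + 1) = (if s < J - 1 then R0 + 2 * s + 2 else R0 + 2 * s + 1)"
  proof (cases "s < J - 1")
    case True thus ?thesis using px_eqs(2)[of "s + 1"] s by (simp add: add.assoc)
  next
    case False
    hence "s = J - 1" using s by simp
    thus ?thesis using px_eqs(3)[of 0] s J2 by simp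
  qed
  show False
  proof (cases "j < q + J")
    case True
    hence "px j = R0 + 2 * (j - q)" using px_eqs(2)[of "j - q"] j by simp
    thus False using X unfolding pi pi1 by (auto split: if_splits; presburger)
  next
    case False
    define t where "t = j - q - J"
    have t: "j = q + J + t" "0 \<le> t" "t < J" using j False by (auto simp: t_def \<mu>_def)
    have pj: "px j = R0 + 2 * (J - t) - 1" "py j = \<rho> t" using px_eqs(3) py_eqs(3) t by simp_all
    have st: "s = J - 1 - t \<and> s < J - 1" using X unfolding pi pi1 pj by (auto split: if_splits)
    hence "py (j - 1) = \<rho> (t - 1)" using py_eqs(3)[of "t - 1"] t by (simp add: algebra_simps)
    moreover have "\<rho> (t - 1) + 2 \<le> \<rho> t" using rho_step[of "t - 1"] by simp
    moreover have "py i = \<rho> t + 1" using pi st by simp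
    ultimately show False using Y pj by auto
  qed
next
  case False
  define t where "t = i - q - J"
  have t: "i = q + J + t" "0 \<le> t" "t < J" using i False by (auto simp: t_def \<mu>_def)
  have pi: "px i = R0 + 2 * (J - t) - 1" "py i = \<rho> t" using px_eqs(3) py_eqs(3) t by simp_all
  have pi1: "px (i + 1) = (if t < J - 1 then R0 + 2 * (J - t) - 3 else Xm)"
  proof (cases "t < J - 1")
    case True thus ?thesis using px_eqs(3)[of "t + 1"] t by (simp add: add.assoc)
  next
    case False
    hence "i + 1 = \<mu>" using t by (simp add: \<mu>_def)
    thus ?thesis using px_eqs(6) False by simp
  qed
  show False
  proof (cases "j < q + J")
    case True
    define s where "s = j - q"
    have s: "j = q + s" "0 \<le> s" "s < J" using j True by (auto simp: s_def)
    have pj: "px j = R0 + 2 * s" "py j = \<rho> (J - 1 - s) + 1" using px_eqs(2) py_eqs(2) s by simp_all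
    have st: "s = J - 1 - t" using X Xm_less unfolding pi pi1 pj using s t by (auto split: if_splits)
    have "\<rho> t < py (j - 1)"
    \<comment> \<open>Column \<open>R0\<close> is entered from the last step above row
      \<open>Y\<close>, not from within the staircase.\<close>
    proof (cases "s = 0")
      case True
      hence "j - 1 = q - 1" using s by simp
      hence "Y < py (j - 1)" using py_eqs(1)[of "q - 1"] h_pos[of "q - 1"] q1 by simp
      thus ?thesis using rho_less[OF t(3)] by (simp add: local.Y_def)
    next
      case False
      hence "py (j - 1) = \<rho> (J - s) + 1" using py_eqs(2)[of "s - 1"] s by (simp add: algebra_simps)
      thus ?thesis using rho_mono[of t "J - s"] st by simp
    qed
    moreover have "\<rho> t < py j" using pj st by simp
    ultimately show False using Y pi by auto
  next
    case False
    define t' where "t' = j - q - J"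
    have t': "j = q + J + t'" "0 \<le> t'" "t' < J" using j False by (auto simp: t'_def \<mu>_def)
    have "px j = R0 + 2 * (J - t') - 1" using px_eqs(3) t' by simp
    thus False using X Xm_less t t' unfolding pi pi1 by (auto split: if_splits)
  qed
qed

text \<open>The step function is monotone and stays above row \<open>Y\<close>, the staircases lie
  right of column \<open>Xm\<close>, and the kept part is bounded by \<open>Y\<close> and
  \<open>Xm\<close>. So the pieces are separated from each other by rows or by columns.\<close>

lemma cross_range:
  assumes ij: "0 \<le> i" "i < N" "0 \<le> j" "j < N" and c: "cross x' y' i j"
  shows "\<mu> \<le> i \<and> i < N - 1 \<and> \<mu> < j"
proof -
  have X: "px i < px j \<and> px j < px (i + 1) \<or> px (i + 1) < px j \<and> px j < px i"
    and V: "py (j - 1) < py i \<and> py i < py j \<or> py j < py i \<and> py i < py (j - 1)"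
    using c ij x'_eq[of i] x'_eq[of "i + 1"] x'_eq[of j] y'_eq[of i] y'_eq[of j] y'_eq[of "j - 1"] by (simp_all add: cross_def)
  have low: "py (j - 1) \<le> Y \<and> py j \<le> Y" if "q < j" using row_le[of j] row_le[of "j - 1"] that ij by simp
  have j0: "j < q \<Longrightarrow> Y \<le> py (j - 1) \<and> Y \<le> py j"
    using vert_high[of j] ij py_eqs(1)[of 0] py_eqs(6) h_pos[of 0] q1 by (cases "j = 0") auto
  consider "i < q" | "i = N - 1" | "q \<le> i" "i < \<mu>" | "\<mu> \<le> i" "i < N - 1" using ij by linarith
  thus ?thesis
  proof cases
    case 1
    hence r: "Y < py i" using py_eqs(1)[of i] h_pos[of i] ij by simp
    hence "\<not> q < j" using low V by auto
    hence "\<xi> i < \<xi> j \<and> \<xi> j < \<xi> (i + 1)" using X px_eqs(1)[of j] px_eqs(1)[of i] px_eqs(1)[of "i + 1"] 1 ij xi_step[of i] by auto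
    moreover have "\<xi> j \<le> \<xi> i \<or> \<xi> (i + 1) \<le> \<xi> j" using xi_mono[of j i] xi_mono[of "i + 1" j] by linarith
    ultimately show ?thesis by linarith
  next
    case 2
    have r: "py i = Y" using 2 py_eqs(5) by simp
    \<comment> \<open>Only the vertical edge that comes down from the step function passes through
      row \<open>Y\<close>, and it stands to the right of the top edge.\<close>
    have "j = q" 
    proof (rule ccontr)
      assume "j \<noteq> q"
      then consider "j < q" | "q < j" by linarith
      thus False using j0 low V r by cases auto
    qed
    hence "px j = R0" using px_eqs(1)[of q] xi_q q1 by simp
    moreover have "px i \<le> Xm" "px (i + 1) \<le> Xm" using old_col_le[of i] old_col_le[of "i + 1"] 2 mu_bounds by auto
    ultimately show ?thesis using X Xm_less by linarith
  next
    case 3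
    have r: "py i < Y" using row_less 3 mu_bounds by simp
    have "\<not> j < q" using j0 V r by auto
    moreover have "\<not> \<mu> \<le> j"
    proof
      assume "\<mu> \<le> j"
      hence "px j \<le> Xm" using old_col_le[of j] ij by simp
      moreover have "Xm < px i" using finger_col 3 Xm_less by fastforce
      moreover have "Xm \<le> px (i + 1)" using finger_col[of "i + 1"] 3 Xm_less px_eqs(6) by (cases "i + 1 = \<mu>") auto
      ultimately show False using X by linarith
    qed
    ultimately show ?thesis using finger_no_cross[OF 3 _ _ X V] by simp
  next
    case 4
    have r: "py i < Y" using row_less 4 mu_bounds by simp
    have "\<not> j < q" using j0 V r by auto
    moreover have le: "px i \<le> Xm" "px (i + 1) \<le> Xm" using old_col_le[of i] old_col_le[of "i + 1"] 4 by auto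
    have "\<not> j \<le> \<mu>"
    proof
      assume "j \<le> \<mu>"
      hence "Xm \<le> px j" using finger_col[of j] \<open>\<not> j < q\<close> Xm_less px_eqs(6) by (cases "j = \<mu>") auto
      thus False using X le by linarith
    qed
    thus ?thesis using 4 by simp
  qed
qed

lemma x'_old: "0 \<le> l \<Longrightarrow> l < n \<Longrightarrow> x' (\<mu> + l) = K * x l + K - 1"
  using x'_eq[of "\<mu> + l"] px_eqs(4)[of l] mu_bounds q1 by (simp add: N_def)

lemma y'_old: "0 \<le> l \<Longrightarrow> l < n - 1 \<Longrightarrow> y' (\<mu> + l) = L * y l + L - 1"
  using y'_eq[of "\<mu> + l"] py_eqs(4)[of l] mu_bounds q1 by (simp add: N_def)

lemma y'_top: "y' (N - 1) = Y" using y'_eq[of "N - 1"] py_eqs(5) mu_bounds by simp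

text \<open>Kept rows and columns retain their order; the top row is the only one not moved by the
  common affine map, and it stays on top.\<close>

lemma cross_old:
  assumes l: "0 \<le> l" "l < n - 1" "0 < m" "m < n" and c: "cross x' y' (\<mu> + l) (\<mu> + m)"
  shows "cross x y l m"
proof -
  have X: "x' (\<mu> + l) = K * x l + K - 1" "x' (\<mu> + m) = K * x m + K - 1" "x' (\<mu> + l + 1) = K * x (l + 1) + K - 1"
    using x'_old[of l] x'_old[of m] x'_old[of "l + 1"] l by (simp_all add: add.assoc)
  have Kl: "K * a < K * b \<longleftrightarrow> a < b" for a b using K by simp
  have Lp: "0 < L" using lam by (simp add: L_def)
  hence Ll: "L * a < L * b \<longleftrightarrow> a < b" for a b by simp
  have Yl: "y' (\<mu> + l) = L * y l + L - 1" "y' (\<mu> + m - 1) = L * y (m - 1) + L - 1"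
    using y'_old[of l] y'_old[of "m - 1"] l by (simp_all add: add_diff_eq)
  have top: "y' (\<mu> + m) < y' (\<mu> + l) \<longleftrightarrow> y m < y l" "y' (\<mu> + l) < y' (\<mu> + m) \<longleftrightarrow> y l < y m"
  proof -
    have "(y' (\<mu> + m) < y' (\<mu> + l) \<longleftrightarrow> y m < y l) \<and> (y' (\<mu> + l) < y' (\<mu> + m) \<longleftrightarrow> y l < y m)"
    proof (cases "m = n - 1")
      case True
      have "y' (\<mu> + m) = Y" using y'_top True by (simp add: N_def add_diff_eq)
      moreover have "L * y l + L - 1 < Y" using old_row[of l] l by (simp add: Y_def)
      moreover have "y l < y m" using y_lt[of l] l True corner by (simp add: \<nu>_def)
      ultimately show ?thesis using Yl by auto
    next
      case False
      hence "y' (\<mu> + m) = L * y m + L - 1" using y'_old[of m] l by simp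
      thus ?thesis using Yl Ll by auto
    qed
    thus "y' (\<mu> + m) < y' (\<mu> + l) \<longleftrightarrow> y m < y l" "y' (\<mu> + l) < y' (\<mu> + m) \<longleftrightarrow> y l < y m" by auto
  qed
  show ?thesis using c unfolding cross_def X top by (simp add: Yl Kl Ll)
qed

lemma cross':
  assumes c: "cross x' y' i j"
  obtains l m where "0 \<le> l" "l < n - 1" "0 < m" "m < n" "i mod N = \<mu> + l" "j mod N = \<mu> + m" "cross x y l m"
proof -
  have sx: "x' (k mod N + e) = x' (k + e)" and sy: "y' (k mod N + e) = y' (k + e)" for k e
    by (simp_all add: x'_def y'_def mod_add_left_eq)
  have c': "cross x' y' (i mod N) (j mod N)"
    using c sx[of i 0] sx[of i 1] sx[of j 0] sy[of i 0] sy[of j 0] sy[of j "-1"] by (simp add: cross_def)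
  have r: "0 \<le> i mod N" "i mod N < N" "0 \<le> j mod N" "j mod N < N" using mu_bounds by simp_all
  define l where "l = i mod N - \<mu>"
  define m where "m = j mod N - \<mu>"
  have lm: "0 \<le> l" "l < n - 1" "0 < m" "m < n" using cross_range[OF r c'] r(4) N_def unfolding l_def m_def by linarith+
  moreover have "cross x y l m" by (rule cross_old[OF lm]) (use c' in \<open>simp add: l_def m_def\<close>)
  ultimately show thesis by (intro that[of l m]) (simp_all add: l_def m_def)
qed

lemma heights_old:
  assumes h: "heights x y z" and h': "heights x' y' z'" and "0 \<le> l" "l < n"
  shows "z' (\<mu> + l) = K * L * z l + (L - 1) * K * x l + (z' \<mu> - K * L * z 0 - (L - 1) * K * x 0)"
  using assms(3,4)
proof (induction l rule: int_ge_induct)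
  case (step l)
  have "z' (\<mu> + (l + 1)) = z' (\<mu> + l) + y' (\<mu> + l) * (x' (\<mu> + (l + 1)) - x' (\<mu> + l))"
    using h'[unfolded heights_def, rule_format, of "\<mu> + l"] by (simp add: add.assoc)
  also have "\<dots> = z' (\<mu> + l) + (L * y l + L - 1) * (K * (x (l + 1) - x l))"
    using x'_old[of l] x'_old[of "l + 1"] y'_old[of l] step by (simp add: right_diff_distrib)
  also have "z' (\<mu> + l) = K * L * z l + (L - 1) * K * x l + (z' \<mu> - K * L * z 0 - (L - 1) * K * x 0)"
    using step by simp
  finally show ?case unfolding h[unfolded heights_def, rule_format, of l] by (simp add: algebra_simps)
qed simp

text \<open>The multiples of the column that the row shift adds to the heights in
  \<open>heights_old\<close> cancel at a crossing, and the factor \<open>K * L\<close>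
  remains.\<close>

lemma crossing_scaled:
  assumes h: "heights x y z" and h': "heights x' y' z'" and pz: "\<And>i. z' (i + N) = z' i"
    and c: "cross x' y' i j"
  obtains l m where "cross x y l m" "z' i + y' i * (x' j - x' i) - z' j = K * L * (z l + y l * (x m - x l) - z m)"
proof (rule cross'[OF c])
  fix l m assume lm: "0 \<le> l" "l < n - 1" "0 < m" "m < n" "i mod N = \<mu> + l" "j mod N = \<mu> + m" "cross x y l m"
  have e: "z' i = z' (\<mu> + l)" "z' j = z' (\<mu> + m)" "x' i = x' (\<mu> + l)" "x' j = x' (\<mu> + m)" "y' i = y' (\<mu> + l)"
    using periodic_mod[of z' N] periodic_mod[of x' N] periodic_mod[of y' N] pz perx' pery' lm by metis+
  have "z' i + y' i * (x' j - x' i) - z' j = K * L * (z l + y l * (x m - x l) - z m)"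
  proof -
    have l': "l < n" "0 \<le> m" using lm by auto
    show ?thesis
      unfolding e heights_old[OF h h' lm(1) l'(1)] heights_old[OF h h' l'(2) lm(4)] x'_old[OF lm(1) l'(1)] x'_old[OF l'(2) lm(4)]
        y'_old[OF lm(1,2)] by (simp add: algebra_simps)
  qed
  thus thesis by (rule that[OF lm(7)])
qed

end

section \<open>Rotation number and total area of the new diagram\<close>

lemma sum_int_split:
  fixes f :: "int \<Rightarrow> 'a::comm_monoid_add"
  assumes "a \<le> b" "b \<le> c" shows "sum f {a..<c} = sum f {a..<b} + sum f {b..<c}"
  using assms by (metis ivl_disj_int_two(3) ivl_disj_un_two(3) finite_atLeastLessThan_int sum.union_disjoint)

lemma sum_int_telescope:
  fixes f :: "int \<Rightarrow> int"
  assumes "a \<le> b" shows "(\<Sum>i\<in>{a..<b}. f (i + 1) - f i) = f b - f a"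
  using assms
proof (induction b rule: int_ge_induct)
  case (step b)
  have "{a..<b + 1} = insert b {a..<b}" using step by auto
  thus ?case using step by simp
qed simp

lemma sum_int_shift:
  fixes f :: "int \<Rightarrow> 'a::comm_monoid_add"
  shows "(\<Sum>i\<in>{a + c..<b + c}. f i) = (\<Sum>i\<in>{a..<b}. f (c + i))"
  by (rule sum.reindex_bij_witness[of _ "\<lambda>i. c + i" "\<lambda>i. i - c"]) auto

context corner_path
begin

lemma sgn_old: "0 \<le> l \<Longrightarrow> l < n - 1 \<Longrightarrow> sgn (x' (\<mu> + l + 1) - x' (\<mu> + l)) = sgn (x (l + 1) - x l)"
proof -
  assume l: "0 \<le> l" "l < n - 1"
  have "x' (\<mu> + l + 1) - x' (\<mu> + l) = K * (x (l + 1) - x l)"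
    using x'_old[of l] x'_old[of "l + 1"] l by (simp add: add.assoc right_diff_distrib)
  thus ?thesis using K by (simp add: sgn_mult)
qed

lemma sgn_old_y: "1 \<le> l \<Longrightarrow> l < n \<Longrightarrow> sgn (y' (\<mu> + l) - y' (\<mu> + l - 1)) = sgn (y l - y (l - 1))"
proof -
  assume l: "1 \<le> l" "l < n"
  have 1: "y' (\<mu> + l - 1) = L * y (l - 1) + L - 1" using y'_old[of "l - 1"] l by (simp add: add_diff_eq)
  show ?thesis
  proof (cases "l = n - 1")
    case True
    have "y' (\<mu> + l) = Y" using y'_top True by (simp add: N_def add_diff_eq)
    moreover have "L * y (l - 1) + L - 1 < Y" "y (l - 1) < y l"
      using old_row[of "l - 1"] y_lt[of "l - 1"] True l corner by (auto simp: Y_def \<nu>_def)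
    ultimately show ?thesis using 1 by simp
  next
    case False
    hence "y' (\<mu> + l) - y' (\<mu> + l - 1) = L * (y l - y (l - 1))"
      using y'_old[of l] 1 l by (simp add: right_diff_distrib)
    thus ?thesis using lam by (simp add: sgn_mult L_def)
  qed
qed

text \<open>Wherever the horizontal direction \<open>s\<close> is constant the sum telescopes. The
  path runs right along the steps and the descent and left along the return, so only the vertical
  directions at its ends and at the turning point count; they give exactly the old terms with
  indices 0 and \<open>n - 1\<close>.\<close>

lemma rotation_same: "rot_seq N x' y' = rot_seq n x y"
proof -
  define s where "s i = sgn (x' (i + 1) - x' i)" for i
  define \<tau> where "\<tau> i = sgn (y' i - y' (i - 1))" for i
  define s0 where "s0 i = sgn (x (i + 1) - x i)" for i
  define \<tau>0 where "\<tau>0 i = sgn (y i - y (i - 1))" for i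
  have new: "rot_seq N x' y' = (\<Sum>i\<in>{0..<N}. s i * (\<tau> (i + 1) - \<tau> i))"
    and old: "rot_seq n x y = (\<Sum>i\<in>{0..<n}. s0 i * (\<tau>0 (i + 1) - \<tau>0 i))"
    by (simp_all add: rot_seq_def s_def \<tau>_def s0_def \<tau>0_def)
  have right: "s i = 1" if i: "0 \<le> i" "i < q + J" for i
  proof -
    have "px i < px (i + 1)"
    proof (cases "i < q")
      case True thus ?thesis using px_eqs(1)[of i] px_eqs(1)[of "i + 1"] xi_step[of i] i by simp
    next
      case False
      define t where "t = i - q"
      have t: "i = q + t" "0 \<le> t" "t < J" using False i by (auto simp: t_def)
      show ?thesis
      proof (cases "t < J - 1")
        case True
        thus ?thesis using px_eqs(2)[of t] px_eqs(2)[of "t + 1"] t by (simp add: add.assoc)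
      next
        case False
        hence "i + 1 = q + J + 0" "t = J - 1" using t by auto
        thus ?thesis using px_eqs(2)[of t] px_eqs(3)[of 0] t J2 by simp
      qed
    qed
    thus ?thesis using x'_eq[of i] x'_eq[of "i + 1"] i mu_bounds by (simp add: s_def)
  qed
  have left: "s i = -1" if i: "q + J \<le> i" "i < \<mu> + 1" for i
  proof (cases "i = \<mu>")
    case True
    have "x 1 < x 0" using x_lt[of 1] n2 corner by (simp add: \<nu>_def)
    thus ?thesis using sgn_old[of 0] n2 True by (simp add: s_def)
  next
    case False
    define t where "t = i - q - J"
    have t: "i = q + J + t" "0 \<le> t" "t < J" using False i by (auto simp: t_def \<mu>_def)
    have "px (i + 1) < px i"
    proof (cases "t < J - 1")
      case True
      thus ?thesis using px_eqs(3)[of t] px_eqs(3)[of "t + 1"] t by (simp add: add.assoc)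
    next
      case False
      hence "i + 1 = \<mu>" using t by (simp add: \<mu>_def)
      thus ?thesis using px_eqs(3)[of t] px_eqs(6) t Xm_less by simp
    qed
    thus ?thesis using x'_eq[of i] x'_eq[of "i + 1"] t q1 J2 mu_bounds False i by (simp add: s_def)
  qed
  have t0: "\<tau> 0 = 1"
    using y'_eq[of 0] y'_eq[of "-1"] py_eqs(1)[of 0] py_eqs(6) h_pos[of 0] q1 mu_bounds by (simp add: \<tau>_def)
  have tN: "\<tau> N = 1"
  proof -
    have "y' N = y' 0" "y' (N - 1) = y' (-1)" using pery'[of 0] pery'[of "-1"] by simp_all
    thus ?thesis using t0 by (simp add: \<tau>_def)
  qed
  have tm: "\<tau> (q + J) = -1"
  proof -
    have "py (q + J) = \<rho> 0" "py (q + (J - 1)) = \<rho> 0 + 1" using py_eqs(3)[of 0] py_eqs(2)[of "J - 1"] J2 by auto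
    thus ?thesis using y'_eq[of "q + J"] y'_eq[of "q + (J - 1)"] q1 J2 mu_bounds by (simp add: \<tau>_def algebra_simps)
  qed
  have tl: "\<tau> (\<mu> + l) = \<tau>0 l" if "1 \<le> l" "l < n" for l
    using sgn_old_y[OF that] by (simp add: \<tau>_def \<tau>0_def)
  have sl: "s (\<mu> + l) = s0 l" if "0 \<le> l" "l < n - 1" for l
    using sgn_old[OF that] by (simp add: s_def s0_def)
  have last: "s (N - 1) = -1"
  proof -
    have "x' N = 0" using x'_eq[of N] px_eqs(5) mu_bounds by simp
    moreover have "0 < x' (N - 1)" 
    proof -
      have "0 \<le> K * x (n - 1)" using x_ge[of "n - 1"] K by simp
      moreover have "x' (N - 1) = K * x (n - 1) + K - 1" using x'_old[of "n - 1"] n2 by (simp add: N_def algebra_simps)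
      ultimately show ?thesis using K by linarith
    qed
    ultimately show ?thesis by (simp add: s_def)
  qed
  have top0: "\<tau>0 (n - 1) = 1" "\<tau>0 0 = -1" "\<tau>0 n = -1" "s0 0 = -1" "s0 (n - 1) = 1" "\<tau> (N - 1) = 1"
  proof -
    show 1: "\<tau>0 (n - 1) = 1" using y_lt[of "n - 2"] n2 corner by (simp add: \<tau>0_def \<nu>_def)
    show "\<tau>0 0 = -1" using y_lt[of 0] n2 corner pery[of "-1"] by (simp add: \<tau>0_def \<nu>_def)
    show "\<tau>0 n = -1" using y_lt[of 0] n2 corner pery[of 0] by (simp add: \<tau>0_def \<nu>_def)
    show "s0 0 = -1" using x_lt[of 1] n2 corner by (simp add: s0_def \<nu>_def)
    show "s0 (n - 1) = 1" using x_lt[of "n - 1"] n2 corner perx[of 0] by (simp add: s0_def \<nu>_def)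
    show "\<tau> (N - 1) = 1" using tl[of "n - 1"] n2 1 by (simp add: N_def algebra_simps)
  qed
  have A: "(\<Sum>i\<in>{0..<q + J}. s i * (\<tau> (i + 1) - \<tau> i)) = -2"
  proof -
    have "(\<Sum>i\<in>{0..<q + J}. s i * (\<tau> (i + 1) - \<tau> i)) = (\<Sum>i\<in>{0..<q + J}. \<tau> (i + 1) - \<tau> i)"
      by (rule sum.cong) (use right in auto)
    thus ?thesis using sum_int_telescope[of 0 "q + J" \<tau>] q1 J2 t0 tm by simp
  qed
  have B: "(\<Sum>i\<in>{q + J..<\<mu> + 1}. s i * (\<tau> (i + 1) - \<tau> i)) = - (\<tau>0 1 + 1)"
  proof -
    have "(\<Sum>i\<in>{q + J..<\<mu> + 1}. s i * (\<tau> (i + 1) - \<tau> i)) = (\<Sum>i\<in>{q + J..<\<mu> + 1}. - (\<tau> (i + 1) - \<tau> i))"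
      by (rule sum.cong) (use left in auto)
    also have "\<dots> = - (\<tau> (\<mu> + 1) - \<tau> (q + J))"
      using sum_int_telescope[of "q + J" "\<mu> + 1" \<tau>] mu_bounds unfolding sum_negf by simp
    finally show ?thesis using tl[of 1] n2 tm by simp
  qed
  have C: "(\<Sum>i\<in>{\<mu> + 1..<N - 1}. s i * (\<tau> (i + 1) - \<tau> i)) = (\<Sum>i\<in>{1..<n - 1}. s0 i * (\<tau>0 (i + 1) - \<tau>0 i))"
  proof -
    have e: "{\<mu> + 1..<N - 1} = {1 + \<mu>..<(n - 1) + \<mu>}" by (auto simp: N_def)
    show ?thesis unfolding e sum_int_shift
    proof (rule sum.cong)
      fix l assume "l \<in> {1..<n - 1}"
      thus "s (\<mu> + l) * (\<tau> (\<mu> + l + 1) - \<tau> (\<mu> + l)) = s0 l * (\<tau>0 (l + 1) - \<tau>0 l)"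
        using sl[of l] tl[of l] tl[of "l + 1"] by (simp add: add.assoc)
    qed simp
  qed
  have "rot_seq N x' y' = -2 - (\<tau>0 1 + 1) + (\<Sum>i\<in>{1..<n - 1}. s0 i * (\<tau>0 (i + 1) - \<tau>0 i)) + s (N - 1) * (\<tau> N - \<tau> (N - 1))"
  proof -
    have N1: "\<mu> + 1 \<le> N - 1" using n2 by (simp add: N_def)
    have "{N - 1..<N} = {N - 1}" by auto
    thus ?thesis unfolding new
      using sum_int_split[of 0 "q + J" N "\<lambda>i. s i * (\<tau> (i + 1) - \<tau> i)"] sum_int_split[of "q + J" "\<mu> + 1" N "\<lambda>i. s i * (\<tau> (i + 1) - \<tau> i)"]
        sum_int_split[of "\<mu> + 1" "N - 1" N "\<lambda>i. s i * (\<tau> (i + 1) - \<tau> i)"] A B C mu_bounds q1 J2 N1 by simp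
  qed
  also have "\<dots> = -2 - (\<tau>0 1 + 1) + (\<Sum>i\<in>{1..<n - 1}. s0 i * (\<tau>0 (i + 1) - \<tau>0 i))"
    using tN top0 by simp
  also have "\<dots> = rot_seq n x y"
  proof -
    have "{n - 1..<n} = {n - 1}" "{0..<1} = {0::int}" by auto
    thus ?thesis unfolding old
      using sum_int_split[of 0 1 n "\<lambda>i. s0 i * (\<tau>0 (i + 1) - \<tau>0 i)"] sum_int_split[of 1 "n - 1" n "\<lambda>i. s0 i * (\<tau>0 (i + 1) - \<tau>0 i)"]
        n2 top0 by simp
  qed
  finally show ?thesis .
qed

definition "\<Sigma> = (\<Sum>k\<in>{0..<q}. h k * (\<xi> (k + 1) - \<xi> k))"

text \<open>The products of \<open>\<kappa>\<close> and \<open>q\<close> cancel: what the step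
  function gains by standing on row \<open>Y\<close> is lost again on the last returning edge, which
  runs at height \<open>L * \<nu>\<close> over almost the same columns. So the coefficient of
  \<open>\<kappa>\<close> does not involve \<open>q\<close>.\<close>

lemma area:
  assumes old: "(\<Sum>i\<in>{0..<n}. y i * (x (i + 1) - x i)) = 0"
  shows "(\<Sum>i\<in>{0..<N}. y' i * (x' (i + 1) - x' i)) =
    \<Sigma> + 2 * (q + \<nu> - K * \<nu> - K + 1) + \<nu> + 3 + 2 * K * (\<nu> - x (n - 1)) - 2 * \<kappa> * (K * (\<nu> - x (n - 1)) - 2 * \<nu>)"
proof -
  define f where "f i = py i * (px (i + 1) - px i)" for i
  define a where "a = x (n - 1)"
  have fe: "(\<Sum>i\<in>{0..<N}. y' i * (x' (i + 1) - x' i)) = sum f {0..<N}"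
    by (rule sum.cong) (auto simp: f_def x'_eq y'_eq)
  have A: "sum f {0..<q} = \<Sigma> + Y * R0"
  proof -
    have "sum f {0..<q} = (\<Sum>k\<in>{0..<q}. h k * (\<xi> (k + 1) - \<xi> k) + Y * (\<xi> (k + 1) - \<xi> k))"
      by (rule sum.cong) (auto simp: f_def px_eqs(1) py_eqs(1) algebra_simps)
    also have "\<dots> = \<Sigma> + Y * (\<Sum>k\<in>{0..<q}. \<xi> (k + 1) - \<xi> k)"
      by (simp add: sum.distrib \<Sigma>_def sum_distrib_left)
    finally show ?thesis using sum_int_telescope[of 0 q \<xi>] q1 xi_0 xi_q by simp
  qed
  have B: "sum f {q..<q + J} = (\<Sum>t\<in>{0..<J}. (\<rho> t + 1) * 2) - 1"
  proof -
    \<comment> \<open>The last edge of the descent has length 1 instead of 2, because it leads into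
      the return; under this reindexing it is \<open>t = 0\<close>.\<close>
    have "sum f {q..<q + J} = (\<Sum>t\<in>{0..<J}. (\<rho> t + 1) * (2 - (if t = 0 then 1 else 0)))"
    proof (rule sum.reindex_bij_witness[of _ "\<lambda>t. q + (J - 1 - t)" "\<lambda>i. J - 1 - (i - q)"])
      fix i assume i: "i \<in> {q..<q + J}"
      define s where "s = i - q"
      have s: "i = q + s" "0 \<le> s" "s < J" using i by (auto simp: s_def)
      show "(\<rho> (J - 1 - (i - q)) + 1) * (2 - (if J - 1 - (i - q) = 0 then 1 else 0)) = f i"
      proof (cases "s = J - 1")
        case True
        hence "i + 1 = q + J + 0" using s by simp
        thus ?thesis using px_eqs(2)[of s] px_eqs(3)[of 0] py_eqs(2)[of s] s True J2 by (simp add: f_def)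
      next
        case False
        thus ?thesis using px_eqs(2)[of s] px_eqs(2)[of "s + 1"] py_eqs(2)[of s] s by (simp add: f_def add.assoc)
      qed
    qed auto
    also have "\<dots> = (\<Sum>t\<in>{0..<J}. (\<rho> t + 1) * 2 - (if t = 0 then 1 else 0))"
      by (rule sum.cong) (auto simp: rho_0)
    also have "\<dots> = (\<Sum>t\<in>{0..<J}. (\<rho> t + 1) * 2) - 1"
      using J2 by (simp add: sum_subtractf)
    finally show ?thesis .
  qed
  have C: "sum f {q + J..<\<mu>} = (\<Sum>t\<in>{0..<J}. \<rho> t * (-2)) - L * \<nu> * (R0 - 1 - Xm)"
  proof -
    have e: "{q + J..<\<mu>} = {0 + (q + J)..<J + (q + J)}" by (auto simp: \<mu>_def)
    \<comment> \<open>The last returning edge does not end after 2 columns but continues to the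
      corner column \<open>Xm\<close>.\<close>
    have "sum f {q + J..<\<mu>} = (\<Sum>t\<in>{0..<J}. \<rho> t * (-2) - (if t = J - 1 then L * \<nu> * (R0 - 1 - Xm) else 0))"
      unfolding e sum_int_shift
    proof (rule sum.cong)
      fix t assume "t \<in> {0..<J}"
      hence t: "0 \<le> t" "t < J" by auto
      show "f (q + J + t) = \<rho> t * (-2) - (if t = J - 1 then L * \<nu> * (R0 - 1 - Xm) else 0)"
      proof (cases "t = J - 1")
        case True
        hence p: "q + J + t + 1 = \<mu>" by (simp add: \<mu>_def)
        have r: "\<rho> t = L * \<nu>" using rho_top True by simp
        have jt: "J - t = 1" using True by simp
        show ?thesis unfolding f_def p px_eqs(3)[OF t] px_eqs(6) py_eqs(3)[OF t] r jt
          using True by (simp add: algebra_simps)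
      next
        case False
        thus ?thesis using px_eqs(3)[OF t] px_eqs(3)[of "t + 1"] py_eqs(3)[OF t] t by (simp add: f_def add.assoc)
      qed
    qed simp
    thus ?thesis using J2 by (simp add: sum_subtractf)
  qed
  have D: "sum f {\<mu>..<N - 1} = K * L * (- \<nu> * (\<nu> - a)) + (L - 1) * K * (a - \<nu>)"
  proof -
    have e: "{\<mu>..<N - 1} = {0 + \<mu>..<(n - 1) + \<mu>}" by (auto simp: N_def)
    have "sum f {\<mu>..<N - 1} = (\<Sum>l\<in>{0..<n - 1}. K * L * (y l * (x (l + 1) - x l)) + (L - 1) * K * (x (l + 1) - x l))"
      unfolding e sum_int_shift
    proof (rule sum.cong)
      fix l assume "l \<in> {0..<n - 1}"
      thus "f (\<mu> + l) = K * L * (y l * (x (l + 1) - x l)) + (L - 1) * K * (x (l + 1) - x l)"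
        using px_eqs(4)[of l] px_eqs(4)[of "l + 1"] py_eqs(4)[of l] by (simp add: f_def add.assoc) (simp add: algebra_simps)
    qed simp
    also have "\<dots> = K * L * (\<Sum>l\<in>{0..<n - 1}. y l * (x (l + 1) - x l)) + (L - 1) * K * (\<Sum>l\<in>{0..<n - 1}. x (l + 1) - x l)"
      by (simp add: sum.distrib sum_distrib_left)
    also have "(\<Sum>l\<in>{0..<n - 1}. x (l + 1) - x l) = a - \<nu>"
      using sum_int_telescope[of 0 "n - 1" x] n2 corner by (simp add: a_def \<nu>_def)
    also have "(\<Sum>l\<in>{0..<n - 1}. y l * (x (l + 1) - x l)) = - \<nu> * (\<nu> - a)"
    proof -
      have "{n - 1..<n} = {n - 1}" by auto
      hence "(\<Sum>l\<in>{0..<n - 1}. y l * (x (l + 1) - x l)) + \<nu> * (\<nu> - a) = 0"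
        using sum_int_split[of 0 "n - 1" n "\<lambda>i. y i * (x (i + 1) - x i)"] old n2 corner perx[of 0]
        by (simp add: a_def \<nu>_def)
      thus ?thesis unfolding mult_minus_left by linarith
    qed
    finally show ?thesis .
  qed
  have E: "f (N - 1) = - Y * (K * a + K - 1)"
  proof -
    have p: "px (N - 1) = K * a + K - 1" using px_eqs(4)[of "n - 1"] n2 by (simp add: a_def N_def algebra_simps)
    show ?thesis using px_eqs(5) py_eqs(5) by (simp add: f_def p) (simp add: algebra_simps)
  qed
  \<comment> \<open>Descent and return use adjacent rows over steps of equal width, so of their
    areas only 2 per pair survives.\<close>
  have BC: "(\<Sum>t\<in>{0..<J}. (\<rho> t + 1) * 2) + (\<Sum>t\<in>{0..<J}. \<rho> t * (-2)) = 2 * J"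
    using J2 by (simp add: sum.distrib[symmetric] algebra_simps)
  have s1: "{N - 1..<N} = {N - 1}" by auto
  have "sum f {0..<N} = sum f {0..<q} + sum f {q..<q + J} + sum f {q + J..<\<mu>} + sum f {\<mu>..<N - 1} + f (N - 1)"
    using sum_int_split[of 0 q N f] sum_int_split[of q "q + J" N f] sum_int_split[of "q + J" \<mu> N f]
      sum_int_split[of \<mu> "N - 1" N f] mu_bounds q1 s1 by simp
  also have "\<dots> = \<Sigma> + Y * R0 + 2 * J - 1 - L * \<nu> * (R0 - 1 - Xm) + K * L * (- \<nu> * (\<nu> - a)) + (L - 1) * K * (a - \<nu>) - Y * (K * a + K - 1)"
    unfolding A B C D E using BC by linarith
  also have "\<dots> = \<Sigma> + 2 * (q + \<nu> - K * \<nu> - K + 1) + \<nu> + 3 + 2 * K * (\<nu> - a) - 2 * \<kappa> * (K * (\<nu> - a) - 2 * \<nu>)"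
  proof -
    have r: "R0 = q + \<nu> + 1" by (simp add: R0_def \<nu>_def)
    show ?thesis unfolding Y_def J_def L_def Xm_def r by (simp add: algebra_simps)
  qed
  finally show ?thesis unfolding fe a_def .
qed

end

section \<open>The hypotheses of the corner move for the new diagram\<close>

context corner_path
begin

text \<open>This supplies \<open>above\<close>: over the corner column the path has only its own
  final edge and points of the step function. The staircases lie strictly to the right, and all
  other vertical edges use other columns.\<close>

lemma mid_edges:
  assumes u: "u \<in> {-1..2 * real_of_int \<mu> - 1}" and X: "pl (cx (half x')) u = half x' \<mu>"
  shows "u = 2 * of_int \<mu> - 1 \<or> half y' (\<mu> - 1) < pl (cy (half y')) u"
proof (cases u rule: edge_cases)
  case (1 i)
  hence i: "0 \<le> i" "i < \<mu>" using u by auto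
  have py: "pl (cy (half y')) u = half y' i" using pl_horizontal(2)[of i u] 1 by simp
  have y\<mu>: "y' (\<mu> - 1) = L * \<nu>"
    using y'_eq[of "\<mu> - 1"] py_eqs(3)[of "J - 1"] rho_top mu_bounds J2 q1 by (simp add: \<mu>_def algebra_simps)
  show ?thesis
  proof (cases "i < q")
    case True
    hence "y' i = Y + h i" using y'_eq[of i] py_eqs(1)[of i] i mu_bounds by simp
    thus ?thesis using y\<mu> h_pos[of i] i True unfolding py by (simp add: half_def Y_def)
  next
    case False
    have "Xm < x' i" using finger_col[of i] Xm_less x'_eq[of i] i False mu_bounds by simp
    moreover have "Xm \<le> x' (i + 1)"
      using finger_col[of "i + 1"] Xm_less x'_eq[of "i + 1"] px_eqs(6) i False mu_bounds by (cases "i + 1 = \<mu>") auto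
    moreover have m: "x' \<mu> = Xm" using x'_eq[of \<mu>] px_eqs(6) mu_bounds q1 J2 by simp
    ultimately have b: "half x' \<mu> < half x' i" "half x' \<mu> \<le> half x' (i + 1)" by (simp_all add: half_def)
    have "pl (cx (half x')) u = (1 - (u - 2 * of_int i)) * half x' i + (u - 2 * of_int i) * half x' (i + 1)"
      using pl_horizontal(1)[of i u] 1 by (simp add: algebra_simps)
    moreover have "(1 - (u - 2 * of_int i)) * half x' \<mu> < (1 - (u - 2 * of_int i)) * half x' i"
      using 1 b by (intro mult_strict_left_mono) auto
    moreover have "(u - 2 * of_int i) * half x' \<mu> \<le> (u - 2 * of_int i) * half x' (i + 1)"
      using 1 b by (intro mult_left_mono) auto
    ultimately have "half x' \<mu> < pl (cx (half x')) u" by (simp add: algebra_simps)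
    thus ?thesis using X by simp
  qed
next
  case (2 j)
  hence j: "0 \<le> j" "j \<le> \<mu>" using u by auto
  have "half x' j = half x' \<mu>" using X pl_vertical(1)[of j u] 2 by simp
  hence "N dvd \<mu> - j" using grid_seqD(6)[OF seq', of \<mu> j] by (simp add: half_def)
  hence "j = \<mu>" using j mu_bounds zdvd_imp_le[of N "\<mu> - j"] by (cases "j = \<mu>") auto
  thus ?thesis using 2 u by auto
qed

text \<open>By \<open>cross'\<close> all crossings of the new diagram lie in the kept part. Apart
  from these, the closed parameter interval repeats only its two ends, which are one and the same
  vertex.\<close>

lemma planar_corner:
  assumes u: "u \<in> {-2..2 * real_of_int (\<mu> + n) - 2}" and w: "w \<in> {-2..2 * real_of_int (\<mu> + n) - 2}"
    and X: "pl (cx (half x')) u = pl (cx (half x')) w" and Y: "pl (cy (half y')) u = pl (cy (half y')) w"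
  shows "u = w \<or> (u = -2 \<or> 2 * of_int \<mu> \<le> u) \<and> (w = -2 \<or> 2 * of_int \<mu> \<le> w)"
proof -
  have low: "2 * of_int \<mu> < s \<and> 2 * of_int \<mu> < t"
    if c: "cross x' y' i j" and s: "2 * of_int i < s" "s < 2 * of_int i + 1" and t: "2 * of_int j - 1 < t" "t < 2 * of_int j"
      and st: "s \<in> {-2..2 * real_of_int (\<mu> + n) - 2}" "t \<in> {-2..2 * real_of_int (\<mu> + n) - 2}" for i j and s t :: real
  proof (rule cross'[OF c])
    fix l m assume lm: "0 \<le> l" "l < n - 1" "0 < m" "m < n" "i mod N = \<mu> + l" "j mod N = \<mu> + m"
    have "real_of_int (2 * i) < of_int (2 * (\<mu> + n) - 2)" "real_of_int (-3) < of_int (2 * i)" 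
       "real_of_int (2 * j - 1) < of_int (2 * (\<mu> + n) - 2)" "real_of_int (-2) < of_int (2 * j)" using s t st by auto
    hence "2 * i < 2 * (\<mu> + n) - 2" "-3 < 2 * i" "2 * j - 1 < 2 * (\<mu> + n) - 2" "-2 < 2 * j"
      by (simp_all only: of_int_less_iff)
    hence ij: "-1 \<le> i" "i \<le> N - 2" "0 \<le> j" "j \<le> N - 1" unfolding N_def by auto
    \<comment> \<open>Index \<open>-1\<close> is the top row, which carries no crossing.\<close>
    have "i \<noteq> -1"
    proof
      assume "i = -1"
      hence "i mod N = N - 1" using zmod_minus1[of N] mu_bounds by simp
      thus False using lm by (simp add: N_def)
    qed
    hence "i = \<mu> + l" "j = \<mu> + m" using ij lm by auto
    thus ?thesis using s t lm by auto
  qed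
  have N2: "2 \<le> N" using grid_seqD(1)[OF seq'] .
  have per: "half x' (i + N) = half x' i" "half y' (i + N) = half y' i" for i by (simp_all add: half_def perx' pery')
  have inj: "half x' i = half x' j \<Longrightarrow> N dvd i - j" "half y' i = half y' j \<Longrightarrow> N dvd i - j" for i j
    using grid_seqD(6,7)[OF seq', of i j] by (simp_all add: half_def)
  show ?thesis
  proof (rule planar_coincidence[OF N2 per inj X Y])
    fix k assume k: "u = w + 2 * real_of_int N * of_int k"
    have Nn: "real_of_int N = of_int \<mu> + of_int n" by (simp add: N_def)
    have Npos: "0 < real_of_int N" using mu_bounds by simp
    consider "k = 0" | "1 \<le> k" | "k \<le> -1" by linarith
    thus ?thesis
    proof cases
      case 2
      hence "2 * real_of_int N * 1 \<le> 2 * real_of_int N * of_int k" using Npos by (intro mult_left_mono) auto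
      hence "u = 2 * of_int N - 2" "w = -2" using k u w Nn by auto
      thus ?thesis using Nn n2 by simp
    next
      case 3
      hence "2 * real_of_int N * of_int k \<le> 2 * real_of_int N * (-1)" using Npos by (intro mult_left_mono) auto
      hence "w = 2 * of_int N - 2" "u = -2" using k u w Nn by auto
      thus ?thesis using Nn n2 by simp
    qed (use k in simp)
  next
    fix i j assume "cross (half x') (half y') i j" "2 * of_int i < u" "u < 2 * of_int i + 1" "2 * of_int j - 1 < w" "w < 2 * of_int j"
    thus ?thesis using low[of i j u w] u w by auto
  next
    fix i j assume "cross (half x') (half y') i j" "2 * of_int i < w" "w < 2 * of_int i + 1" "2 * of_int j - 1 < u" "u < 2 * of_int j"
    thus ?thesis using low[of i j w u] u w by auto
  qed
qed

text \<open>The shifts \<open>(K - 1) / 2\<close> and \<open>(L - 1) / 2\<close> arise by expressing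
  \<open>K * x + K - 1\<close> and \<open>L * y + L - 1\<close> through cell centres.\<close>

lemma new_isotopic:
  assumes h: "heights x y z" and pz: "z n = z 0" and h': "heights x' y' z'" and pz': "z' N = z' 0"
    and nc: "\<And>i j. cross x y i j \<Longrightarrow> z i + y i * (x j - x i) \<noteq> z j"
  shows "ambient_isotopic (knot (half x) (half y) (height x z)) (knot (half x') (half y') (height x' z'))"
proof -
  have zp: "z (i + n) = z i" for i using heights_periodic[OF h perx pery pz] .
  have zp': "z' (i + N) = z' i" for i using heights_periodic[OF h' perx' pery' pz'] .
  have N: "\<mu> + n = N" "\<mu> + n - 1 = N - 1" by (simp_all add: N_def)
  have Lp: "0 < L" using lam by (simp add: L_def)
  have m0: "x' \<mu> = Xm" using x'_eq[of \<mu>] px_eqs(6) mu_bounds q1 J2 by simp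
  have xm1: "x' (-1) = K * x (n - 1) + K - 1" using perx'[of "-1"] x'_old[of "n - 1"] n2 by (simp add: N_def algebra_simps)
  have "corner_move n \<mu> (half x) (half y) (height x z) (half x') (half y') (height x' z')
     (of_int K) (of_int L) (of_int (K - 1) / 2) (of_int (L - 1) / 2) (of_int \<nu> + 1/2) (of_int \<nu> + 1/2)"
  proof
    show "2 \<le> n" "1 \<le> \<mu>" "0 < real_of_int K" "0 < real_of_int L" using n2 mu_bounds q1 J2 K Lp by auto
    show "half x (i + n) = half x i" "half y (i + n) = half y i" "height x z (i + n) = height x z i" for i
      by (simp_all add: half_def height_def perx pery zp)
    show "half x' (i + (\<mu> + n)) = half x' i" "half y' (i + (\<mu> + n)) = half y' i" "height x' z' (i + (\<mu> + n)) = height x' z' i" for i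
      unfolding N by (simp_all add: half_def height_def perx' pery' zp')
    show "height x z (i + 1) = height x z i + half y i * (half x (i + 1) - half x i)"
      "height x' z' (i + 1) = height x' z' i + half y' i * (half x' (i + 1) - half x' i)" for i
      by (rule height_rec[OF h] height_rec[OF h'])+
    show "half x 0 = of_int \<nu> + 1/2" "half y (n - 1) = of_int \<nu> + 1/2" using corner by (simp_all add: half_def \<nu>_def)
    show "half x l < of_int \<nu> + 1/2" if "l \<in> {1..n - 1}" for l using x_lt[OF that] by (simp add: half_def)
    show "half y l < of_int \<nu> + 1/2" if "l \<in> {0..n - 2}" for l using y_lt[OF that] by (simp add: half_def)
    show "half x l \<noteq> half x (n - 1)" if l: "l \<in> {1..n - 2}" for l
    proof
      assume "half x l = half x (n - 1)"
      hence "n dvd (n - 1) - l" using grid_seqD(6)[OF seq, of "n - 1" l] by (simp add: half_def)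
      thus False using l zdvd_imp_le[of n "n - 1 - l"] by auto
    qed
    show "half x' (\<mu> + l) = of_int K * half x l + of_int (K - 1) / 2" if "l \<in> {0..n - 1}" for l
    proof -
      have e: "x' (\<mu> + l) = K * x l + K - 1" using x'_old[of l] that by simp
      show ?thesis unfolding half_def e by (simp add: field_simps)
    qed
    show yy: "half y' (\<mu> + l) = of_int L * half y l + of_int (L - 1) / 2" if "l \<in> {0..n - 2}" for l
    proof -
      have e: "y' (\<mu> + l) = L * y l + L - 1" using y'_old[of l] that by simp
      show ?thesis unfolding half_def e by (simp add: field_simps)
    qed
    show "of_int L * half y l + of_int (L - 1) / 2 < half y' (\<mu> + n - 1)" if l: "l \<in> {0..n - 2}" for l
    proof -
      have "y' (\<mu> + l) < y' (N - 1)" using y'_old[of l] y'_top old_row[OF l] l by (simp add: Y_def)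
      thus ?thesis unfolding yy[OF l, symmetric] N by (simp add: half_def)
    qed
    show "height x z i + half y i * (half x (n - 1) - half x i) \<noteq> height x z (n - 1)"
      if i: "i \<in> {0..n - 3}" and X: "half x (n - 1) \<in> {half x i<..<half x (i + 1)} \<union> {half x (i + 1)<..<half x i}"
        and Y: "half y i \<in> {half y (n - 2)<..<of_int \<nu> + 1/2}" for i
    proof -
      have "cross x y i (n - 1)" using X Y corner unfolding cross_def half_def by (auto simp: \<nu>_def)
      hence "z i + y i * (x (n - 1) - x i) - z (n - 1) \<noteq> 0" using nc by simp
      thus ?thesis using height_cross[of x z i y "n - 1"] by (metis eq_iff_diff_eq_0 of_int_eq_0_iff)
    qed
    have e: "of_int K * (of_int \<nu> + 1/2) + of_int (K - 1) / 2 = half x' \<mu>"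
      unfolding half_def m0 by (simp add: Xm_def field_simps)
    show "u = 2 * of_int \<mu> - 1 \<or> half y' (\<mu> - 1) < pl (cy (half y')) u"
      if "u \<in> {- 1..2 * of_int \<mu> - 1}" "pl (cx (half x')) u = of_int K * (of_int \<nu> + 1/2) + of_int (K - 1) / 2" for u
      using mid_edges that unfolding e by blast
    show "half y' \<mu> < half y' (\<mu> - 1)"
    proof -
      have "y' (\<mu> - 1) = L * \<nu>"
        using y'_eq[of "\<mu> - 1"] py_eqs(3)[of "J - 1"] rho_top mu_bounds J2 q1 by (simp add: \<mu>_def algebra_simps)
      hence "y' \<mu> < y' (\<mu> - 1)" using y'_old[of 0] old_row[of 0] n2 by simp
      thus ?thesis by (simp add: half_def)
    qed
    show "half x' 0 < half x' (- 1)"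
    proof -
      have "x' 0 = 0" using x'_eq[of 0] px_eqs(1)[of 0] xi_0 q1 mu_bounds by simp
      moreover have "0 \<le> K * x (n - 1)" using x_ge[of "n - 1"] K by simp
      ultimately have "x' 0 < x' (-1)" using xm1 K by linarith
      thus ?thesis by (simp add: half_def)
    qed
    show "u = v \<or> (u = - 2 \<or> 2 * of_int \<mu> \<le> u) \<and> (v = - 2 \<or> 2 * of_int \<mu> \<le> v)"
      if "u \<in> {- 2..2 * of_int (\<mu> + n) - 2}" "v \<in> {- 2..2 * of_int (\<mu> + n) - 2}"
        "pl (cx (half x')) u = pl (cx (half x')) v" "pl (cy (half y')) u = pl (cy (half y')) v" for u v
      by (rule planar_corner[OF that])
  qed
  thus ?thesis by (rule corner_move.isotopic)
qed

end

text \<open>The freedom in the heights of the step function is used to close up the area exactly: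
  exchanging the heights of a gap of width 2 and one of width 1 changes the area by their
  difference, so every residue modulo \<open>2 * D\<close> can be reached.\<close>

lemma choose_heights:
  fixes n a M :: int
  defines "\<nu> \<equiv> n - 1" and "K \<equiv> 2 * (n - 1) + 1"
  defines "\<xi> \<equiv> \<lambda>k. k + min n (k div (K - 1))"
  assumes n2: "2 \<le> n" and a: "a < n - 1"
  obtains q \<kappa> h where "(K - 1) * n + 1 \<le> q" "h ` {0..<q} = {1..q}" "M \<le> \<kappa>" "1 \<le> \<kappa>"
    "(\<Sum>k\<in>{0..<q}. h k * (\<xi> (k + 1) - \<xi> k)) + 2 * (q + \<nu> - K * \<nu> - K + 1) + \<nu> + 3 + 2 * K * (\<nu> - a)
       = 2 * \<kappa> * (K * (\<nu> - a) - 2 * \<nu>)"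
proof -
  \<comment> \<open>The area freed per unit of \<open>2 * \<kappa>\<close>, net of the cost of the
    staircases. It is positive because \<open>\<nu> - a \<ge> 1\<close> and
    \<open>K > 2 * \<nu>\<close>.\<close>
  define D where "D = K * (\<nu> - a) - 2 * \<nu>"
  have nu: "1 \<le> \<nu>" and n_eq: "n = \<nu> + 1" and a': "a < \<nu>" using n2 a by (simp_all add: \<nu>_def)
  have K: "K = 2 * \<nu> + 1" by (simp add: K_def \<nu>_def)
  have "K * 1 \<le> K * (\<nu> - a)" using a' K nu by (intro mult_left_mono) auto
  hence D: "1 \<le> D" using K by (simp add: D_def)
  \<comment> \<open>Large enough to pass all old columns, to leave \<open>2 * D\<close> choices for
    \<open>t\<close> beyond them, and, through \<open>q \<le> S0\<close>, to push
    \<open>\<kappa>\<close> above \<open>M\<close>.\<close>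
  define q where "q = K * n + 2 * D * (\<bar>M\<bar> + 2) + 1"
  define g where "g k = \<xi> (k + 1) - \<xi> k" for k
  have g1: "1 \<le> g k" for k
  proof -
    have "k div (K - 1) \<le> (k + 1) div (K - 1)" by (rule zdiv_mono1) (use K nu in auto)
    thus ?thesis by (simp add: g_def \<xi>_def)
  qed
  \<comment> \<open>The step from position \<open>s\<close> jumps over the first old column, so it
    has width 2; from \<open>t0\<close> on all old columns are passed and the widths are 1.\<close>
  define s where "s = K - 2"
  define t0 where "t0 = (K - 1) * n"
  have gs: "g s = 2"
  proof -
    have "(K - 2) div (K - 1) = 0" "(K - 1) div (K - 1) = 1" using K nu by auto
    moreover have "s + 1 = K - 1" by (simp add: s_def)
    ultimately show ?thesis using n2 by (simp add: g_def \<xi>_def s_def)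
  qed
  have gt: "g k = 1" if "t0 \<le> k" for k
  proof -
    have "t0 div (K - 1) \<le> k div (K - 1)" "t0 div (K - 1) \<le> (k + 1) div (K - 1)"
      by (rule zdiv_mono1; use that K nu in simp)+
    moreover have "t0 div (K - 1) = n" using K nu by (simp add: t0_def)
    ultimately show ?thesis by (simp add: g_def \<xi>_def)
  qed
  define S0 where "S0 = (\<Sum>k\<in>{0..<q}. (k + 1) * g k)"
  define C where "C = 2 * (q + \<nu> - K * \<nu> - K + 1) + \<nu> + 3 + 2 * K * (\<nu> - a)"
  define A where "A = S0 + t0 - s + C"
  \<comment> \<open>What \<open>A\<close> lacks to a multiple of \<open>2 * D\<close>: exchanging
    the heights at \<open>s\<close> and \<open>t0 + r\<close>, rather than at \<open>s\<close> and
    \<open>t0\<close>, adds exactly \<open>r\<close>.\<close>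
  define r where "r = (- A) mod (2 * D)"
  have r: "0 \<le> r" "r < 2 * D" using D by (simp_all add: r_def)
  have dv: "2 * D dvd A + r"
    unfolding r_def by (metis add.commute add.right_inverse dvd_eq_mod_eq_0 mod_0 mod_add_left_eq)
  define t where "t = t0 + r"
  define h where "h k = (if k = s then t + 1 else if k = t then s + 1 else k + 1)" for k
  have Mpos: "2 * D * 2 \<le> 2 * D * (\<bar>M\<bar> + 2)" using D by (intro mult_left_mono) auto
  have s0: "0 \<le> s" "s < t0"
  proof -
    show "0 \<le> s" using K nu by (simp add: s_def)
    have "(K - 1) * 1 \<le> (K - 1) * n" using K nu n2 by (intro mult_left_mono) auto
    thus "s < t0" by (simp add: s_def t0_def)
  qed
  have tq: "t0 \<le> t" "t < q"
  proof -
    show "t0 \<le> t" using r by (simp add: t_def)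
    have "t0 + n = K * n" by (simp add: t0_def algebra_simps)
    thus "t < q" unfolding t_def q_def using r Mpos n2 by linarith
  qed
  have img: "h ` {0..<q} = {1..q}"
  proof
    show "h ` {0..<q} \<subseteq> {1..q}" using s0 tq by (auto simp: h_def)
    show "{1..q} \<subseteq> h ` {0..<q}"
    proof
      fix c assume c: "c \<in> {1..q}"
      define k where "k = (if c = s + 1 then t else if c = t + 1 then s else c - 1)"
      have "h k = c" "k \<in> {0..<q}" using c s0 tq by (auto simp: k_def h_def)
      thus "c \<in> h ` {0..<q}" by blast
    qed
  qed
  have sum: "(\<Sum>k\<in>{0..<q}. h k * g k) = S0 + (t - s)"
  proof -
    have "(\<Sum>k\<in>{0..<q}. h k * g k) = (\<Sum>k\<in>{0..<q}. (k + 1) * g k + (if k = s then (t - s) * g s else 0) + (if k = t then (s - t) * g t else 0))"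
      by (rule sum.cong) (use s0 tq in \<open>auto simp: h_def algebra_simps\<close>)
    also have "\<dots> = S0 + (t - s) * g s + (s - t) * g t"
      using s0 tq by (simp add: sum.distrib S0_def)
    finally show ?thesis using gs gt[OF tq(1)] by simp
  qed
  have S0q: "q \<le> S0"
  proof -
    have "(\<Sum>k\<in>{0..<q}. 1) \<le> S0" unfolding S0_def
    proof (rule sum_mono)
      fix k assume "k \<in> {0..<q}"
      thus "1 \<le> (k + 1) * g k" using mult_mono[of 1 "k + 1" 1 "g k"] g1[of k] by simp
    qed
    thus ?thesis using tq s0 by simp
  qed
  have C0: "0 \<le> C"
  proof -
    have "K * \<nu> + K = K * n" unfolding n_eq by (simp add: algebra_simps)
    moreover have "K * n \<le> q" unfolding q_def using Mpos D by linarith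
    moreover have "0 \<le> K * (\<nu> - a)" using K nu a' by simp
    ultimately show ?thesis using nu by (simp add: C_def)
  qed
  define \<kappa> where "\<kappa> = (A + r) div (2 * D)"
  have k: "A + r = 2 * D * \<kappa>" using dv by (simp add: \<kappa>_def)
  have "2 * D * (\<bar>M\<bar> + 2) \<le> q" using n2 K nu by (auto simp: q_def)
  also have "q \<le> A + r" unfolding A_def using S0q C0 s0 r by linarith
  finally have "2 * D * (\<bar>M\<bar> + 2) \<le> 2 * D * \<kappa>" unfolding k .
  hence km: "\<bar>M\<bar> + 2 \<le> \<kappa>" using D by simp
  show thesis
  proof (rule that[of q h \<kappa>])
    have "(K - 1) * n \<le> K * n" using n2 by (simp add: algebra_simps)
    thus "(K - 1) * n + 1 \<le> q" unfolding q_def using Mpos D by linarith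
    show "(\<Sum>k\<in>{0..<q}. h k * (\<xi> (k + 1) - \<xi> k)) + 2 * (q + \<nu> - K * \<nu> - K + 1) + \<nu> + 3 + 2 * K * (\<nu> - a)
       = 2 * \<kappa> * (K * (\<nu> - a) - 2 * \<nu>)"
      using sum k unfolding g_def[symmetric] D_def[symmetric] by (simp add: C_def A_def t_def algebra_simps)
  qed (use km img in auto)
qed

text \<open>The conclusion in terms of sequences, a form that can be transported along shifts and
  reversal of the parametrisation. \<open>x' 0 = 0\<close> and \<open>z' 0 = 0\<close> are the
  normalisations needed to return to a grid and its lift.\<close>

definition stretched :: "int \<Rightarrow> int \<Rightarrow> (int \<Rightarrow> int) \<Rightarrow> (int \<Rightarrow> int) \<Rightarrow> (int \<Rightarrow> int) \<Rightarrow> bool" where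
  "stretched M n x y z \<longleftrightarrow> (\<exists>N x' y' z'. grid_seq N x' y' \<and> x' 0 = 0 \<and> heights x' y' z' \<and> z' 0 = 0 \<and> z' N = 0 \<and>
     rot_seq N x' y' = rot_seq n x y \<and>
     (\<forall>i j. cross x' y' i j \<longrightarrow> M < \<bar>z' i + y' i * (x' j - x' i) - z' j\<bar>) \<and>
     ambient_isotopic (knot (half x) (half y) (height x z)) (knot (half x') (half y') (height x' z')))"

text \<open>The nonzero integers at the old crossings are multiplied by \<open>K * L\<close>, which
  is at least \<open>L = 2 * \<kappa> + 1 > M\<close>.\<close>

lemma stretched_corner:
  assumes seq: "grid_seq n x y" and h: "heights x y z" and pz: "z n = z 0" and corner: "x 0 = n - 1" "y (n - 1) = n - 1"
    and nc: "\<And>i j. cross x y i j \<Longrightarrow> z i + y i * (x j - x i) \<noteq> z j"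
  shows "stretched M n x y z"
proof -
  define K where "K = 2 * (n - 1) + 1"
  have n2: "2 \<le> n" using grid_seqD(1)[OF seq] .
  have an: "x (n - 1) < n - 1"
  proof -
    have "x (n - 1) \<noteq> x 0"
    proof
      assume "x (n - 1) = x 0"
      hence "n dvd n - 1 - 0" by (rule grid_seqD(6)[OF seq])
      thus False using n2 zdvd_imp_le[of n "n - 1"] by auto
    qed
    thus ?thesis using corner grid_seqD(4)[OF seq, of "n - 1"] by simp
  qed
  obtain q \<kappa> p where P: "(K - 1) * n + 1 \<le> q" "p ` {0..<q} = {1..q}" "M \<le> \<kappa>" "1 \<le> \<kappa>"
    "(\<Sum>k\<in>{0..<q}. p k * ((k + 1 + min n ((k + 1) div (K - 1))) - (k + min n (k div (K - 1))))) + 2 * (q + (n - 1) - K * (n - 1) - K + 1) + (n - 1) + 3 + 2 * K * ((n - 1) - x (n - 1))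
       = 2 * \<kappa> * (K * ((n - 1) - x (n - 1)) - 2 * (n - 1))"
    by (rule choose_heights[OF n2 an, folded K_def])
  interpret C: corner_path n K \<kappa> q x y p
    by standard (use seq corner P n2 in \<open>auto simp: K_def\<close>)
  obtain z' where z': "z' 0 = 0" "heights C.x' C.y' z'" using heights_exist by blast
  have old: "(\<Sum>i\<in>{0..<n}. y i * (x (i + 1) - x i)) = 0"
    using heights_sum[OF h, of n 0] pz n2 by simp
  have "z' C.N = z' 0 + (\<Sum>i\<in>{0..<C.N}. C.y' i * (C.x' (i + 1) - C.x' i))"
    using heights_sum[OF z'(2), of C.N 0] C.mu_bounds by simp
  also have "\<dots> = 0" using C.area[OF old] P(5) z'(1) by (simp add: C.\<Sigma>_def C.\<xi>_def C.\<nu>_def)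
  finally have zN: "z' C.N = 0" .
  have pz': "z' (i + C.N) = z' i" for i
    using heights_periodic[OF z'(2) C.perx' C.pery'] zN z'(1) by simp
  have big: "M < \<bar>z' i + C.y' i * (C.x' j - C.x' i) - z' j\<bar>" if c: "cross C.x' C.y' i j" for i j
  proof (rule C.crossing_scaled[OF h z'(2) pz' c])
    fix l m assume lm: "cross x y l m"
      and e: "z' i + C.y' i * (C.x' j - C.x' i) - z' j = K * C.L * (z l + y l * (x m - x l) - z m)"
    have "1 \<le> \<bar>z l + y l * (x m - x l) - z m\<bar>" using nc[OF lm] by simp
    moreover have KL: "C.L \<le> K * C.L" "0 < C.L" using mult_right_mono[of 1 K C.L] P(4) n2 by (auto simp: C.L_def K_def)
    ultimately have "C.L * 1 \<le> (K * C.L) * \<bar>z l + y l * (x m - x l) - z m\<bar>" by (intro mult_mono) auto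
    also have "\<dots> = \<bar>z' i + C.y' i * (C.x' j - C.x' i) - z' j\<bar>" unfolding e using KL by (simp add: abs_mult)
    finally show ?thesis using P(3,4) by (simp add: C.L_def)
  qed
  have "C.x' 0 = 0" using C.x'_eq[of 0] C.px_eqs(1)[of 0] C.xi_0 C.q1 C.mu_bounds by simp
  moreover have "ambient_isotopic (knot (half x) (half y) (height x z)) (knot (half C.x') (half C.y') (height C.x' z'))"
    by (rule C.new_isotopic[OF h pz z'(2) _ nc]) (use zN z'(1) in simp)
  ultimately show ?thesis unfolding stretched_def
    using C.seq' z' zN C.rotation_same big by (intro exI[of _ C.N] exI[of _ C.x'] exI[of _ C.y'] exI[of _ z']) blast
qed

section \<open>Shifting and reversing the parametrisation\<close>

lemma sum_periodic:
  fixes f :: "int \<Rightarrow> int"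
  assumes "\<And>i. f (i + n) = f i" "0 < n"
  shows "(\<Sum>i\<in>{0..<n}. f (i + s)) = (\<Sum>i\<in>{0..<n}. f i)"
proof (rule sum.reindex_bij_witness[of _ "\<lambda>i. (i - s) mod n" "\<lambda>i. (i + s) mod n"])
  show "f ((a + s) mod n) = f (a + s)" for a by (rule periodic_mod) (rule assms)
qed (use assms(2) in \<open>auto simp: mod_simps\<close>)

lemma grid_seq_reindex:
  assumes "grid_seq n x y"
  shows "grid_seq n (\<lambda>i. x (i + s)) (\<lambda>i. y (i + s))" "grid_seq n (\<lambda>i. x (- i)) (\<lambda>i. y (- i - 1))"
proof -
  note D = grid_seqD[OF assms]
  have im: "x ` {0..<n} = {0..<n}" "y ` {0..<n} = {0..<n}" using assms by (simp_all add: grid_seq_def)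
  have img: "(\<lambda>i. f (e * i + s)) ` {0..<n} = {0..<n}"
    if f: "f ` {0..<n} = {0..<n}" and p: "\<And>i. f (i + n) = f i" and e: "e = 1 \<or> e = -1" for f :: "int \<Rightarrow> int" and e s
  proof
    show "(\<lambda>i. f (e * i + s)) ` {0..<n} \<subseteq> {0..<n}" using periodic_perm_range[of f n] f p D(1) by fastforce
    show "{0..<n} \<subseteq> (\<lambda>i. f (e * i + s)) ` {0..<n}"
    proof
      fix c assume "c \<in> {0..<n}"
      then obtain k where k: "f k = c" using f by (metis imageE)
      define i where "i = (e * (k - s)) mod n"
      have "(e * i + s) mod n = (e * (e * (k - s)) + s) mod n" unfolding i_def using e by (elim disjE) (simp_all add: mod_simps)
      also have "e * (e * (k - s)) + s = k" using e by auto
      finally have "f (e * i + s) = f k" using periodic_mod[of f n] p by metis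
      moreover have "i \<in> {0..<n}" using D(1) by (simp add: i_def)
      ultimately show "c \<in> (\<lambda>i. f (e * i + s)) ` {0..<n}" using k by (metis imageI)
    qed
  qed
  have x1: "x (1 + (i + s)) = x (i + s + 1)" for i by (simp add: algebra_simps)
  have per: "x (i + n + s) = x (i + s)" "y (i + n + s) = y (i + s)" for i
    using D(2)[of "i + s"] D(3)[of "i + s"] by (simp_all add: algebra_simps)
  have per2: "x (- (i + n)) = x (- i)" "y (- (i + n) - 1) = y (- i - 1)" for i
  proof -
    have e: "- (i + n) + n = - i" "- (i + n) - 1 + n = - i - 1" by simp_all
    show "x (- (i + n)) = x (- i)" "y (- (i + n) - 1) = y (- i - 1)"
      using D(2)[of "- (i + n)"] D(3)[of "- (i + n) - 1"] unfolding e by simp_all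
  qed
  show "grid_seq n (\<lambda>i. x (i + s)) (\<lambda>i. y (i + s))"
    unfolding grid_seq_def using D(1) per img[OF im(1) D(2), of 1 s] img[OF im(2) D(3), of 1 s] by simp
  show "grid_seq n (\<lambda>i. x (- i)) (\<lambda>i. y (- i - 1))"
    unfolding grid_seq_def using D(1) per2 img[OF im(1) D(2), of "-1" 0] img[OF im(2) D(3), of "-1" "-1"] by simp
qed

lemma rot_shift:
  assumes "grid_seq n x y" shows "rot_seq n (\<lambda>i. x (i + s)) (\<lambda>i. y (i + s)) = rot_seq n x y"
proof -
  note D = grid_seqD[OF assms]
  define f where "f i = sgn (x (i + 1) - x i) * (sgn (y (i + 1) - y i) - sgn (y i - y (i - 1)))" for i
  have "f (i + n) = f i" for i
    using D(2)[of i] D(2)[of "i + 1"] D(3)[of i] D(3)[of "i + 1"] D(3)[of "i - 1"] by (simp add: f_def algebra_simps)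
  hence "(\<Sum>i\<in>{0..<n}. f (i + s)) = (\<Sum>i\<in>{0..<n}. f i)" using D(1) by (intro sum_periodic) auto
  thus ?thesis by (simp add: rot_seq_def f_def algebra_simps)
qed

text \<open>Reversal turns left turns into right turns. Since it will be applied to the old and the
  new curve alike, equality of their rotation numbers survives.\<close>

lemma rot_reverse:
  assumes "grid_seq n x y" shows "rot_seq n (\<lambda>i. x (- i)) (\<lambda>i. y (- i - 1)) = - rot_seq n x y"
proof -
  note D = grid_seqD[OF assms]
  define f where "f i = sgn (x (i + 1) - x i) * (sgn (y (i + 1) - y i) - sgn (y i - y (i - 1)))" for i
  have per: "f (i + n) = f i" for i
    using D(2)[of i] D(2)[of "i + 1"] D(3)[of i] D(3)[of "i + 1"] D(3)[of "i - 1"] by (simp add: f_def algebra_simps)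
  have sg: "sgn (a - b) = - sgn (b - a)" for a b :: int by (simp add: sgn_if)
  have "rot_seq n (\<lambda>i. x (- i)) (\<lambda>i. y (- i - 1)) = (\<Sum>i\<in>{0..<n}. - f (- i - 1))"
    unfolding rot_seq_def
  proof (rule sum.cong)
    fix i :: int
    have e: "- (i + 1) = - i - 1" "- (i - 1) - 1 = - i" "- i - 1 - 1 = - i - 2" "- i - 1 + 1 = - i" "- (i + 1) - 1 = - i - 2" by simp_all
    show "sgn (x (- (i + 1)) - x (- i)) * (sgn (y (- (i + 1) - 1) - y (- i - 1)) - sgn (y (- i - 1) - y (- (i - 1) - 1))) = - f (- i - 1)"
      unfolding f_def e using sg[of "x (- i - 1)" "x (- i)"] sg[of "y (- i - 2)" "y (- i - 1)"] sg[of "y (- i - 1)" "y (- i)"] by (simp add: algebra_simps)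
  qed simp
  also have "\<dots> = - (\<Sum>i\<in>{0..<n}. f i)"
  proof -
    have "(\<Sum>i\<in>{0..<n}. f (- i - 1)) = (\<Sum>i\<in>{0..<n}. f i)"
      by (rule sum.reindex_bij_witness[of _ "\<lambda>i. n - 1 - i" "\<lambda>i. n - 1 - i"]) (use per[of "- _ - 1"] in \<open>auto simp: algebra_simps\<close>)
    thus ?thesis by (simp add: sum_negf)
  qed
  finally show ?thesis by (simp add: rot_seq_def f_def)
qed

lemma knot_shift: "knot (\<lambda>i. x (i + s)) (\<lambda>i. y (i + s)) (\<lambda>i. z (i + s)) = knot x y z"
proof -
  define V where "V = tri (cx x) (cy y) (cx z)"
  have e: "(k + 2 * s + 1) div 2 = (k + 1) div 2 + s" "(k + 2 * s) div 2 = k div 2 + s" for k by presburger+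
  have "tri (cx (\<lambda>i. x (i + s))) (cy (\<lambda>i. y (i + s))) (cx (\<lambda>i. z (i + s))) = (\<lambda>k. V (k + 2 * s))"
    unfolding V_def tri_def cx_def cy_def e ..
  moreover have "range (pl (\<lambda>k. V (k + 2 * s))) = range (pl V)"
  proof -
    have "pl (\<lambda>k. V (k + 2 * s)) = pl V \<circ> (\<lambda>u. u + of_int (2 * s))" by (rule ext) (simp add: pl_shift[symmetric])
    moreover have "surj (\<lambda>u::real. u + of_int (2 * s))" by (rule surjI[of _ "\<lambda>u. u - of_int (2 * s)"]) simp
    ultimately show ?thesis by (metis image_comp)
  qed
  ultimately show ?thesis by (simp add: knot_def V_def)
qed

text \<open>The offset in \<open>y (- i - 1)\<close> keeps row \<open>i\<close> between the columns
  with indices \<open>i\<close> and \<open>i + 1\<close>.\<close>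

lemma knot_reverse: "knot (\<lambda>i. x (- i)) (\<lambda>i. y (- i - 1)) (\<lambda>i. z (- i)) = knot x y z"
proof -
  define V where "V = tri (cx x) (cy y) (cx z)"
  have e: "(-1 - k + 1) div 2 = - ((k + 1) div 2)" "(-1 - k) div 2 = - (k div 2) - 1" for k :: int by presburger+
  have "tri (cx (\<lambda>i. x (- i))) (cy (\<lambda>i. y (- i - 1))) (cx (\<lambda>i. z (- i))) = (\<lambda>k. V (-1 - k))"
    unfolding V_def tri_def cx_def cy_def e ..
  moreover have "range (pl (\<lambda>k. V (-1 - k))) = range (pl V)"
  proof -
    have "pl (\<lambda>k. V (-1 - k)) = pl V \<circ> (\<lambda>u. -1 - u)" by (rule ext) (simp add: pl_reflect)
    moreover have "surj (\<lambda>u::real. -1 - u)" by (rule surjI[of _ "\<lambda>u. -1 - u"]) simp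
    ultimately show ?thesis by (metis image_comp)
  qed
  ultimately show ?thesis by (simp add: knot_def V_def)
qed

lemma heights_reverse: "heights x y z \<Longrightarrow> heights (\<lambda>i. x (- i)) (\<lambda>i. y (- i - 1)) (\<lambda>i. z (- i))"
  unfolding heights_def
proof
  fix i :: int assume "\<forall>i. z (i + 1) = z i + y i * (x (i + 1) - x i)"
  note h = this[rule_format, of "- i - 1"]
  have e: "- i - 1 + 1 = - i" "- (i + 1) = - i - 1" by simp_all
  show "z (- (i + 1)) = z (- i) + y (- i - 1) * (x (- (i + 1)) - x (- i))"
    using h unfolding e by (simp add: right_diff_distrib)
qed

lemma cross_reverse: "cross (\<lambda>i. x (- i)) (\<lambda>i. y (- i - 1)) i j \<longleftrightarrow> cross x y (- i - 1) (- j)"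
proof -
  have "- (j - 1) - 1 = - j" "- i - 1 + 1 = - i" "- (i + 1) = - i - 1" by simp_all
  thus ?thesis unfolding cross_def by (auto simp only:)
qed

text \<open>Both sides extrapolate the height along the same horizontal edge to column
  \<open>x (- j)\<close>, starting from its two ends.\<close>

lemma cross_value_reverse:
  fixes i j :: int
  assumes "heights x y z"
  shows "z (- i) + y (- i - 1) * (x (- j) - x (- i)) = z (- i - 1) + y (- i - 1) * (x (- j) - x (- i - 1))"
  using assms[unfolded heights_def, rule_format, of "- i - 1"] by (simp add: algebra_simps)

lemma stretched_shift:
  assumes "grid_seq n x y" "stretched M n (\<lambda>i. x (i + s)) (\<lambda>i. y (i + s)) (\<lambda>i. z (i + s))"
  shows "stretched M n x y z"
proof -
  have "knot (half (\<lambda>i. x (i + s))) (half (\<lambda>i. y (i + s))) (height (\<lambda>i. x (i + s)) (\<lambda>i. z (i + s))) = knot (half x) (half y) (height x z)"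
    using knot_shift[of "half x" s "half y" "height x z"] by (simp add: half_def[abs_def] height_def[abs_def])
  thus ?thesis using assms(2) rot_shift[OF assms(1), of s] by (simp add: stretched_def)
qed

lemma stretched_reverse:
  assumes "grid_seq n x y" "stretched M n (\<lambda>i. x (- i)) (\<lambda>i. y (- i - 1)) (\<lambda>i. z (- i))"
  shows "stretched M n x y z"
proof -
  have k: "knot (half (\<lambda>i. x (- i))) (half (\<lambda>i. y (- i - 1))) (height (\<lambda>i. x (- i)) (\<lambda>i. z (- i))) = knot (half x) (half y) (height x z)" for x y z
    using knot_reverse[of "half x" "half y" "height x z"] by (simp add: half_def[abs_def] height_def[abs_def])
  obtain N x' y' z' where *: "grid_seq N x' y'" "x' 0 = 0" "heights x' y' z'" "z' 0 = 0" "z' N = 0"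
    "rot_seq N x' y' = rot_seq n (\<lambda>i. x (- i)) (\<lambda>i. y (- i - 1))"
    "\<And>i j. cross x' y' i j \<Longrightarrow> M < \<bar>z' i + y' i * (x' j - x' i) - z' j\<bar>"
    "ambient_isotopic (knot (half x) (half y) (height x z)) (knot (half x') (half y') (height x' z'))"
    using assms(2) unfolding stretched_def k by blast
  have "z' (- N) = z' (- N + N)"
    by (rule heights_periodic[OF *(3), symmetric]) (use *(4,5) grid_seqD(2,3)[OF *(1)] in auto)
  hence zN: "z' (- N) = 0" using *(4) by simp
  have big: "M < \<bar>z' (- i) + y' (- i - 1) * (x' (- j) - x' (- i)) - z' (- j)\<bar>"
    if "cross (\<lambda>i. x' (- i)) (\<lambda>i. y' (- i - 1)) i j" for i j
    using *(7)[OF that[unfolded cross_reverse]] unfolding cross_value_reverse[OF *(3)] .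
  show ?thesis unfolding stretched_def
    by (rule exI[of _ N], rule exI[of _ "\<lambda>i. x' (- i)"], rule exI[of _ "\<lambda>i. y' (- i - 1)"], rule exI[of _ "\<lambda>i. z' (- i)"])
       (use *(2,4,6,8) zN big grid_seq_reindex(2)[OF *(1)] heights_reverse[OF *(3)] rot_reverse[OF *(1)] rot_reverse[OF assms(1)] in \<open>simp add: k\<close>)
qed

text \<open>The corner is an O marking: the curve arrives along the top edge and leaves down the
  right edge, turning clockwise. A shift of the index gives it the position assumed in
  \<open>stretched_corner\<close>.\<close>

lemma stretched_cw:
  assumes seq: "grid_seq n x y" and h: "heights x y z" and pz: "z n = z 0" and corner: "x i = n - 1" "y (i - 1) = n - 1"
    and nc: "\<And>i j. cross x y i j \<Longrightarrow> z i + y i * (x j - x i) \<noteq> z j"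
  shows "stretched M n x y z"
proof (rule stretched_shift[OF seq, of _ i], rule stretched_corner)
  show "grid_seq n (\<lambda>k. x (k + i)) (\<lambda>k. y (k + i))" by (rule grid_seq_reindex(1)[OF seq])
  show "heights (\<lambda>k. x (k + i)) (\<lambda>k. y (k + i)) (\<lambda>k. z (k + i))"
    unfolding heights_def
  proof
    fix k show "z (k + 1 + i) = z (k + i) + y (k + i) * (x (k + 1 + i) - x (k + i))"
      using h[unfolded heights_def, rule_format, of "k + i"] by (simp add: algebra_simps)
  qed
  show "z (n + i) = z (0 + i)"
    using heights_periodic[OF h _ _ pz, of i] grid_seqD(2,3)[OF seq] by (simp add: add.commute)
  show "x (0 + i) = n - 1" "y (n - 1 + i) = n - 1"
    using corner grid_seqD(3)[OF seq, of "i - 1"] by (simp_all add: algebra_simps)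
  fix k j assume "cross (\<lambda>k. x (k + i)) (\<lambda>k. y (k + i)) k j"
  hence "cross x y (k + i) (j + i)" unfolding cross_def by (simp add: algebra_simps)
  thus "z (k + i) + y (k + i) * (x (j + i) - x (k + i)) \<noteq> z (j + i)" by (rule nc)
qed

text \<open>The corner is an X marking, where the curve comes up the right edge and turns left into
  the top edge; reversing the curve leads to the clockwise case.\<close>

lemma stretched_ccw:
  assumes seq: "grid_seq n x y" and h: "heights x y z" and pz: "z n = z 0" and corner: "x i = n - 1" "y i = n - 1"
    and nc: "\<And>i j. cross x y i j \<Longrightarrow> z i + y i * (x j - x i) \<noteq> z j"
  shows "stretched M n x y z"
proof (rule stretched_reverse[OF seq], rule stretched_cw[where i = "- i"])
  show "grid_seq n (\<lambda>i. x (- i)) (\<lambda>i. y (- i - 1))" by (rule grid_seq_reindex(2)[OF seq])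
  show "heights (\<lambda>i. x (- i)) (\<lambda>i. y (- i - 1)) (\<lambda>i. z (- i))" by (rule heights_reverse[OF h])
  show "z (- n) = z (- 0)"
    using heights_periodic[OF h _ _ pz, of "- n"] grid_seqD(2,3)[OF seq] by simp
  show "x (- (- i)) = n - 1" "y (- (- i - 1) - 1) = n - 1" using corner by simp_all
  fix k j assume "cross (\<lambda>i. x (- i)) (\<lambda>i. y (- i - 1)) k j"
  from nc[OF this[unfolded cross_reverse]]
  show "z (- k) + y (- k - 1) * (x (- j) - x (- k)) \<noteq> z (- j)" unfolding cross_value_reverse[OF h] .
qed

section \<open>Back to grid diagrams\<close>

theorem theorem8p1:
  fixes G :: grid and M :: real
  assumes "lagrangian_grid G"
    and "marking_upper_right G"
    and "M > 0"
  shows "\<exists>G'. lagrangian_grid G' \<and>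
           ambient_isotopic (lift_knot G) (lift_knot G') \<and>
           rotation_number G' = rotation_number G \<and>
           (\<forall>\<theta>0\<in>{0..<2*pi}. \<forall>\<theta>1\<in>{0..<2*pi}.
              \<theta>0 \<noteq> \<theta>1 \<and> gamma G' \<theta>0 = gamma G' \<theta>1 \<longrightarrow> \<bar>tint G' \<theta>0 \<theta>1\<bar> > M)"
proof -
  define n where "n = int (gsize G)"
  obtain x y where seq: "grid_seq n x y" and rep: "represents G n x y"
    using immersed_grid_sequences[of G] assms(1) unfolding lagrangian_grid_def n_def by blast
  interpret R: represented_grid G n x y by standard (rule seq rep)+
  obtain z where z: "z 0 = 0" "heights x y z" using heights_exist by blast
  have zn: "z n = 0" using R.total[OF z(2)] assms(1) z(1) by (simp add: lagrangian_grid_def)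
  have nc: "z i + y i * (x j - x i) \<noteq> z j" if c: "cross x y i j" for i j
  proof (rule R.cross_double_point[OF z(2) _ c])
    fix \<theta>0 \<theta>1 assume H: "\<theta>0 \<in> {0..<2*pi}" "\<theta>1 \<in> {0..<2*pi}" "\<theta>0 \<noteq> \<theta>1" "gamma G \<theta>0 = gamma G \<theta>1"
      "\<bar>tint G \<theta>0 \<theta>1\<bar> = \<bar>of_int (z i + y i * (x j - x i) - z j)\<bar>"
    hence "tint G \<theta>0 \<theta>1 \<noteq> 0" using assms(1) unfolding lagrangian_grid_def by blast
    show ?thesis
    proof
      assume "z i + y i * (x j - x i) = z j"
      hence "z i + y i * (x j - x i) - z j = 0" by simp
      hence "\<bar>tint G \<theta>0 \<theta>1\<bar> = 0" using H(5) by (simp only: of_int_0 abs_zero)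
      thus False using \<open>tint G \<theta>0 \<theta>1 \<noteq> 0\<close> by simp
    qed
  qed (use zn z in simp)
  have "\<exists>i\<in>{0..<n}. nat (x i) = nat n - 1" using R.x_onto[of "nat n - 1"] R.n2 by simp
  then obtain i where "nat (x i) = nat n - 1" by blast
  hence xi: "x i = n - 1" using R.xr[of i] R.n2 by linarith
  have nn: "nat (x i) = gsize G - 1" using xi R.n2 by (simp add: n_def nat_diff_distrib)
  have top: "y k = n - 1" if "nat (y k) = gsize G - 1" for k using that R.yr[of k] R.n2 by (simp add: n_def)
  have "stretched \<lceil>M\<rceil> n x y z"
    using assms(2) unfolding marking_upper_right_def
  proof
    assume "Xrow G (gsize G - 1) = gsize G - 1"
    hence "y i = n - 1" using R.Xrow[of i] nn top by simp
    thus ?thesis using stretched_ccw[OF seq z(2) _ xi _ nc] zn z by simp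
  next
    assume "Orow G (gsize G - 1) = gsize G - 1"
    hence "y (i - 1) = n - 1" using R.Orow[of "i - 1"] nn top by simp
    thus ?thesis using stretched_cw[OF seq z(2) _ xi _ nc] zn z by simp
  qed
  then obtain N x' y' z' where S: "grid_seq N x' y'" "x' 0 = 0" "heights x' y' z'" "z' 0 = 0" "z' N = 0"
    "rot_seq N x' y' = rot_seq n x y"
    "\<And>i j. cross x' y' i j \<Longrightarrow> \<lceil>M\<rceil> < \<bar>z' i + y' i * (x' j - x' i) - z' j\<bar>"
    "ambient_isotopic (knot (half x) (half y) (height x z)) (knot (half x') (half y') (height x' z'))"
    unfolding stretched_def by blast
  obtain G' where rep': "represents G' N x' y'" using represented_exists[OF S(1,2)] by blast
  interpret R': represented_grid G' N x' y' by standard (rule S(1) rep')+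
  have zN: "z' N = z' 0" using S by simp
  have big: "M < \<bar>tint G' \<theta>0 \<theta>1\<bar>"
    if H: "\<theta>0 \<in> {0..<2*pi}" "\<theta>1 \<in> {0..<2*pi}" "\<theta>0 \<noteq> \<theta>1" "gamma G' \<theta>0 = gamma G' \<theta>1" for \<theta>0 \<theta>1
  proof -
    obtain i j where c: "cross x' y' i j" and t: "\<bar>tint G' \<theta>0 \<theta>1\<bar> = \<bar>of_int (z' i + y' i * (x' j - x' i) - z' j)\<bar>"
      using R'.double_point_cross[OF S(3) zN H] by blast
    have "M \<le> of_int \<lceil>M\<rceil>" by simp
    also have "\<dots> < of_int \<bar>z' i + y' i * (x' j - x' i) - z' j\<bar>" using S(7)[OF c] by (simp only: of_int_less_iff)
    finally show ?thesis unfolding t by simp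
  qed
  have "lagrangian_grid G'"
    unfolding lagrangian_grid_def using R'.immersed R'.total[OF S(3)] zN big assms(3) by fastforce
  moreover have "ambient_isotopic (lift_knot G) (lift_knot G')"
    using S(8) R.lift_knot_eq[OF z(2)] R'.lift_knot_eq[OF S(3)] zn z S(4,5) by simp
  moreover have "rotation_number G' = rotation_number G"
    unfolding R.rotation R'.rotation S(6) ..
  ultimately show ?thesis using big by blast
qed

end
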